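(* Let $\mathbf f\in\mathbb R^n$, $\boldsymbol\xi\sim\mathcal N(\mathbf 0,\sigma^2I_{n\times n})$ with $\sigma>0$, $\mathbf y=\mathbf f+\boldsymbol\xi$, and $\mathbb X\in\mathbb R^{n\times p}$. Let $p\ge 2$ and $\lambda\ge 2\sigma\sqrt{2\log(p)/n}$. Assume that the diagonal elements of the matrix $\frac1n\mathbb X^T\mathbb X$ are not greater than $1$. Let $\hat{\boldsymbol\beta}$ be the LASSO estimator with tuning parameter $\lambda$, $$\hat{\boldsymbol\beta}\in\operatorname*{argmin}_{\boldsymbol\beta\in\mathbb R^p}\left(\|\mathbf y-\mathbb X\boldsymbol\beta\|^2+2\lambda|\boldsymbol\beta|_1\right).$$ Then for any $\delta\in(0,1)$, with probability at least $1-\delta$, $$\|\mathbb X\hat{\boldsymbol\beta}-\mathbf f\|\le\min_{S\subset\{1,\dots,p\}}\left[\min_{\boldsymbol\beta\in\mathbb R^p:\ \operatorname{Supp}(\boldsymbol\beta)=S}\|\mathbb X\boldsymbol\beta-\mathbf f\|+\frac{3\lambda\sqrt{|S|}}{2\kappa(S,3)}\right]+\frac{\sigma\,\Phi^{-1}(1-\delta)}{\sqrt n},$$ where $\Phi^{-1}(1-\delta)\le\sqrt{2\log(1/\delta)}$. Furthermore, $$\mathbb E\|\mathbb X\hat{\boldsymbol\beta}-\mathbf f\|\le\min_{S\subset\{1,\dots,p\}}\left[\min_{\boldsymbol\beta\in\mathbb R^p:\ \operatorname{Supp}(\boldsymbol\beta)=S}\|\mathbb X\boldsymbol\beta-\mathbf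 f\|+\frac{3\lambda\sqrt{|S|}}{2\kappa(S,3)}\right]+\frac{\sigma}{\sqrt{2\pi n}}.$$
   Context: For $\mathbf u\in\mathbb R^n$, $\|\mathbf u\|$ is the scaled Euclidean norm, $\|\mathbf u\|^2=\frac1n\sum_{i=1}^nu_i^2$; $|\cdot|_1$ and $|\cdot|_2$ are the $\ell_1$ and Euclidean norms. $\operatorname{Supp}(\boldsymbol\beta)$ is the support of $\boldsymbol\beta$ (the set of indices of its nonzero components); $|S|$ is the cardinality of $S$; for $\mathbf u\in\mathbb R^p$, $\mathbf u_S$ is the vector with components $u_j$ for $j\in S$ and $0$ otherwise. $\Phi$ is the $\mathcal N(0,1)$ cumulative distribution function. For any $S\subset\{1,\dots,p\}$ and $c_0>0$, the Restricted Eigenvalue constant $\kappa(S,c_0)\ge0$ is defined by $$\kappa^2(S,c_0)=\min_{\boldsymbol\Delta\in\mathbb R^p:\ |\boldsymbol\Delta_{S^c}|_1\le c_0|\boldsymbol\Delta_S|_1}\frac{\|\mathbb X\boldsymbol\Delta\|^2}{|\boldsymbol\Delta|_2^2},$$ the minimum being over nonzero $\boldsymbol\Delta$. Convention: $a/0=+\infty$ for any $a>0$.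
   Formalization: In the probability bound, Φ⁻¹(1−δ) is replaced by max(0, Φ⁻¹(1−δ)), which changes it only for δ > 1/2; there the claim as stated fails (f = 0, S = ∅ makes the right-hand side negative). *)

theory Defs
  imports "HOL-Probability.Probability"
begin

definition scaled_norm :: "real ^ 'n::finite \<Rightarrow> real" where
  "scaled_norm u = sqrt ((1 / real CARD('n)) * (\<Sum>i\<in>UNIV. (u $ i)\<^sup>2))"

definition l1_norm :: "real ^ 'p::finite \<Rightarrow> real" where
  "l1_norm b = (\<Sum>j\<in>UNIV. \<bar>b $ j\<bar>)"

definition Supp :: "real ^ 'p::finite \<Rightarrow> 'p set" where
  "Supp b = {j. b $ j \<noteq> 0}"

definition restrict_vec :: "real ^ 'p::finite \<Rightarrow> 'p set \<Rightarrow> real ^ 'p" where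
  "restrict_vec u S = (\<chi> j. if j \<in> S then u $ j else 0)"

definition isotropic_normal_density :: "real \<Rightarrow> real ^ 'n::finite \<Rightarrow> real" where
  "isotropic_normal_density \<sigma> x =
     exp (- (norm x)\<^sup>2 / (2 * \<sigma>\<^sup>2)) / sqrt (2 * pi * \<sigma>\<^sup>2) ^ CARD('n)"

text \<open>\<open>Phi\<close> is a strictly increasing bijection onto the open unit interval, so for \<open>0 < q < 1\<close>
  the term \<open>inv Phi q\<close> is the unique \<open>q\<close>-quantile. It is negative for \<open>q < 1/2\<close>. A high-probability
  bound on a norm cannot shrink without limit as the required probability tends to \<open>0\<close>, so at
  level \<open>1 - \<delta>\<close> the deviation term is to be taken as \<open>max 0 (inv Phi (1 - \<delta>))\<close>, which is
  \<open>inv Phi (1 - \<delta>)\<close> itself for \<open>\<delta> \<le> 1/2\<close>.\<close>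

definition Phi :: "real \<Rightarrow> real" where
  "Phi = cdf std_normal_distribution"

text \<open>The set of LASSO estimators; the minimiser need not be unique.\<close>

definition lasso :: "real ^ 'p::finite ^ 'n::finite \<Rightarrow> real ^ 'n \<Rightarrow> real \<Rightarrow> (real ^ 'p) set" where
  "lasso X y lam =
     {b. is_arg_min (\<lambda>b. (scaled_norm (y - X *v b))\<^sup>2 + 2 * lam * l1_norm b) (\<lambda>_. True) b}"

text \<open>The values are extended reals: for \<open>S = {}\<close> no nonzero vector is admissible and the
  infimum over the empty set is \<open>\<infinity>\<close>. For nonempty \<open>S\<close> the infimum is a real number and is
  attained.\<close>

definition restricted_eigenvalue_sq ::
    "real ^ 'p::finite ^ 'n::finite \<Rightarrow> 'p set \<Rightarrow> real \<Rightarrow> ereal" where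
  "restricted_eigenvalue_sq X S c\<^sub>0 =
     (INF \<Delta> \<in> {\<Delta>. \<Delta> \<noteq> 0 \<and> l1_norm (restrict_vec \<Delta> (- S)) \<le> c\<^sub>0 * l1_norm (restrict_vec \<Delta> S)}.
        ereal ((scaled_norm (X *v \<Delta>))\<^sup>2 / (norm \<Delta>)\<^sup>2))"

definition restricted_eigenvalue ::
    "real ^ 'p::finite ^ 'n::finite \<Rightarrow> 'p set \<Rightarrow> real \<Rightarrow> ereal" where
  "restricted_eigenvalue X S c\<^sub>0 =
     (THE \<kappa>. 0 \<le> \<kappa> \<and> \<kappa>\<^sup>2 = restricted_eigenvalue_sq X S c\<^sub>0)"

lemma ex1_ereal_sqrt:
  fixes r :: ereal
  assumes "0 \<le> r"
  shows "\<exists>!k. 0 \<le> k \<and> k\<^sup>2 = r"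
proof (rule ex_ex1I)
  show "\<exists>k. 0 \<le> k \<and> k\<^sup>2 = r"
  proof (cases r)
    case (real x)
    with assms have "(ereal (sqrt x))\<^sup>2 = r" "0 \<le> ereal (sqrt x)" by auto
    then show ?thesis by blast
  next
    case PInf
    then have "(\<infinity>::ereal)\<^sup>2 = r" by (simp add: power2_eq_square)
    then show ?thesis by (intro exI[of _ "\<infinity>"]) auto
  next
    case MInf
    with assms show ?thesis by simp
  qed
next
  fix k l :: ereal
  assume "0 \<le> k \<and> k\<^sup>2 = r" "0 \<le> l \<and> l\<^sup>2 = r"
  then have "k\<^sup>2 = l\<^sup>2" "0 \<le> k" "0 \<le> l" by auto
  then show "k = l"
    by (cases k; cases l) (auto simp: power2_eq_square ereal_mult_infty split: if_splits
          dest: power2_eq_imp_eq[of _ _, unfolded power2_eq_square])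
qed

lemma restricted_eigenvalue_nonneg: "0 \<le> restricted_eigenvalue X S c\<^sub>0"
  and restricted_eigenvalue_square:
    "(restricted_eigenvalue X S c\<^sub>0)\<^sup>2 = restricted_eigenvalue_sq X S c\<^sub>0"
proof -
  have "0 \<le> restricted_eigenvalue_sq X S c\<^sub>0"
    unfolding restricted_eigenvalue_sq_def by (rule INF_greatest) simp
  from theI'[OF ex1_ereal_sqrt[OF this]]
  show "0 \<le> restricted_eigenvalue X S c\<^sub>0"
    and "(restricted_eigenvalue X S c\<^sub>0)\<^sup>2 = restricted_eigenvalue_sq X S c\<^sub>0"
    unfolding restricted_eigenvalue_def by auto
qed

text \<open>The quantities in the oracle bound are extended reals because \<open>\<kappa>(S,3)\<close> may be \<open>0\<close> or \<open>\<infinity>\<close>;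
  in \<^typ>\<open>ereal\<close>, \<open>a / 0 = \<infinity>\<close> for \<open>a > 0\<close> and \<open>a / \<infinity> = 0\<close> for real \<open>a\<close>.
  The vectors with support exactly \<open>S\<close> form a set that is not closed, so the inner minimum need
  not be attained and is taken as an infimum.\<close>

definition oracle_bound ::
    "real ^ 'p::finite ^ 'n::finite \<Rightarrow> real ^ 'n \<Rightarrow> real \<Rightarrow> ereal" where
  "oracle_bound X f lam =
     (MIN S \<in> UNIV. (INF b \<in> {b. Supp b = S}. ereal (scaled_norm (X *v b - f))) +
        ereal (3 * lam * sqrt (real (card S))) / (2 * restricted_eigenvalue X S 3))"

end

theory Submission
  imports Defs "HOL-Real_Asymp.Real_Asymp"
begin

text \<open>
  Let \<open>A\<close> be the prediction error \<open>\<parallel>X \<beta>hat - f\<parallel>\<close> in the scaled norm. The proof splits into a deterministic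
  bound for \<open>A\<close> and a sharp concentration statement about the noise.

  The deterministic part compares \<open>\<xi>\<close> with the convex set \<open>C\<close> of noise vectors \<open>z\<close> for which every
  correlation \<open>\<bar>x\<^sub>j \<bullet> z\<bar> / n\<close> with a column of \<open>X\<close> is at most \<open>lam / 2\<close>. On \<open>C\<close> the usual argument for the
  LASSO gives the oracle inequality with no remainder. For general \<open>\<xi>\<close> with projection \<open>z\<close> on \<open>C\<close>, the part
  \<open>\<xi> - z\<close> enters the basic inequality only through \<open>(\<xi> - z) \<bullet> X u\<close>, which Cauchy-Schwarz bounds. Since
  the objective is strongly convex in the fitted vector, the basic inequality has \<open>\<parallel>X u\<parallel>\<^sup>2\<close> to spare, and
  completing the square absorbs both this term and the penalty. The outcome is
  \<open>A \<le> oracle_bound + dist(\<xi>, C) / sqrt n\<close> for every \<open>\<xi>\<close> (\<open>lasso_oracle_bound\<close>).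

  A union bound over the columns, in which the constant of the Gaussian tail has to be tracked down to
  \<open>p = 2\<close>, shows that \<open>C\<close> has probability at least \<open>1/2\<close> (\<open>std_gauss_slabs\<close>). Gaussian isoperimetry
  then says that \<open>dist(\<xi>, C) / \<sigma>\<close> exceeds \<open>t\<close> with probability at most \<open>1 - Phi t\<close>, as if \<open>C\<close> were a half-space
  through the origin. Taking \<open>t = max 0 (inv Phi (1 - \<delta>))\<close> gives the first claim, and integrating \<open>1 - Phi t\<close>
  over \<open>t \<ge> 0\<close> gives \<open>1 / sqrt (2 * pi)\<close>, hence the bound in expectation.

  Isoperimetry is obtained by Bobkov's method. With the profile \<open>I = phi \<circ> inv Phi\<close>, the functional inequality
  \<open>I (E f) \<le> E (sqrt (I(f)\<^sup>2 + \<bar>\<nabla>f\<bar>\<^sup>2))\<close> is proved for a two-point space by calculus, it passes to products by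
  Minkowski's inequality, the central limit theorem carries it from sums of random signs to the Gaussian
  line, and a second use of the product argument carries it to Euclidean space. It is then applied to
  \<open>f = Phi (R * (r - F))\<close>, where \<open>F\<close> is a smooth approximation of the distance to \<open>C\<close>: writing \<open>U(r) = E f\<close>,
  the root is at most \<open>sqrt (1 + R\<^sup>2) * phi (R * (r - F))\<close>, whose expectation is \<open>U'(r) * sqrt (1 + R\<^sup>2) / R\<close>. So the
  inequality becomes the differential inequality \<open>(inv Phi (U r))' \<ge> R / sqrt (1 + R\<^sup>2)\<close>. Letting \<open>R\<close> tend to
  infinity while \<open>F\<close> tends to the distance gives the claim for \<open>C\<close> (\<open>gaussian_isoperimetry\<close>).
\<close>

section \<open>The normal distribution function and the isoperimetric profile\<close>

abbreviation phi :: "real \<Rightarrow> real" where "phi \<equiv> std_normal_density"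

abbreviation gauss :: "real measure" where "gauss \<equiv> std_normal_distribution"

lemma real_distribution_gauss: "real_distribution gauss"
  by (rule real_dist_normal_dist)

lemma prob_space_gauss: "prob_space gauss"
  using real_distribution_gauss by (simp add: real_distribution_def)

lemma phi_pos: "phi x > 0"
  by (simp add: normal_density_pos)

lemma phi_nonzero [simp]: "phi x \<noteq> 0"
  using phi_pos[of x] by simp

lemma phi_minus: "phi (-x) = phi x"
  by (simp add: std_normal_density_def)

lemma phi_has_real_derivative [derivative_intros]:
  assumes "(g has_real_derivative g') (at x within S)"
  shows "((\<lambda>x. phi (g x)) has_real_derivative (- g x * phi (g x) * g')) (at x within S)"
  unfolding std_normal_density_def
  by (rule derivative_eq_intros assms refl | simp)+

lemma continuous_on_phi [continuous_intros]:
  "continuous_on S g \<Longrightarrow> continuous_on S (\<lambda>x. phi (g x))"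
  unfolding std_normal_density_def by (intro continuous_intros) auto

lemma phi_le_half: "phi x \<le> 1/2"
proof -
  have "(2::real) \<le> sqrt (2*pi)"
    by (rule real_le_rsqrt) (use pi_ge_two in simp)
  then have "1 / sqrt (2*pi) * exp (- x\<^sup>2 / 2) \<le> (1/2) * 1"
    by (intro mult_mono) (auto simp: field_simps)
  then show ?thesis by (simp add: std_normal_density_def)
qed

lemma phi_le_one: "phi x \<le> 1"
  using phi_le_half[of x] by simp

lemma abs_mult_phi_le_one: "\<bar>x * phi x\<bar> \<le> 1"
proof -
  have "\<bar>x\<bar> \<le> 1 + x\<^sup>2 / 2"
    using zero_le_power2[of "\<bar>x\<bar> - 1"] by (simp add: power2_diff)
  also have "\<dots> \<le> exp (x\<^sup>2 / 2)" by (rule exp_ge_add_one_self)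
  finally have "\<bar>x\<bar> * exp (- x\<^sup>2 / 2) \<le> 1"
    by (simp add: exp_minus field_simps)
  moreover have "1 / sqrt (2*pi) \<le> 1"
    using pi_ge_two by (simp add: field_simps)
  ultimately have "1 / sqrt (2*pi) * (\<bar>x\<bar> * exp (- x\<^sup>2 / 2)) \<le> 1 * 1"
    by (intro mult_mono) auto
  then show ?thesis by (simp add: std_normal_density_def abs_mult mult_ac)
qed

lemma Phi_diff:
  assumes "a \<le> b"
  shows "Phi b - Phi a = integral {a..b} phi"
proof (cases "a = b")
  case False
  interpret G: real_distribution gauss by (rule real_distribution_gauss)
  have "Phi b - Phi a = measure gauss {a<..b}"
    unfolding Phi_def using False assms by (subst G.cdf_diff_eq) auto
  also have "\<dots> = (\<integral>x. indicator {a<..b} x \<partial>gauss)"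
    by simp
  also have "\<dots> = (\<integral>x. phi x * indicator {a<..b} x \<partial>lborel)"
    by (subst integral_density) (auto)
  also have "\<dots> = (LINT x:{a<..b}|lborel. phi x)"
    by (simp add: set_lebesgue_integral_def mult.commute)
  also have "\<dots> = (LINT x:{a..b}|lborel. phi x)"
    unfolding set_lebesgue_integral_def
    by (rule integral_cong_AE) (auto intro!: AE_I[where N="{a}"] simp: indicator_def)
  also have "\<dots> = integral {a..b} phi"
    by (rule set_borel_integral_eq_integral(2))
       (auto simp: set_integrable_def intro!: integrable_mult_indicator[of _ lborel phi, simplified])
  finally show ?thesis .
qed auto

lemma Phi_has_real_derivative_at: "(Phi has_real_derivative phi x) (at x)"
proof -
  have "((\<lambda>u. integral {x-1..u} phi) has_real_derivative phi x) (at x within {x-1..x+1})"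
    by (rule integral_has_real_derivative) (auto intro!: continuous_on_phi continuous_intros)
  then have "((\<lambda>u. Phi (x-1) + integral {x-1..u} phi) has_real_derivative phi x) (at x within {x-1..x+1})"
    by (auto intro!: derivative_eq_intros)
  then have "(Phi has_real_derivative phi x) (at x within {x-1..x+1})"
    by (rule has_field_derivative_transform_within[where d=1]) (auto simp: Phi_diff[symmetric])
  then have "(Phi has_real_derivative phi x) (at x within {x-1<..<x+1})"
    by (rule DERIV_subset) auto
  then show ?thesis
    by (subst (asm) at_within_open) auto
qed

lemma Phi_has_real_derivative [derivative_intros]:
  assumes "(g has_real_derivative g') (at x within S)"
  shows "((\<lambda>x. Phi (g x)) has_real_derivative (phi (g x) * g')) (at x within S)"
  using DERIV_chain2[OF Phi_has_real_derivative_at assms] by simp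

lemma continuous_on_Phi [continuous_intros]:
  "continuous_on S g \<Longrightarrow> continuous_on S (\<lambda>x. Phi (g x))"
  using continuous_on_compose2[of UNIV Phi S g] DERIV_isCont[OF Phi_has_real_derivative_at]
  by (auto simp: continuous_on_eq_continuous_at)

lemma borel_measurable_Phi [measurable]: "Phi \<in> borel_measurable borel"
  by (intro borel_measurable_continuous_onI continuous_intros)

lemma Phi_strict_mono: "a < b \<Longrightarrow> Phi a < Phi b"
  by (rule DERIV_pos_imp_increasing) (auto intro: Phi_has_real_derivative_at phi_pos)

lemma Phi_less_iff [simp]: "Phi a < Phi b \<longleftrightarrow> a < b"
  by (metis Phi_strict_mono less_asym linorder_neqE_linordered_idom order_less_irrefl)

lemma Phi_le_iff [simp]: "Phi a \<le> Phi b \<longleftrightarrow> a \<le> b"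
  by (meson Phi_less_iff not_less)

lemma inj_Phi: "inj Phi"
  by (metis Phi_le_iff injI order_antisym order_refl)

lemma Phi_bounds: "0 < Phi x" "Phi x < 1"
proof -
  interpret G: real_distribution gauss by (rule real_distribution_gauss)
  have "0 \<le> Phi y" "Phi y \<le> 1" for y
    by (auto simp: Phi_def G.cdf_nonneg G.cdf_bounded_prob)
  with Phi_strict_mono[of "x-1" x] Phi_strict_mono[of x "x+1"] show "0 < Phi x" "Phi x < 1"
    by (smt (verit))+
qed

lemma Phi_at_top: "(Phi \<longlongrightarrow> 1) at_top" and Phi_at_bot: "(Phi \<longlongrightarrow> 0) at_bot"
proof -
  interpret G: real_distribution gauss by (rule real_distribution_gauss)
  show "(Phi \<longlongrightarrow> 1) at_top" "(Phi \<longlongrightarrow> 0) at_bot"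
    unfolding Phi_def using G.cdf_lim_at_top_prob G.cdf_lim_at_bot by simp_all
qed

lemma Phi_surj:
  assumes "0 < q" "q < 1"
  obtains x where "Phi x = q"
proof -
  have "\<forall>\<^sub>F x in at_bot. Phi x < q" "\<forall>\<^sub>F x in at_top. q < Phi x"
    using order_tendstoD[OF Phi_at_bot] order_tendstoD[OF Phi_at_top] assms by auto
  then obtain a b where a: "Phi a < q" and b: "q < Phi b"
    by (meson eventually_happens' trivial_limit_at_bot_linorder trivial_limit_at_top_linorder)
  then have "Phi a < Phi b" by linarith
  then have "a \<le> b" by simp
  then have "\<exists>x\<ge>a. x \<le> b \<and> Phi x = q"
    using a b by (intro IVT') (auto intro!: continuous_on_Phi)
  then show ?thesis using that by blast
qed

lemma inv_Phi_Phi [simp]: "inv Phi (Phi x) = x"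
  by (simp add: inj_Phi)

lemma Phi_inv_Phi: "0 < q \<Longrightarrow> q < 1 \<Longrightarrow> Phi (inv Phi q) = q"
  by (metis Phi_surj inv_Phi_Phi)

text \<open>The sum \<open>Phi (-x) + Phi x\<close> has derivative zero, and its limit at infinity is \<open>1\<close>.\<close>

lemma Phi_minus: "Phi (-x) = 1 - Phi x"
proof -
  have "Phi (-x) + Phi x = Phi (-0) + Phi 0" for x
    by (rule DERIV_isconst_all[of "\<lambda>x. Phi (-x) + Phi x"])
       (auto intro!: derivative_eq_intros simp: phi_minus)
  moreover have "((\<lambda>x. Phi (-x) + Phi x) \<longlongrightarrow> 0 + 1) at_top"
    by (intro tendsto_add Phi_at_top filterlim_compose[OF Phi_at_bot] filterlim_uminus_at_bot_at_top)
  ultimately have "((\<lambda>x::real. Phi (-0) + Phi 0) \<longlongrightarrow> 1) at_top" by simp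
  then have "Phi (-0) + Phi 0 = 1"
    by (simp add: tendsto_const_iff)
  with \<open>Phi (-x) + Phi x = Phi (-0) + Phi 0\<close> show ?thesis by simp
qed

lemma Phi_zero: "Phi 0 = 1/2"
  using Phi_minus[of 0] by simp

lemma inv_Phi_mono: "0 < p \<Longrightarrow> p \<le> q \<Longrightarrow> q < 1 \<Longrightarrow> inv Phi p \<le> inv Phi q"
  by (metis Phi_inv_Phi Phi_le_iff dual_order.strict_trans1 dual_order.strict_trans2)

lemma inv_Phi_one_minus: "0 < q \<Longrightarrow> q < 1 \<Longrightarrow> inv Phi (1 - q) = - inv Phi q"
  by (metis Phi_inv_Phi Phi_minus inv_Phi_Phi)

lemma inv_Phi_has_real_derivative_at:
  assumes "0 < q" "q < 1"
  shows "(inv Phi has_real_derivative 1 / phi (inv Phi q)) (at q)"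
proof -
  have "isCont (inv Phi) q"
  proof -
    have "isCont (inv Phi) (Phi (inv Phi q))"
      by (rule isCont_inverse_function[where d=1])
         (auto intro!: DERIV_isCont[OF Phi_has_real_derivative_at])
    then show ?thesis using assms by (simp add: Phi_inv_Phi)
  qed
  then have "(inv Phi has_real_derivative inverse (phi (inv Phi q))) (at q)"
    by (intro DERIV_inverse_function[where f=Phi and a=0 and b=1] Phi_has_real_derivative_at)
       (use assms phi_pos[of "inv Phi q"] in \<open>auto simp: Phi_inv_Phi\<close>)
  then show ?thesis by (simp add: divide_inverse)
qed

lemma inv_Phi_has_real_derivative [derivative_intros]:
  assumes "(g has_real_derivative g') (at x within S)" "0 < g x" "g x < 1"
  shows "((\<lambda>x. inv Phi (g x)) has_real_derivative (g' / phi (inv Phi (g x)))) (at x within S)"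
  using DERIV_chain2[OF inv_Phi_has_real_derivative_at[OF assms(2,3)] assms(1)] by simp

text \<open>The Gaussian isoperimetric profile: the Gaussian boundary measure of a half-space of
  Gaussian measure \<open>s\<close>.\<close>

definition profile :: "real \<Rightarrow> real" where
  "profile s = phi (inv Phi s)"

lemma profile_pos: "0 < profile s"
  by (simp add: profile_def phi_pos)

lemma profile_le_half: "profile s \<le> 1/2"
  using phi_le_half[of "inv Phi s"] by (simp only: profile_def)

lemma profile_Phi [simp]: "profile (Phi x) = phi x"
  by (simp add: profile_def)

lemma profile_one_minus: "0 < s \<Longrightarrow> s < 1 \<Longrightarrow> profile (1 - s) = profile s"
  by (simp add: profile_def inv_Phi_one_minus phi_minus)

lemma profile_has_real_derivative [derivative_intros]:
  assumes "(g has_real_derivative g') (at x within S)" "0 < g x" "g x < 1"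
  shows "((\<lambda>x. profile (g x)) has_real_derivative (- inv Phi (g x) * g')) (at x within S)"
  unfolding profile_def using phi_pos[of "inv Phi (g x)"]
  by (auto intro!: derivative_eq_intros assms)

text \<open>Equivalent to \<open>I'' = -1 / I\<close>, the differential equation that characterises the profile; up to a
  factor the differentiated function is the derivative of \<open>I\<^sup>2\<close>.\<close>

lemma profile_mult_inv_Phi_has_real_derivative:
  assumes "(g has_real_derivative g') (at x within S)" "0 < g x" "g x < 1"
  shows "((\<lambda>x. profile (g x) * inv Phi (g x)) has_real_derivative ((1 - (inv Phi (g x))\<^sup>2) * g')) (at x within S)"
proof -
  have "((\<lambda>x. profile (g x) * inv Phi (g x)) has_real_derivative
      (- inv Phi (g x) * g') * inv Phi (g x) + g' / phi (inv Phi (g x)) * profile (g x)) (at x within S)"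
    by (intro DERIV_mult inv_Phi_has_real_derivative profile_has_real_derivative assms)
  then show ?thesis by (simp add: profile_def power2_eq_square algebra_simps)
qed

lemma continuous_on_profile:
  assumes "continuous_on S g" "\<And>x. x \<in> S \<Longrightarrow> 0 < g x \<and> g x < 1"
  shows "continuous_on S (\<lambda>x. profile (g x))"
proof (rule continuous_on_compose2[OF _ assms(1)])
  show "continuous_on {0<..<1} profile"
    by (rule DERIV_continuous_on[where D="\<lambda>x. - inv Phi x * 1"],
        rule profile_has_real_derivative[OF DERIV_ident]) auto
qed (use assms in auto)

text \<open>Outside the open unit interval the inverse is an arbitrary constant, so \<open>profile\<close> is Borel on
  the whole line.\<close>

lemma borel_measurable_profile [measurable]: "profile \<in> borel_measurable borel"
proof -
  have eq: "inv Phi s = inv Phi 2" if "\<not> (0 < s \<and> s < 1)" for s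
  proof -
    have "(\<lambda>x. Phi x = s) = (\<lambda>x. Phi x = 2)"
      using that Phi_bounds by (intro ext) (metis not_numeral_less_one order_less_irrefl)
    then show ?thesis by (simp add: inv_def)
  qed
  have "(\<lambda>s. if s \<in> {0<..<1} then profile s else profile 2) \<in> borel_measurable borel"
    by (intro borel_measurable_continuous_on_if continuous_on_profile continuous_on_const continuous_on_id)
       auto
  also have "(\<lambda>s. if s \<in> {0<..<1} then profile s else profile 2) = profile"
  proof
    show "(if s \<in> {0<..<1} then profile s else profile 2) = profile s" for s
      using eq[of s] unfolding profile_def by (cases "0 < s \<and> s < 1") simp_all
  qed
  finally show ?thesis .
qed

section \<open>Bobkov's two-point inequality\<close>

lemma inv_Phi_over_phi_mono:
  assumes "0 < s" "s \<le> t" "t < 1"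
  shows "inv Phi s / phi (inv Phi s) \<le> inv Phi t / phi (inv Phi t)"
proof (rule DERIV_nonneg_imp_nondecreasing[of _ _ "\<lambda>u. u / phi u"])
  show "inv Phi s \<le> inv Phi t" using assms by (intro inv_Phi_mono) auto
  fix u :: real
  have "((\<lambda>u. u / phi u) has_real_derivative (1 + u\<^sup>2) / phi u) (at u)"
    using phi_pos[of u]
    by (auto intro!: derivative_eq_intros simp: field_simps power2_eq_square)
  then show "\<exists>y. ((\<lambda>u. u / phi u) has_real_derivative y) (at u) \<and> 0 \<le> y"
    using phi_pos[of u] by (intro exI[of _ "(1 + u\<^sup>2) / phi u"]) (auto simp: less_imp_le)
qed

text \<open>Convexity of \<open>(inv Phi)\<^sup>2\<close>, which is the square of the derivative of the profile.\<close>

lemma inv_Phi_sq_midpoint: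
  assumes "0 \<le> x" "0 < c - x" "c + x < 1"
  shows "2 * (inv Phi c)\<^sup>2 \<le> (inv Phi (c + x))\<^sup>2 + (inv Phi (c - x))\<^sup>2"
proof -
  let ?g = "\<lambda>t. (inv Phi (c + t))\<^sup>2 + (inv Phi (c - t))\<^sup>2"
  let ?m = "\<lambda>s. inv Phi s / phi (inv Phi s)"
  have "?g 0 \<le> ?g x"
  proof (rule DERIV_nonneg_imp_nondecreasing[OF assms(1)])
    fix t assume t: "0 \<le> t" "t \<le> x"
    then have r: "0 < c + t" "c + t < 1" "0 < c - t" "c - t < 1" using assms by auto
    have "(?g has_real_derivative 2 * (?m (c + t) - ?m (c - t))) (at t)"
      by (rule derivative_eq_intros refl r)+ (simp add: algebra_simps)
    moreover have "?m (c - t) \<le> ?m (c + t)"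
      using r t by (intro inv_Phi_over_phi_mono) auto
    ultimately show "\<exists>y. (?g has_real_derivative y) (at t) \<and> 0 \<le> y"
      by - (rule exI, rule conjI, assumption, simp)
  qed
  then show ?thesis by simp
qed

text \<open>Of two points placed symmetrically about \<open>c \<le> 1/2\<close>, the upper one is the closer to \<open>1/2\<close>, the zero
  of \<open>inv Phi\<close>.\<close>

lemma inv_Phi_sq_below_half:
  assumes "0 \<le> x" "0 < c - x" "c \<le> 1/2"
  shows "(inv Phi (c + x))\<^sup>2 \<le> (inv Phi (c - x))\<^sup>2"
proof -
  have "inv Phi (c + x) \<le> inv Phi (1 - (c - x))"
    using assms by (intro inv_Phi_mono) auto
  also have "\<dots> = - inv Phi (c - x)"
    using assms by (intro inv_Phi_one_minus) auto
  finally have "inv Phi (c + x) \<le> - inv Phi (c - x)" .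
  moreover have "inv Phi (c - x) \<le> inv Phi (c + x)"
    using assms by (intro inv_Phi_mono) auto
  ultimately have "\<bar>inv Phi (c + x)\<bar> \<le> \<bar>inv Phi (c - x)\<bar>" by linarith
  then show ?thesis by (simp add: abs_le_square_iff)
qed

text \<open>The function \<open>I(s)\<^sup>2 + s\<^sup>2\<close> has second derivative \<open>2 * (inv Phi s)\<^sup>2\<close>, because \<open>I * I'' = -1\<close>. Convexity of
  that derivative bounds the symmetric second difference from below by its value at the centre times \<open>x\<^sup>2\<close>.\<close>

lemma profile_sq_second_difference:
  assumes "0 \<le> x" "0 < c - x" "c + x < 1"
  shows "2 * (inv Phi c)\<^sup>2 * x\<^sup>2 \<le> (profile (c + x))\<^sup>2 + (profile (c - x))\<^sup>2 + 2 * x\<^sup>2 - 2 * (profile c)\<^sup>2"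
proof -
  let ?q = "inv Phi"
  let ?h = "\<lambda>t. 2 * (profile (c - t) * ?q (c - t)) - 2 * (profile (c + t) * ?q (c + t)) + 4 * t - 4 * (?q c)\<^sup>2 * t"
  let ?g = "\<lambda>t. (profile (c + t))\<^sup>2 + (profile (c - t))\<^sup>2 + 2 * t\<^sup>2 - 2 * (?q c)\<^sup>2 * t\<^sup>2"
  have range: "0 < c + t" "c + t < 1" "0 < c - t" "c - t < 1" if "0 \<le> t" "t \<le> x" for t
    using that assms by auto
  have h: "0 \<le> ?h t" if t: "0 \<le> t" "t \<le> x" for t
  proof -
    have "?h 0 \<le> ?h t"
    proof (rule DERIV_nonneg_imp_nondecreasing[OF t(1)])
      fix s assume s: "0 \<le> s" "s \<le> t"
      then have r: "0 < c + s" "c + s < 1" "0 < c - s" "c - s < 1" using range[of s] t by auto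
      have "(?h has_real_derivative 2 * ((?q (c + s))\<^sup>2 + (?q (c - s))\<^sup>2 - 2 * (?q c)\<^sup>2)) (at s)"
        by (rule profile_mult_inv_Phi_has_real_derivative derivative_eq_intros refl r)+
           (simp add: algebra_simps)
      moreover have "2 * (?q c)\<^sup>2 \<le> (?q (c + s))\<^sup>2 + (?q (c - s))\<^sup>2"
        using s r by (intro inv_Phi_sq_midpoint) auto
      ultimately show "\<exists>y. (?h has_real_derivative y) (at s) \<and> 0 \<le> y"
        by - (rule exI, rule conjI, assumption, simp)
    qed
    then show ?thesis by simp
  qed
  have "?g 0 \<le> ?g x"
  proof (rule DERIV_nonneg_imp_nondecreasing[OF assms(1)])
    fix t assume t: "0 \<le> t" "t \<le> x"
    note r = range[OF t]
    have "(?g has_real_derivative ?h t) (at t)"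
      by (rule derivative_eq_intros refl r)+ (simp add: power2_eq_square algebra_simps)
    then show "\<exists>y. (?g has_real_derivative y) (at t) \<and> 0 \<le> y"
      using h[OF t] by blast
  qed
  then show ?thesis by simp
qed

text \<open>The odd part of \<open>I\<^sup>2\<close> about \<open>c \<le> 1/2\<close> is concave to the right of the centre, so it lies below its
  tangent.\<close>

lemma profile_sq_first_difference:
  assumes "0 \<le> x" "0 < c - x" "c \<le> 1/2"
  shows "\<bar>(profile (c + x))\<^sup>2 - (profile (c - x))\<^sup>2\<bar> \<le> 4 * profile c * \<bar>inv Phi c\<bar> * x"
proof -
  let ?q = "inv Phi"
  let ?h = "\<lambda>t. 2 * (profile (c + t) * ?q (c + t)) + 2 * (profile (c - t) * ?q (c - t)) - 4 * profile c * ?q c"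
  let ?g = "\<lambda>t. (profile (c - t))\<^sup>2 - (profile (c + t))\<^sup>2 - 4 * profile c * ?q c * t"
  have range: "0 < c + t" "c + t < 1" "0 < c - t" "c - t < 1" if "0 \<le> t" "t \<le> x" for t
    using that assms by auto
  have h: "0 \<le> ?h t" if t: "0 \<le> t" "t \<le> x" for t
  proof -
    have "?h 0 \<le> ?h t"
    proof (rule DERIV_nonneg_imp_nondecreasing[OF t(1)])
      fix s assume s: "0 \<le> s" "s \<le> t"
      then have r: "0 < c + s" "c + s < 1" "0 < c - s" "c - s < 1" using range[of s] t by auto
      have "(?h has_real_derivative 2 * ((?q (c - s))\<^sup>2 - (?q (c + s))\<^sup>2)) (at s)"
        by (rule profile_mult_inv_Phi_has_real_derivative derivative_eq_intros refl r)+
           (simp add: algebra_simps)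
      moreover have "(?q (c + s))\<^sup>2 \<le> (?q (c - s))\<^sup>2"
        using s r assms by (intro inv_Phi_sq_below_half) auto
      ultimately show "\<exists>y. (?h has_real_derivative y) (at s) \<and> 0 \<le> y"
        by - (rule exI, rule conjI, assumption, simp)
    qed
    then show ?thesis by simp
  qed
  have "?g 0 \<le> ?g x"
  proof (rule DERIV_nonneg_imp_nondecreasing[OF assms(1)])
    fix t assume t: "0 \<le> t" "t \<le> x"
    note r = range[OF t]
    have "(?g has_real_derivative ?h t) (at t)"
      by (rule derivative_eq_intros refl r)+ (simp add: power2_eq_square algebra_simps)
    then show "\<exists>y. (?g has_real_derivative y) (at t) \<and> 0 \<le> y"
      using h[OF t] by blast
  qed
  moreover have "?q c \<le> 0"
    using inv_Phi_mono[of c "1/2"] assms inv_Phi_Phi[of 0] by (simp add: Phi_zero)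
  moreover have "profile (c - x) \<le> profile (c + x)"
    using inv_Phi_sq_below_half[OF assms]
    by (simp add: profile_def std_normal_density_def divide_right_mono)
  then have "(profile (c - x))\<^sup>2 \<le> (profile (c + x))\<^sup>2"
    by (intro power_mono) (auto simp: profile_pos less_imp_le)
  ultimately show ?thesis by simp
qed

text \<open>With \<open>u(x) = I(c + x)\<^sup>2 + x\<^sup>2\<close> the claim is \<open>2 * sqrt (u 0) \<le> sqrt (u x) + sqrt (u (-x))\<close>. Squaring twice turns it
  into \<open>(u(x) - u(-x))\<^sup>2 \<le> 8 * u(0) * (u(x) + u(-x) - 2 * u(0))\<close>, and both sides compare with
  \<open>16 * (I(c) * inv Phi c * x)\<^sup>2\<close> through the bounds on the first and the second difference.\<close>

lemma two_point_inequality_centred: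
  assumes "0 \<le> x" "0 < c - x" "c \<le> 1/2"
  shows "2 * profile c \<le> sqrt ((profile (c + x))\<^sup>2 + x\<^sup>2) + sqrt ((profile (c - x))\<^sup>2 + x\<^sup>2)"
proof (rule ccontr)
  define a b where "a = sqrt ((profile (c + x))\<^sup>2 + x\<^sup>2)" and "b = sqrt ((profile (c - x))\<^sup>2 + x\<^sup>2)"
  assume "\<not> ?thesis"
  then have lt: "a + b < 2 * profile c" by (simp add: a_def b_def)
  have ab: "0 \<le> a" "0 \<le> b" "a\<^sup>2 = (profile (c + x))\<^sup>2 + x\<^sup>2" "b\<^sup>2 = (profile (c - x))\<^sup>2 + x\<^sup>2"
    by (simp_all add: a_def b_def)
  have cx: "c + x < 1" using assms by auto
  have "(a\<^sup>2 - b\<^sup>2)\<^sup>2 \<le> (4 * profile c * \<bar>inv Phi c\<bar> * x)\<^sup>2"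
    using profile_sq_first_difference[OF assms] unfolding ab
    by (subst power2_abs[symmetric]) (intro power_mono, auto)
  also have "\<dots> = 8 * (profile c)\<^sup>2 * (2 * (inv Phi c)\<^sup>2 * x\<^sup>2)"
    by (simp add: power_mult_distrib)
  also have "\<dots> \<le> 8 * (profile c)\<^sup>2 * (a\<^sup>2 + b\<^sup>2 - 2 * (profile c)\<^sup>2)"
    using profile_sq_second_difference[OF assms(1,2) cx] unfolding ab
    by (intro mult_left_mono) auto
  \<comment> \<open>In terms of \<open>a + b\<close> and \<open>a - b\<close> both sides share a factor, which is positive if the claim fails.\<close>
  finally have "((2 * profile c)\<^sup>2 - (a + b)\<^sup>2) * (2 * profile c)\<^sup>2 \<le> ((2 * profile c)\<^sup>2 - (a + b)\<^sup>2) * (a - b)\<^sup>2"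
    by (simp add: power2_eq_square algebra_simps)
  moreover have sq: "(a + b)\<^sup>2 < (2 * profile c)\<^sup>2"
    using lt ab by (intro power_strict_mono) auto
  ultimately have "(2 * profile c)\<^sup>2 \<le> (a - b)\<^sup>2"
    by (simp add: mult_le_cancel_left_pos)
  moreover have "(a - b)\<^sup>2 \<le> (a + b)\<^sup>2"
    using ab(1,2) by (simp add: power2_eq_square algebra_simps)
  ultimately show False using sq by simp
qed

text \<open>The case of mean above \<open>1/2\<close> follows from the symmetry \<open>I(1 - s) = I(s)\<close>.\<close>

lemma two_point_inequality:
  assumes "0 < a" "a < 1" "0 < b" "b < 1"
  shows "2 * profile ((a + b) / 2) \<le> sqrt ((profile a)\<^sup>2 + ((a - b) / 2)\<^sup>2) + sqrt ((profile b)\<^sup>2 + ((a - b) / 2)\<^sup>2)"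
proof -
  have low: "2 * profile ((a + b) / 2) \<le> sqrt ((profile a)\<^sup>2 + ((a - b) / 2)\<^sup>2) + sqrt ((profile b)\<^sup>2 + ((a - b) / 2)\<^sup>2)"
    if "0 < a" "a < 1" "0 < b" "b < 1" "(a + b) / 2 \<le> 1/2" for a b
  proof -
    have *: "2 * profile ((u + w) / 2) \<le> sqrt ((profile w)\<^sup>2 + ((w - u) / 2)\<^sup>2) + sqrt ((profile u)\<^sup>2 + ((w - u) / 2)\<^sup>2)"
      if "0 < u" "u \<le> w" "(u + w) / 2 \<le> 1/2" for u w :: real
    proof -
      have "(u + w) / 2 + (w - u) / 2 = w" "(u + w) / 2 - (w - u) / 2 = u"
        by (simp_all add: field_simps)
      then show ?thesis
        using two_point_inequality_centred[of "(w - u) / 2" "(u + w) / 2"] that by simp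
    qed
    have sq: "((b - a) / 2)\<^sup>2 = ((a - b) / 2)\<^sup>2"
      by (simp add: power2_eq_square field_simps)
    show ?thesis
    proof (cases "a \<le> b")
      case True
      then show ?thesis using *[of a b] that unfolding sq by linarith
    next
      case False
      then show ?thesis using *[of b a] that unfolding add.commute[of b a] by linarith
    qed
  qed
  show ?thesis
  proof (cases "(a + b) / 2 \<le> 1/2")
    case True
    with low assms show ?thesis by blast
  next
    case False
    have m: "((1 - a) + (1 - b)) / 2 = 1 - (a + b) / 2" "((1 - a) - (1 - b)) / 2 = - ((a - b) / 2)"
      by (simp_all add: field_simps)
    show ?thesis
      using low[of "1 - a" "1 - b"] False assms unfolding m power2_minus
      by (simp add: profile_one_minus)
  qed
qed

section \<open>Tensorization\<close>

text \<open>Minkowski's integral inequality for finitely many components, by duality: pair the vector with its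
  own integral and use Cauchy-Schwarz under the integral sign.\<close>

lemma L2_set_integral_le:
  fixes u :: "'k \<Rightarrow> 'a \<Rightarrow> real"
  assumes "finite K" and int: "\<And>k. k \<in> K \<Longrightarrow> integrable M (u k)"
  shows "L2_set (\<lambda>k. \<integral>x. u k x \<partial>M) K \<le> (\<integral>x. L2_set (\<lambda>k. u k x) K \<partial>M)"
proof -
  define c where "c k = (\<integral>x. u k x \<partial>M)" for k
  have meas: "(\<lambda>x. L2_set (\<lambda>k. u k x) K) \<in> borel_measurable M"
  proof -
    note [measurable] = borel_measurable_integrable[OF int]
    show ?thesis unfolding L2_set_def by measurable
  qed
  have intL: "integrable M (\<lambda>x. L2_set (\<lambda>k. u k x) K)"
  proof (rule Bochner_Integration.integrable_bound[OF _ meas])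
    show "integrable M (\<lambda>x. \<Sum>k\<in>K. \<bar>u k x\<bar>)" using int by auto
    show "AE x in M. norm (L2_set (\<lambda>k. u k x) K) \<le> norm (\<Sum>k\<in>K. \<bar>u k x\<bar>)"
      by (intro AE_I2) (use L2_set_le_sum_abs in \<open>auto simp: L2_set_nonneg sum_nonneg\<close>)
  qed
  show ?thesis
  proof (cases "L2_set c K = 0")
    case True
    then show ?thesis unfolding c_def by (simp add: L2_set_nonneg integral_nonneg_AE)
  next
    case False
    have "L2_set c K * L2_set c K = (\<Sum>k\<in>K. c k * c k)"
      by (simp add: L2_set_def sum_nonneg power2_eq_square)
    also have "\<dots> = (\<integral>x. (\<Sum>k\<in>K. c k * u k x) \<partial>M)"
      using int by (subst Bochner_Integration.integral_sum) (auto simp: c_def)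
    also have "\<dots> \<le> (\<integral>x. L2_set c K * L2_set (\<lambda>k. u k x) K \<partial>M)"
    proof (rule integral_mono)
      show "integrable M (\<lambda>x. \<Sum>k\<in>K. c k * u k x)" using int by auto
      show "integrable M (\<lambda>x. L2_set c K * L2_set (\<lambda>k. u k x) K)" using intL by auto
      fix x
      have "(\<Sum>k\<in>K. c k * u k x) \<le> (\<Sum>k\<in>K. \<bar>c k\<bar> * \<bar>u k x\<bar>)"
        by (intro sum_mono) (metis abs_ge_self abs_mult)
      also have "\<dots> \<le> L2_set c K * L2_set (\<lambda>k. u k x) K" by (rule L2_set_mult_ineq)
      finally show "(\<Sum>k\<in>K. c k * u k x) \<le> L2_set c K * L2_set (\<lambda>k. u k x) K" .
    qed
    also have "\<dots> = L2_set c K * (\<integral>x. L2_set (\<lambda>k. u k x) K \<partial>M)" by simp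
    finally have "L2_set c K \<le> (\<integral>x. L2_set (\<lambda>k. u k x) K \<partial>M)"
      using False L2_set_nonneg[of c K] by (simp add: mult_le_cancel_left)
    then show ?thesis by (simp add: c_def[abs_def])
  qed
qed

lemma sqrt_integral_sq_le:
  fixes u :: "'a \<Rightarrow> real" and v :: "'k \<Rightarrow> 'a \<Rightarrow> real"
  assumes "finite K" "integrable M u" "\<And>k. k \<in> K \<Longrightarrow> integrable M (v k)"
  shows "sqrt ((\<integral>x. u x \<partial>M)\<^sup>2 + (\<Sum>k\<in>K. (\<integral>x. v k x \<partial>M)\<^sup>2))
    \<le> (\<integral>x. sqrt ((u x)\<^sup>2 + (\<Sum>k\<in>K. (v k x)\<^sup>2)) \<partial>M)"
proof -
  have fin: "finite (insert None (Some ` K))" using assms(1) by simp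
  have eq: "L2_set g (insert None (Some ` K)) = sqrt ((g None)\<^sup>2 + (\<Sum>k\<in>K. (g (Some k))\<^sup>2))" for g
    using assms(1) by (simp add: L2_set_def sum.reindex)
  have "integrable M (case k of None \<Rightarrow> u | Some x \<Rightarrow> v x)" if "k \<in> insert None (Some ` K)" for k
    using that assms(2,3) by auto
  from L2_set_integral_le[of _ M "case_option u v", OF fin this] show ?thesis unfolding eq by simp
qed

lemma (in prob_space) integral_between:
  fixes f :: "'a \<Rightarrow> real"
  assumes [measurable]: "f \<in> borel_measurable M" and "\<And>x. x \<in> space M \<Longrightarrow> a < f x \<and> f x < b"
  shows "a < (\<integral>x. f x \<partial>M)" "(\<integral>x. f x \<partial>M) < b" "integrable M f"
proof -
  show int: "integrable M f"
    by (rule integrable_const_bound[where B="max \<bar>a\<bar> \<bar>b\<bar>"])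
       (use assms(2) in \<open>auto intro!: AE_I2 simp: abs_if max_def, (smt (verit))+\<close>)
  have "(\<integral>x. a \<partial>M) < (\<integral>x. f x \<partial>M)"
    by (rule integral_less_AE_space) (use int assms(2) emeasure_space_1 in auto)
  then show "a < (\<integral>x. f x \<partial>M)" by (simp add: prob_space)
  have "(\<integral>x. f x \<partial>M) < (\<integral>x. b \<partial>M)"
    by (rule integral_less_AE_space) (use int assms(2) emeasure_space_1 in auto)
  then show "(\<integral>x. f x \<partial>M) < b" by (simp add: prob_space)
qed

text \<open>A law on the line together with a notion of derivative, for which the one-dimensional functional
  inequality holds. The derivative is a relation between \<open>f\<close> and \<open>v\<close> so that the same product theorem
  covers the discrete derivative of the two-point space and the true derivative on the Gaussian line.
  What the product argument needs of it is that it survives averaging over a parameter.\<close>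

locale bobkov_space = prob_space \<mu> for \<mu> :: "real measure" +
  fixes grad :: "(real \<Rightarrow> real) \<Rightarrow> (real \<Rightarrow> real) \<Rightarrow> bool"
  assumes sets_mu [measurable_cong]: "sets \<mu> = sets borel"
    and grad_integral: "\<And>f v B.
      f \<in> borel_measurable (borel \<Otimes>\<^sub>M borel) \<Longrightarrow> v \<in> borel_measurable (borel \<Otimes>\<^sub>M borel) \<Longrightarrow>
      (\<And>x y. 0 < f (x, y) \<and> f (x, y) < 1) \<Longrightarrow> (\<And>x y. \<bar>v (x, y)\<bar> \<le> B) \<Longrightarrow>
      (\<And>y. grad (\<lambda>x. f (x, y)) (\<lambda>x. v (x, y))) \<Longrightarrow>
      grad (\<lambda>x. \<integral>y. f (x, y) \<partial>\<mu>) (\<lambda>x. \<integral>y. v (x, y) \<partial>\<mu>)"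
    and bobkov_one: "\<And>f v B.
      f \<in> borel_measurable borel \<Longrightarrow> v \<in> borel_measurable borel \<Longrightarrow>
      (\<And>x. 0 < f x \<and> f x < 1) \<Longrightarrow> (\<And>x. \<bar>v x\<bar> \<le> B) \<Longrightarrow> grad f v \<Longrightarrow>
      profile (\<integral>x. f x \<partial>\<mu>) \<le> (\<integral>x. sqrt ((profile (f x))\<^sup>2 + (v x)\<^sup>2) \<partial>\<mu>)"
begin

lemma space_mu [simp]: "space \<mu> = UNIV"
  using sets_eq_imp_space_eq[OF sets_mu] by simp

lemma prob_UNIV [simp]: "prob UNIV = 1"
  using prob_space by simp

text \<open>Split off one coordinate \<open>a\<close> and let \<open>g\<close> be the average of \<open>f\<close> over it. The induction hypothesis applies
  to \<open>g\<close>, whose partial derivatives are averages of those of \<open>f\<close>. The one-dimensional inequality bounds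
  \<open>I(g)\<close> by an average of \<open>sqrt (I(f)\<^sup>2 + v\<^sub>a\<^sup>2)\<close>, and Minkowski's inequality pulls all these averages out of
  the Euclidean norm.\<close>

theorem bobkov_product:
  fixes f :: "('i \<Rightarrow> real) \<Rightarrow> real" and v :: "'i \<Rightarrow> ('i \<Rightarrow> real) \<Rightarrow> real"
  assumes "finite A"
    and "f \<in> borel_measurable (PiM A (\<lambda>_. \<mu>))"
    and "\<And>i. i \<in> A \<Longrightarrow> v i \<in> borel_measurable (PiM A (\<lambda>_. \<mu>))"
    and "\<And>x. x \<in> space (PiM A (\<lambda>_. \<mu>)) \<Longrightarrow> 0 < f x \<and> f x < 1"
    and "\<And>i x. i \<in> A \<Longrightarrow> x \<in> space (PiM A (\<lambda>_. \<mu>)) \<Longrightarrow> \<bar>v i x\<bar> \<le> B"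
    and "\<And>i x. i \<in> A \<Longrightarrow> x \<in> space (PiM A (\<lambda>_. \<mu>)) \<Longrightarrow>
      grad (\<lambda>t. f (x(i := t))) (\<lambda>t. v i (x(i := t)))"
  shows "profile (\<integral>x. f x \<partial>PiM A (\<lambda>_. \<mu>))
    \<le> (\<integral>x. sqrt ((profile (f x))\<^sup>2 + (\<Sum>i\<in>A. (v i x)\<^sup>2)) \<partial>PiM A (\<lambda>_. \<mu>))"
  using assms
proof (induction A arbitrary: f v rule: finite_induct)
  case empty
  show ?case
    by (simp add: PiM_empty lebesgue_integral_count_space_finite profile_pos less_imp_le)
next
  case (insert a A)
  note [measurable] = insert.prems(1)
  note [simp] = insert.hyps(1)
  let ?P = "PiM A (\<lambda>_. \<mu>)" and ?Q = "PiM (insert a A) (\<lambda>_. \<mu>)"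
  interpret E: product_sigma_finite "\<lambda>_. \<mu>" ..
  interpret PA: prob_space ?P by (rule prob_space_PiM) unfold_locales
  interpret QA: prob_space ?Q by (rule prob_space_PiM) unfold_locales
  have v_meas [measurable]: "v i \<in> borel_measurable ?Q" if "i \<in> insert a A" for i
    using insert.prems(2) that .
  have upd_space: "x(a := y) \<in> space ?Q" if "x \<in> space ?P" for x y
    using that by (auto simp: space_PiM PiE_def extensional_def)
  have upd_meas: "(\<lambda>y. x(a := y)) \<in> measurable borel ?Q" if "x \<in> space ?P" for x
    by (rule measurable_fun_upd[where J=A]) (use that in auto)
  have upd_meas2: "(\<lambda>z. (fst z)(a := snd z)) \<in> measurable (?P \<Otimes>\<^sub>M \<mu>) ?Q"
    using measurable_add_dim[of a A "\<lambda>_. \<mu>"] by (simp add: split_beta')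
  have upd_meas3: "(\<lambda>z. x(i := fst z, a := snd z)) \<in> measurable (borel \<Otimes>\<^sub>M borel) ?Q"
    if "x \<in> space ?P" "i \<in> A" for x i
    by (rule measurable_fun_upd[where J=A]; (rule measurable_fun_upd[where J=A])?) (use that in auto)
  let ?s = "\<lambda>x. sqrt ((profile (f x))\<^sup>2 + (\<Sum>i\<in>insert a A. (v i x)\<^sup>2))"
  have s_bound: "\<bar>?s x\<bar> \<le> 1 + real (card (insert a A)) * \<bar>B\<bar>" if x: "x \<in> space ?Q" for x
  proof -
    have "?s x \<le> sqrt ((profile (f x))\<^sup>2) + sqrt (\<Sum>i\<in>insert a A. (v i x)\<^sup>2)"
      by (rule sqrt_add_le_add_sqrt) (auto intro!: sum_nonneg add_nonneg_nonneg)
    also have "sqrt (\<Sum>i\<in>insert a A. (v i x)\<^sup>2) \<le> (\<Sum>i\<in>insert a A. \<bar>v i x\<bar>)"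
      using L2_set_le_sum_abs[of "\<lambda>i. v i x" "insert a A"] by (simp add: L2_set_def)
    also have "\<dots> \<le> (\<Sum>i\<in>insert a A. \<bar>B\<bar>)"
      by (intro sum_mono) (use insert.prems(4) x in force)
    also have "sqrt ((profile (f x))\<^sup>2) \<le> 1" using profile_pos[of "f x"] profile_le_half[of "f x"] by simp
    finally have "?s x \<le> 1 + real (card (insert a A)) * \<bar>B\<bar>" by simp
    moreover have "0 \<le> ?s x" by (auto intro!: sum_nonneg add_nonneg_nonneg)
    ultimately show ?thesis by simp
  qed
  have int_s: "integrable ?Q ?s"
    by (rule QA.integrable_const_bound[where B="1 + real (card (insert a A)) * \<bar>B\<bar>"])
       (use s_bound in \<open>auto intro!: AE_I2 simp del: sum.insert card_insert_disjoint\<close>)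
  define g where "g x = (\<integral>y. f (x(a := y)) \<partial>\<mu>)" for x
  define w where "w i x = (\<integral>y. v i (x(a := y)) \<partial>\<mu>)" for i x
  have fa: "(\<lambda>y. f (x(a := y))) \<in> borel_measurable borel" if "x \<in> space ?P" for x
    using upd_meas[OF that] by measurable
  have va: "(\<lambda>y. v i (x(a := y))) \<in> borel_measurable borel" if "x \<in> space ?P" "i \<in> insert a A" for x i
    using measurable_compose[OF upd_meas[OF that(1)] v_meas[OF that(2)]] .
  have g01: "0 < g x \<and> g x < 1" if "x \<in> space ?P" for x
    unfolding g_def
    by (intro conjI integral_between) (use that fa insert.prems(3) upd_space in auto)
  have "profile (\<integral>x. f x \<partial>?Q) = profile (\<integral>x. g x \<partial>?P)"
    unfolding g_def
    by (subst E.product_integral_insert)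
       (use insert.hyps insert.prems(3) in \<open>auto intro!: QA.integral_between(3)[where a=0 and b=1]\<close>)
  also have "\<dots> \<le> (\<integral>x. sqrt ((profile (g x))\<^sup>2 + (\<Sum>i\<in>A. (w i x)\<^sup>2)) \<partial>?P)"
  proof (rule insert.IH)
    show "g \<in> borel_measurable ?P"
      unfolding g_def
      by (intro borel_measurable_lebesgue_integral) (use upd_meas2 in \<open>simp add: split_beta', measurable\<close>)
    show "w i \<in> borel_measurable ?P" if "i \<in> A" for i
      unfolding w_def
      by (intro borel_measurable_lebesgue_integral)
         (use measurable_compose[OF upd_meas2 v_meas[of i]] that in \<open>simp add: split_beta'\<close>)
    show "0 < g x \<and> g x < 1" if "x \<in> space ?P" for x by (rule g01[OF that])
    show "\<bar>w i x\<bar> \<le> B" if "i \<in> A" "x \<in> space ?P" for i x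
    proof -
      have "\<bar>w i x\<bar> \<le> (\<integral>y. \<bar>v i (x(a := y))\<bar> \<partial>\<mu>)"
        unfolding w_def by (rule integral_abs_bound)
      also have "\<dots> \<le> (\<integral>y. B \<partial>\<mu>)"
        by (rule integral_mono)
           (use that va insert.prems(4) upd_space in \<open>auto intro!: integrable_const_bound[where B=B] AE_I2\<close>)
      finally show ?thesis by (simp add: prob_space)
    qed
    show "grad (\<lambda>t. g (x(i := t))) (\<lambda>t. w i (x(i := t)))" if "i \<in> A" "x \<in> space ?P" for i x
    proof -
      have ia: "i \<noteq> a" using that insert.hyps by auto
      have sp: "x(i := t, a := y) \<in> space ?Q" for t y
        using that by (intro upd_space) (auto simp: space_PiM PiE_def extensional_def)
      have "grad (\<lambda>t. \<integral>y. (\<lambda>(t, y). f (x(i := t, a := y))) (t, y) \<partial>\<mu>)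
         (\<lambda>t. \<integral>y. (\<lambda>(t, y). v i (x(i := t, a := y))) (t, y) \<partial>\<mu>)"
      proof (rule grad_integral)
        show "(\<lambda>(t, y). f (x(i := t, a := y))) \<in> borel_measurable (borel \<Otimes>\<^sub>M borel)"
          unfolding split_beta' by (rule measurable_compose[OF upd_meas3[OF that(2,1)] insert.prems(1)])
        show "(\<lambda>(t, y). v i (x(i := t, a := y))) \<in> borel_measurable (borel \<Otimes>\<^sub>M borel)"
          unfolding split_beta'
          by (rule measurable_compose[OF upd_meas3[OF that(2,1)] v_meas[OF insertI2[OF that(1)]]])
        show "0 < (\<lambda>(t, y). f (x(i := t, a := y))) (s, z) \<and> (\<lambda>(t, y). f (x(i := t, a := y))) (s, z) < 1" for s z
          unfolding prod.case by (rule insert.prems(3)[OF sp])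
        show "\<bar>(\<lambda>(t, y). v i (x(i := t, a := y))) (s, z)\<bar> \<le> B" for s z
          unfolding prod.case by (rule insert.prems(4)[OF insertI2[OF that(1)] sp])
        show "grad (\<lambda>t. (\<lambda>(t, y). f (x(i := t, a := y))) (t, z))
           (\<lambda>t. (\<lambda>(t, y). v i (x(i := t, a := y))) (t, z))" for z
          unfolding prod.case fun_upd_twist[OF ia]
          by (rule insert.prems(5)[OF insertI2[OF that(1)] upd_space[OF that(2)]])
      qed
      then show ?thesis unfolding g_def w_def prod.case .
    qed
  qed
  also have "\<dots> \<le> (\<integral>x. (\<integral>y. ?s (x(a := y)) \<partial>\<mu>) \<partial>?P)"
  proof (rule integral_mono_AE')
    let ?u = "\<lambda>x y. sqrt ((profile (f (x(a := y))))\<^sup>2 + (v a (x(a := y)))\<^sup>2)"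
    show "integrable ?P (\<lambda>x. \<integral>y. ?s (x(a := y)) \<partial>\<mu>)"
    proof (rule PA.integrable_const_bound[where B="1 + real (card (insert a A)) * \<bar>B\<bar>"])
      show "(\<lambda>x. \<integral>y. ?s (x(a := y)) \<partial>\<mu>) \<in> borel_measurable ?P"
        by (intro borel_measurable_lebesgue_integral)
           (use measurable_compose[OF upd_meas2 borel_measurable_integrable[OF int_s]] in \<open>simp add: split_beta'\<close>)
      show "AE x in ?P. norm (\<integral>y. ?s (x(a := y)) \<partial>\<mu>) \<le> 1 + real (card (insert a A)) * \<bar>B\<bar>"
      proof (rule AE_I2)
        fix x assume x: "x \<in> space ?P"
        have m: "(\<lambda>y. ?s (x(a := y))) \<in> borel_measurable borel"
          using measurable_compose[OF upd_meas[OF x] borel_measurable_integrable[OF int_s]] .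
        have "norm (\<integral>y. ?s (x(a := y)) \<partial>\<mu>) \<le> (\<integral>y. \<bar>?s (x(a := y))\<bar> \<partial>\<mu>)"
          unfolding real_norm_def by (rule integral_abs_bound)
        also have "\<dots> \<le> (\<integral>y. 1 + real (card (insert a A)) * \<bar>B\<bar> \<partial>\<mu>)"
          by (rule integral_mono)
             (use m s_bound[OF upd_space[OF x]] in
               \<open>auto intro!: integrable_const_bound[where B="1 + real (card (insert a A)) * \<bar>B\<bar>"] AE_I2
                  simp del: sum.insert card_insert_disjoint abs_of_nonneg real_sqrt_abs2\<close>)
        finally show "norm (\<integral>y. ?s (x(a := y)) \<partial>\<mu>) \<le> 1 + real (card (insert a A)) * \<bar>B\<bar>"
          by (simp add: prob_space)
      qed
    qed
    show "AE x in ?P. 0 \<le> (\<integral>y. ?s (x(a := y)) \<partial>\<mu>)"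
      by (intro AE_I2 integral_nonneg_AE) (auto intro!: add_nonneg_nonneg sum_nonneg)
    show "AE x in ?P. sqrt ((profile (g x))\<^sup>2 + (\<Sum>i\<in>A. (w i x)\<^sup>2)) \<le> (\<integral>y. ?s (x(a := y)) \<partial>\<mu>)"
    proof (rule AE_I2)
      fix x assume x: "x \<in> space ?P"
      note [measurable] = fa[OF x] va[OF x insertI1]
      have u0: "profile (g x) \<le> (\<integral>y. ?u x y \<partial>\<mu>)"
        unfolding g_def
      proof (rule bobkov_one[where B=B])
        show "0 < f (x(a := y)) \<and> f (x(a := y)) < 1" for y
          using insert.prems(3) upd_space[OF x] by blast
        show "\<bar>v a (x(a := y))\<bar> \<le> B" for y
          using insert.prems(4) upd_space[OF x] by blast
        have *: "x(a := undefined) \<in> space ?Q" using upd_space[OF x] .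
        show "grad (\<lambda>y. f (x(a := y))) (\<lambda>y. v a (x(a := y)))"
          using insert.prems(5)[OF insertI1 *] by (simp only: fun_upd_upd)
      qed measurable
      have "?u x y \<le> 1 + \<bar>B\<bar>" for y
      proof -
        have "?u x y \<le> \<bar>profile (f (x(a := y)))\<bar> + \<bar>v a (x(a := y))\<bar>" by (rule sqrt_sum_squares_le_sum_abs)
        also have "\<dots> \<le> 1 + \<bar>B\<bar>"
          using profile_pos[of "f (x(a := y))"] profile_le_half[of "f (x(a := y))"]
            insert.prems(4)[OF insertI1 upd_space[OF x], of y] by linarith
        finally show ?thesis .
      qed
      then have int_u: "integrable \<mu> (?u x)"
        by (intro integrable_const_bound[where B="1 + \<bar>B\<bar>"] AE_I2) auto
      have "sqrt ((profile (g x))\<^sup>2 + (\<Sum>i\<in>A. (w i x)\<^sup>2)) \<le> sqrt ((\<integral>y. ?u x y \<partial>\<mu>)\<^sup>2 + (\<Sum>i\<in>A. (w i x)\<^sup>2))"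
        using u0 profile_pos[of "g x"] by (intro real_sqrt_le_mono add_mono power_mono) auto
      also have "\<dots> \<le> (\<integral>y. sqrt ((?u x y)\<^sup>2 + (\<Sum>i\<in>A. (v i (x(a := y)))\<^sup>2)) \<partial>\<mu>)"
        unfolding w_def
      proof (rule sqrt_integral_sq_le)
        show "integrable \<mu> (\<lambda>y. v i (x(a := y)))" if "i \<in> A" for i
        proof (rule integrable_const_bound[where B=B])
          show "AE y in \<mu>. norm (v i (x(a := y))) \<le> B"
            unfolding real_norm_def
            by (intro AE_I2 insert.prems(4)[OF insertI2[OF that] upd_space[OF x]])
          show "(\<lambda>y. v i (x(a := y))) \<in> borel_measurable \<mu>"
            using va[OF x insertI2[OF that]] by simp
        qed
      qed (use int_u in auto)
      also have "(\<lambda>y. sqrt ((?u x y)\<^sup>2 + (\<Sum>i\<in>A. (v i (x(a := y)))\<^sup>2))) = (\<lambda>y. ?s (x(a := y)))"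
        using insert.hyps by (simp add: add.assoc)
      finally show "sqrt ((profile (g x))\<^sup>2 + (\<Sum>i\<in>A. (w i x)\<^sup>2)) \<le> (\<integral>y. ?s (x(a := y)) \<partial>\<mu>)" .
    qed
  qed
  also have "\<dots> = (\<integral>x. ?s x \<partial>?Q)"
    by (rule E.product_integral_insert[OF insert.hyps int_s, symmetric])
  finally show ?case .
qed

end

section \<open>From signs to the Gaussian line\<close>

text \<open>A random sign, carried by the real line so that products and sums stay within real variables.\<close>

definition rademacher :: "real measure" where
  "rademacher = distr (measure_pmf (bernoulli_pmf (1/2))) borel (\<lambda>b. if b then 1 else - 1)"

lemma prob_space_rademacher: "prob_space rademacher"
  unfolding rademacher_def by (rule measure_pmf.prob_space_distr) simp

lemma sets_rademacher [simp, measurable_cong]: "sets rademacher = sets borel"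
  by (simp add: rademacher_def)

lemma space_rademacher [simp]: "space rademacher = UNIV"
  by (simp add: rademacher_def)

lemma integral_rademacher:
  fixes f :: "real \<Rightarrow> real"
  assumes "f \<in> borel_measurable borel"
  shows "(\<integral>x. f x \<partial>rademacher) = (f 1 + f (- 1)) / 2"
  unfolding rademacher_def using assms
  by (subst integral_distr) (simp_all add: integral_bernoulli_pmf field_simps)

lemma integrable_rademacher:
  fixes f :: "real \<Rightarrow> real"
  assumes "f \<in> borel_measurable borel"
  shows "integrable rademacher f"
  unfolding rademacher_def using assms
  by (subst integrable_distr_eq) (auto intro!: integrable_measure_pmf_finite)

lemma AE_rademacher: "AE x in rademacher. \<bar>x\<bar> = 1"
  unfolding rademacher_def by (subst AE_distr_iff) auto

text \<open>For a random sign the two values of \<open>f\<close> have the same discrete derivative up to sign, and the functional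
  inequality is the two-point inequality.\<close>

interpretation rademacher: bobkov_space rademacher "\<lambda>f v. \<forall>x. v x = (f x - f (- x)) / 2"
proof (intro bobkov_space.intro bobkov_space_axioms.intro prob_space_rademacher)
  show "sets rademacher = sets borel" by simp
next
  fix f v :: "real \<times> real \<Rightarrow> real"
  assume [measurable]: "f \<in> borel_measurable (borel \<Otimes>\<^sub>M borel)"
    and grad: "\<And>y. \<forall>x. v (x, y) = (f (x, y) - f (- x, y)) / 2"
  have int: "integrable rademacher (\<lambda>y. f (x, y))" for x
    by (rule integrable_rademacher) measurable
  show "\<forall>x. (\<integral>y. v (x, y) \<partial>rademacher) = ((\<integral>y. f (x, y) \<partial>rademacher) - (\<integral>y. f (- x, y) \<partial>rademacher)) / 2"
  proof
    fix x
    have "(\<integral>y. v (x, y) \<partial>rademacher) = (\<integral>y. (f (x, y) - f (- x, y)) / 2 \<partial>rademacher)"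
      by (rule Bochner_Integration.integral_cong) (use grad in auto)
    also have "\<dots> = ((\<integral>y. f (x, y) \<partial>rademacher) - (\<integral>y. f (- x, y) \<partial>rademacher)) / 2"
      using int by simp
    finally show "(\<integral>y. v (x, y) \<partial>rademacher) = ((\<integral>y. f (x, y) \<partial>rademacher) - (\<integral>y. f (- x, y) \<partial>rademacher)) / 2" .
  qed
next
  fix f v :: "real \<Rightarrow> real"
  assume [measurable]: "f \<in> borel_measurable borel" "v \<in> borel_measurable borel"
    and f01: "\<And>x. 0 < f x \<and> f x < 1" and grad: "\<forall>x. v x = (f x - f (- x)) / 2"
  have v: "v 1 = (f 1 - f (- 1)) / 2" "v (- 1) = - ((f 1 - f (- 1)) / 2)"
    using grad[rule_format, of 1] grad[rule_format, of "- 1"] by (simp_all add: field_simps)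
  have "2 * profile ((f 1 + f (- 1)) / 2) \<le> sqrt ((profile (f 1))\<^sup>2 + (v 1)\<^sup>2) + sqrt ((profile (f (- 1)))\<^sup>2 + (v (- 1))\<^sup>2)"
    using two_point_inequality[of "f 1" "f (- 1)"] f01 unfolding v power2_minus by auto
  then show "profile (\<integral>x. f x \<partial>rademacher) \<le> (\<integral>x. sqrt ((profile (f x))\<^sup>2 + (v x)\<^sup>2) \<partial>rademacher)"
    by (simp add: integral_rademacher)
qed

text \<open>A first-order expansion with uniform quadratic error. It implies differentiability with a Lipschitz
  derivative, and since the expansion is linear in the pair \<open>(f, v)\<close> it survives averaging, so that no
  differentiation under an integral sign is needed.\<close>

definition quadratic_gradient :: "real \<Rightarrow> (real \<Rightarrow> real) \<Rightarrow> (real \<Rightarrow> real) \<Rightarrow> bool" where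
  "quadratic_gradient K f v \<longleftrightarrow> (\<forall>x h. \<bar>f (x + h) - f x - v x * h\<bar> \<le> K * h\<^sup>2)"

lemma quadratic_gradientD: "quadratic_gradient K f v \<Longrightarrow> \<bar>f (x + h) - f x - v x * h\<bar> \<le> K * h\<^sup>2"
  by (simp add: quadratic_gradient_def)

text \<open>Compare the expansions from \<open>x\<close> to \<open>y\<close> and from \<open>y\<close> to \<open>x\<close>.\<close>

lemma quadratic_gradient_lipschitz:
  assumes "quadratic_gradient K f v"
  shows "\<bar>v y - v x\<bar> \<le> 2 * K * \<bar>y - x\<bar>"
proof (cases "x = y")
  case False
  have "\<bar>f y - f x - v x * (y - x)\<bar> \<le> K * (y - x)\<^sup>2" "\<bar>f x - f y - v y * (x - y)\<bar> \<le> K * (y - x)\<^sup>2"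
    using quadratic_gradientD[OF assms, of x "y - x"] quadratic_gradientD[OF assms, of y "x - y"]
    by (simp_all add: power2_commute)
  then have "\<bar>(v y - v x) * (y - x)\<bar> \<le> 2 * K * (y - x)\<^sup>2"
    by (simp add: algebra_simps abs_le_iff)
  then have "\<bar>v y - v x\<bar> * \<bar>y - x\<bar> \<le> (2 * K * \<bar>y - x\<bar>) * \<bar>y - x\<bar>"
    by (simp add: abs_mult power2_eq_square mult.assoc)
  then show ?thesis using False by (simp add: mult_le_cancel_right)
qed auto

lemma quadratic_gradient_continuous:
  assumes "quadratic_gradient K f v"
  shows "isCont f x" "isCont v x"
proof -
  have "(v \<longlongrightarrow> v x) (at x)"
  proof (rule LIM_zero_cancel, rule Lim_null_comparison)
    show "\<forall>\<^sub>F y in at x. norm (v y - v x) \<le> 2 * K * \<bar>y - x\<bar>"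
      using quadratic_gradient_lipschitz[OF assms] by (intro always_eventually) auto
    show "((\<lambda>y. 2 * K * \<bar>y - x\<bar>) \<longlongrightarrow> 0) (at x)"
      by (auto intro!: tendsto_eq_intros)
  qed
  then show "isCont v x" by (simp add: isCont_def)
  have "(f \<longlongrightarrow> f x) (at x)"
  proof (rule LIM_zero_cancel, rule Lim_null_comparison)
    show "\<forall>\<^sub>F y in at x. norm (f y - f x) \<le> \<bar>v x\<bar> * \<bar>y - x\<bar> + K * (y - x)\<^sup>2"
    proof (intro always_eventually allI)
      fix y
      have "\<bar>f y - f x - v x * (y - x)\<bar> \<le> K * (y - x)\<^sup>2"
        using quadratic_gradientD[OF assms, of x "y - x"] by simp
      then have "\<bar>f y - f x\<bar> \<le> \<bar>v x * (y - x)\<bar> + K * (y - x)\<^sup>2" by linarith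
      then show "norm (f y - f x) \<le> \<bar>v x\<bar> * \<bar>y - x\<bar> + K * (y - x)\<^sup>2"
        by (simp add: abs_mult)
    qed
    show "((\<lambda>y. \<bar>v x\<bar> * \<bar>y - x\<bar> + K * (y - x)\<^sup>2) \<longlongrightarrow> 0) (at x)"
      by (auto intro!: tendsto_eq_intros)
  qed
  then show "isCont f x" by (simp add: isCont_def)
qed

definition std_sum :: "nat \<Rightarrow> (nat \<Rightarrow> real) \<Rightarrow> real" where
  "std_sum n x = (\<Sum>i<n. x i) / sqrt (real n)"

lemma borel_measurable_rademacher_component:
  "i \<in> A \<Longrightarrow> (\<lambda>x. x i) \<in> borel_measurable (PiM A (\<lambda>_. rademacher))"
  using measurable_component_singleton[of i A "\<lambda>_. rademacher"] by (simp cong: measurable_cong_sets)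

lemma borel_measurable_std_sum:
  "{..<n} \<subseteq> A \<Longrightarrow> std_sum n \<in> borel_measurable (PiM A (\<lambda>_. rademacher))"
  unfolding std_sum_def[abs_def]
  by (intro borel_measurable_divide borel_measurable_sum borel_measurable_const
      borel_measurable_rademacher_component) auto

lemma std_sum_flip:
  assumes "i < n"
  shows "std_sum n (x(i := - x i)) = std_sum n x + (- 2 * x i / sqrt (real n))"
proof -
  have "(\<Sum>j<n. (x(i := - x i)) j) = - x i + (\<Sum>j\<in>{..<n} - {i}. x j)"
    using assms by (subst sum.remove[of _ i]) auto
  also have "\<dots> = (\<Sum>j<n. x j) - 2 * x i"
    using assms by (subst (2) sum.remove[of _ i]) auto
  finally show ?thesis by (simp add: std_sum_def diff_divide_distrib)
qed

text \<open>Flipping one sign moves the standardised sum by \<open>2 / sqrt n\<close>, so each of the \<open>n\<close> discrete derivatives is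
  \<open>v / sqrt n\<close> up to an error of order \<open>1/n\<close>. Their squares add up to \<open>v\<^sup>2\<close>, and the errors together cost
  \<open>2 * K / sqrt n\<close>.\<close>

lemma rademacher_bobkov_std_sum:
  fixes f v :: "real \<Rightarrow> real"
  assumes f01: "\<And>x. 0 < f x \<and> f x < 1" and grad: "quadratic_gradient K f v" and vB: "\<And>x. \<bar>v x\<bar> \<le> B"
    and n: "0 < n"
  defines "P \<equiv> PiM {..<n} (\<lambda>_. rademacher)"
  shows "profile (\<integral>x. f (std_sum n x) \<partial>P)
    \<le> (\<integral>x. sqrt ((profile (f (std_sum n x)))\<^sup>2 + (v (std_sum n x))\<^sup>2) \<partial>P) + 2 * K / sqrt (real n)"
proof -
  interpret P: prob_space P unfolding P_def by (rule prob_space_PiM prob_space_rademacher)+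
  have cont: "f \<in> borel_measurable borel" "v \<in> borel_measurable borel"
    using quadratic_gradient_continuous[OF grad]
    by (auto intro!: borel_measurable_continuous_onI continuous_at_imp_continuous_on)
  note [measurable] = cont
  have [measurable]: "std_sum n \<in> borel_measurable P" unfolding P_def by (simp add: borel_measurable_std_sum)
  have K: "0 \<le> K" using quadratic_gradientD[OF grad, of 0 1] by simp
  have flip: "(\<lambda>x. x(i := - x i)) \<in> measurable P P" if "i < n" for i
    unfolding P_def
  proof (rule measurable_fun_upd[where J="{..<n}"])
    show "(\<lambda>x. - x i) \<in> measurable (PiM {..<n} (\<lambda>_. rademacher)) rademacher"
      using borel_measurable_uminus[OF borel_measurable_rademacher_component[of i "{..<n}"]] that
      by (simp cong: measurable_cong_sets)
    show "(\<lambda>x. x) \<in> measurable (PiM {..<n} (\<lambda>_. rademacher)) (PiM {..<n} (\<lambda>_. rademacher))"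
      by (rule measurable_ident_sets[OF refl])
  qed (use that in auto)
  define V where "V i x = (f (std_sum n x) - f (std_sum n (x(i := - x i)))) / 2" for i x
  have V_meas: "V i \<in> borel_measurable P" if "i < n" for i
  proof -
    have "(\<lambda>x. std_sum n (x(i := - x i))) \<in> borel_measurable P"
      by (rule measurable_compose[OF flip[OF that]]) measurable
    then show ?thesis unfolding V_def by measurable
  qed
  let ?s = "\<lambda>x. sqrt ((profile (f (std_sum n x)))\<^sup>2 + (\<Sum>i<n. (V i x)\<^sup>2))"
  let ?t = "\<lambda>x. sqrt ((profile (f (std_sum n x)))\<^sup>2 + (v (std_sum n x))\<^sup>2) + 2 * K / sqrt (real n)"
  have "profile (\<integral>x. f (std_sum n x) \<partial>P) \<le> (\<integral>x. ?s x \<partial>P)"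
    unfolding P_def
  proof (rule rademacher.bobkov_product[where B=1])
    show "(\<lambda>x. f (std_sum n x)) \<in> borel_measurable (PiM {..<n} (\<lambda>_. rademacher))"
      unfolding P_def[symmetric] by measurable
    show "V i \<in> borel_measurable (PiM {..<n} (\<lambda>_. rademacher))" if "i \<in> {..<n}" for i
      using V_meas[of i] that by (simp add: P_def)
    show "0 < f (std_sum n x) \<and> f (std_sum n x) < 1" for x by (rule f01)
    show "\<bar>V i x\<bar> \<le> 1" for i x
      using f01[of "std_sum n x"] f01[of "std_sum n (x(i := - x i))"] by (simp add: V_def abs_le_iff)
  qed (auto simp: V_def)
  also have "\<dots> \<le> (\<integral>x. ?t x \<partial>P)"
  proof (rule integral_mono_AE')
    have le: "?t x \<le> 1 + \<bar>B\<bar> + 2 * K / sqrt (real n)" for x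
    proof -
      have "sqrt ((profile (f (std_sum n x)))\<^sup>2 + (v (std_sum n x))\<^sup>2)
          \<le> \<bar>profile (f (std_sum n x))\<bar> + \<bar>v (std_sum n x)\<bar>"
        by (rule sqrt_sum_squares_le_sum_abs)
      also have "\<dots> \<le> 1 + \<bar>B\<bar>"
        using vB[of "std_sum n x"] profile_pos[of "f (std_sum n x)"] profile_le_half[of "f (std_sum n x)"]
        by linarith
      finally show ?thesis by simp
    qed
    have nonneg: "0 \<le> ?t x" for x using K by simp
    show "integrable P ?t"
      by (rule P.integrable_const_bound[where B="1 + \<bar>B\<bar> + 2 * K / sqrt (real n)"])
         (use le nonneg in \<open>auto intro!: AE_I2\<close>)
    show "AE x in P. 0 \<le> ?t x" using nonneg by simp
    have "AE x in P. \<forall>i\<in>{..<n}. \<bar>x i\<bar> = 1"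
      unfolding P_def
      by (intro AE_finite_allI AE_PiM_component prob_space_rademacher AE_rademacher) auto
    then show "AE x in P. ?s x \<le> ?t x"
    proof eventually_elim
      case (elim x)
      let ?S = "std_sum n x" and ?r = "sqrt (real n)"
      have r: "0 < ?r" using n by simp
      have "\<bar>V i x\<bar> \<le> (\<bar>v ?S\<bar> + 2 * K / ?r) / ?r" if "i < n" for i
      proof -
        define h where "h = - 2 * x i / ?r"
        have h: "\<bar>h\<bar> = 2 / ?r" using elim that r by (simp add: h_def abs_mult)
        have "h\<^sup>2 = (2 / ?r)\<^sup>2" using h by (metis power2_abs)
        have "\<bar>f (?S + h) - f ?S - v ?S * h\<bar> \<le> K * h\<^sup>2" by (rule quadratic_gradientD[OF grad])
        then have "\<bar>f (?S + h) - f ?S\<bar> \<le> \<bar>v ?S * h\<bar> + K * h\<^sup>2" by linarith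
        also have "\<dots> = 2 * ((\<bar>v ?S\<bar> + 2 * K / ?r) / ?r)"
          unfolding \<open>h\<^sup>2 = (2 / ?r)\<^sup>2\<close> abs_mult h using r by (simp add: field_simps power2_eq_square)
        finally have le: "\<bar>f (?S + h) - f ?S\<bar> \<le> 2 * ((\<bar>v ?S\<bar> + 2 * K / ?r) / ?r)" .
        have V: "V i x = (f ?S - f (?S + h)) / 2"
          unfolding V_def h_def std_sum_flip[OF that] ..
        have half: "\<bar>(b - a) / 2\<bar> \<le> R" if "\<bar>a - b\<bar> \<le> 2 * R" for a b R :: real
          using that by (simp add: abs_le_iff)
        show ?thesis unfolding V by (rule half[OF le])
      qed
      then have "(V i x)\<^sup>2 \<le> ((\<bar>v ?S\<bar> + 2 * K / ?r) / ?r)\<^sup>2" if "i < n" for i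
        using that by (subst power2_abs[symmetric]) (intro power_mono, auto)
      then have "(\<Sum>i<n. (V i x)\<^sup>2) \<le> (\<Sum>i<n. ((\<bar>v ?S\<bar> + 2 * K / ?r) / ?r)\<^sup>2)"
        by (intro sum_mono) auto
      also have "\<dots> = (\<bar>v ?S\<bar> + 2 * K / ?r)\<^sup>2"
        using n by (simp add: power_divide)
      finally have "?s x \<le> sqrt ((profile (f ?S) + 0)\<^sup>2 + (\<bar>v ?S\<bar> + 2 * K / ?r)\<^sup>2)" by simp
      also have "\<dots> \<le> sqrt ((profile (f ?S))\<^sup>2 + \<bar>v ?S\<bar>\<^sup>2) + sqrt (0\<^sup>2 + (2 * K / ?r)\<^sup>2)"
        by (rule real_sqrt_sum_squares_triangle_ineq)
      also have "\<dots> = ?t x" using K by simp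
      finally show ?case .
    qed
  qed
  also have "\<dots> = (\<integral>x. sqrt ((profile (f (std_sum n x)))\<^sup>2 + (v (std_sum n x))\<^sup>2) \<partial>P) + 2 * K / sqrt (real n)"
  proof -
    have "sqrt ((profile (f (std_sum n x)))\<^sup>2 + (v (std_sum n x))\<^sup>2) \<le> 1 + \<bar>B\<bar>" for x
      using sqrt_sum_squares_le_sum_abs[of "profile (f (std_sum n x))" "v (std_sum n x)"]
        vB[of "std_sum n x"] profile_pos[of "f (std_sum n x)"] profile_le_half[of "f (std_sum n x)"]
      by linarith
    then have "integrable P (\<lambda>x. sqrt ((profile (f (std_sum n x)))\<^sup>2 + (v (std_sum n x))\<^sup>2))"
      by (intro P.integrable_const_bound[where B="1 + \<bar>B\<bar>"] AE_I2) auto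
    then show ?thesis by (simp add: P.prob_space)
  qed
  finally show ?thesis .
qed

text \<open>Let \<open>n\<close> tend to infinity in the inequality for standardised sums of signs. Both integrands are bounded and
  continuous, so the central limit theorem identifies the limits.\<close>

lemma bobkov_gauss_one:
  fixes f v :: "real \<Rightarrow> real"
  assumes f01: "\<And>x. 0 < f x \<and> f x < 1" and grad: "quadratic_gradient K f v" and vB: "\<And>x. \<bar>v x\<bar> \<le> B"
  shows "profile (\<integral>x. f x \<partial>gauss) \<le> (\<integral>x. sqrt ((profile (f x))\<^sup>2 + (v x)\<^sup>2) \<partial>gauss)"
proof -
  let ?M = "PiM (UNIV :: nat set) (\<lambda>_. rademacher)"
  let ?t = "\<lambda>x. sqrt ((profile (f x))\<^sup>2 + (v x)\<^sup>2)"
  interpret M: product_prob_space "\<lambda>_. rademacher" "UNIV :: nat set"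
    by unfold_locales
  interpret M: prob_space ?M by (rule prob_space_PiM prob_space_rademacher)+
  interpret G: real_distribution gauss by (rule real_distribution_gauss)
  define \<mu> where "\<mu> n = distr ?M borel (std_sum n)" for n
  have std_sum [measurable]: "std_sum n \<in> borel_measurable ?M" for n by (simp add: borel_measurable_std_sum)
  have mu: "real_distribution (\<mu> n)" for n unfolding \<mu>_def by simp
  have coord: "distr ?M borel (\<lambda>x. x i) = rademacher" for i
    using distr_PiM_component[of UNIV "\<lambda>_. rademacher" i] prob_space_rademacher
    by (simp cong: distr_cong)
  have [measurable]: "(\<lambda>x. x i) \<in> borel_measurable ?M" for i
    by (rule borel_measurable_rademacher_component) simp
  have coord_int: "(\<integral>x. g (x i) \<partial>?M) = (g 1 + g (- 1)) / 2"
    if "g \<in> borel_measurable borel" for g :: "real \<Rightarrow> real" and i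
    using that by (subst integral_rademacher[symmetric], simp, subst coord[of i, symmetric])
      (simp add: integral_distr)
  have weak: "weak_conv_m \<mu> gauss"
  proof -
    have "weak_conv_m (\<lambda>n. distr ?M borel (\<lambda>x. (\<Sum>i<n. x i) / sqrt (real n * 1\<^sup>2))) gauss"
    proof (rule M.central_limit_theorem_zero_mean)
      show "M.indep_vars (\<lambda>i. borel) (\<lambda>i x. x i) UNIV"
        by (subst M.indep_vars_iff_distr_eq_PiM')
           (simp_all add: coord restrict_UNIV distr_id2 cong: sets_PiM_cong)
      show "M.expectation (\<lambda>x. x i) = 0" for i
        using coord_int[of "\<lambda>x. x" i] by simp
      then show "M.variance (\<lambda>x. x i) = 1\<^sup>2" for i
        using coord_int[of "\<lambda>x. x\<^sup>2" i] by simp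
      show "integrable ?M (\<lambda>x. (x i)\<^sup>2)" for i
      proof -
        have "integrable (distr ?M borel (\<lambda>x. x i)) (\<lambda>t. t\<^sup>2)"
          unfolding coord by (rule integrable_rademacher) simp
        then show ?thesis by (simp add: integrable_distr_eq)
      qed
      show "distr ?M borel (\<lambda>x. x i) = rademacher" for i by (rule coord)
    qed simp
    then show ?thesis by (simp add: \<mu>_def[abs_def] std_sum_def[abs_def])
  qed
  have transfer: "(\<integral>x. g (std_sum n x) \<partial>PiM {..<n} (\<lambda>_. rademacher)) = (\<integral>x. g x \<partial>\<mu> n)"
    if [measurable]: "g \<in> borel_measurable borel" for g :: "real \<Rightarrow> real" and n
  proof -
    have "(\<integral>x. g (std_sum n x) \<partial>PiM {..<n} (\<lambda>_. rademacher)) = (\<integral>x. g (std_sum n (restrict x {..<n})) \<partial>?M)"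
      using measurable_compose[OF borel_measurable_std_sum[of n "{..<n}", OF subset_refl] that]
      by (subst M.distr_PiM_restrict_finite[of "{..<n}", symmetric])
         (simp_all add: integral_distr[OF measurable_restrict_subset[OF subset_UNIV]])
    also have "\<dots> = (\<integral>x. g (std_sum n x) \<partial>?M)"
      by (simp add: std_sum_def)
    finally show ?thesis by (simp add: \<mu>_def integral_distr)
  qed
  have fcont: "isCont f x" and vcont: "isCont v x" for x
    using quadratic_gradient_continuous[OF grad] by auto
  have tcont: "isCont ?t x" for x
  proof -
    have "continuous_on UNIV ?t"
      by (intro continuous_intros continuous_on_profile continuous_at_imp_continuous_on)
         (use fcont vcont f01 in auto)
    then show ?thesis by (simp add: continuous_on_eq_continuous_at)
  qed
  have [measurable]: "f \<in> borel_measurable borel" "?t \<in> borel_measurable borel"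
    using fcont tcont by (auto intro!: borel_measurable_continuous_onI continuous_at_imp_continuous_on)
  have lim_f: "(\<lambda>n. \<integral>x. f x \<partial>\<mu> n) \<longlonglongrightarrow> (\<integral>x. f x \<partial>gauss)"
    by (rule weak_conv_imp_integral_bdd_continuous_conv[OF mu real_distribution_gauss weak, where B=1])
       (use f01 fcont in \<open>simp_all add: less_imp_le\<close>)
  have lim_t: "(\<lambda>n. \<integral>x. ?t x \<partial>\<mu> n) \<longlonglongrightarrow> (\<integral>x. ?t x \<partial>gauss)"
  proof (rule weak_conv_imp_integral_bdd_continuous_conv[OF mu real_distribution_gauss weak, where B="1 + \<bar>B\<bar>"])
    show "norm (?t x) \<le> 1 + \<bar>B\<bar>" for x
      using sqrt_sum_squares_le_sum_abs[of "profile (f x)" "v x"]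
        vB[of x] profile_pos[of "f x"] profile_le_half[of "f x"] by simp
  qed (rule tcont)
  have g01: "0 < (\<integral>x. f x \<partial>gauss)" "(\<integral>x. f x \<partial>gauss) < 1"
    using f01 by (auto intro!: G.integral_between)
  have "isCont profile (\<integral>x. f x \<partial>gauss)"
    by (rule DERIV_isCont, rule profile_has_real_derivative[OF DERIV_ident]) (use g01 in auto)
  then have "(\<lambda>n. profile (\<integral>x. f x \<partial>\<mu> n)) \<longlonglongrightarrow> profile (\<integral>x. f x \<partial>gauss)"
    using lim_f by (rule isCont_tendsto_compose)
  moreover have "(\<lambda>n. (\<integral>x. ?t x \<partial>\<mu> n) + 2 * K / sqrt (real n)) \<longlonglongrightarrow> (\<integral>x. ?t x \<partial>gauss) + 0"
    by (intro tendsto_add lim_t real_tendsto_divide_at_top[OF tendsto_const]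
          filterlim_compose[OF sqrt_at_top] filterlim_real_sequentially)
  ultimately have "profile (\<integral>x. f x \<partial>gauss) \<le> (\<integral>x. ?t x \<partial>gauss) + 0"
  proof (rule LIMSEQ_le)
    show "\<exists>N. \<forall>n\<ge>N. profile (\<integral>x. f x \<partial>\<mu> n) \<le> (\<integral>x. ?t x \<partial>\<mu> n) + 2 * K / sqrt (real n)"
    proof (intro exI allI impI)
      fix n :: nat
      assume "1 \<le> n"
      then have "0 < n" by simp
      from rademacher_bobkov_std_sum[OF f01 grad vB this]
      show "profile (\<integral>x. f x \<partial>\<mu> n) \<le> (\<integral>x. ?t x \<partial>\<mu> n) + 2 * K / sqrt (real n)"
        unfolding transfer[of f n, OF \<open>f \<in> borel_measurable borel\<close>]
          transfer[of ?t n, OF \<open>?t \<in> borel_measurable borel\<close>] .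
    qed
  qed
  then show ?thesis by simp
qed

interpretation gauss: bobkov_space gauss "quadratic_gradient K" for K
proof (intro bobkov_space.intro bobkov_space_axioms.intro prob_space_gauss)
  interpret G: real_distribution gauss by (rule real_distribution_gauss)
  show "sets gauss = sets borel" by simp
  show "profile (\<integral>x. f x \<partial>gauss) \<le> (\<integral>x. sqrt ((profile (f x))\<^sup>2 + (v x)\<^sup>2) \<partial>gauss)"
    if "\<And>x. 0 < f x \<and> f x < 1" "\<And>x. \<bar>v x\<bar> \<le> B" "quadratic_gradient K f v" for f v B
    using bobkov_gauss_one that by blast
  fix f v :: "real \<times> real \<Rightarrow> real" and B
  assume [measurable]: "f \<in> borel_measurable (borel \<Otimes>\<^sub>M borel)" "v \<in> borel_measurable (borel \<Otimes>\<^sub>M borel)"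
    and f01: "\<And>x y. 0 < f (x, y) \<and> f (x, y) < 1" and vB: "\<And>x y. \<bar>v (x, y)\<bar> \<le> B"
    and grad: "\<And>y. quadratic_gradient K (\<lambda>x. f (x, y)) (\<lambda>x. v (x, y))"
  have f_int: "integrable gauss (\<lambda>y. f (x, y))" for x
  proof (rule G.integrable_const_bound[where B=1])
    show "AE y in gauss. norm (f (x, y)) \<le> 1"
    proof (rule AE_I2)
      show "norm (f (x, y)) \<le> 1" for y using f01[of x y] by simp
    qed
  qed measurable
  have v_int: "integrable gauss (\<lambda>y. v (x, y))" for x
    by (rule G.integrable_const_bound[where B=B]) (use vB in auto)
  show "quadratic_gradient K (\<lambda>x. \<integral>y. f (x, y) \<partial>gauss) (\<lambda>x. \<integral>y. v (x, y) \<partial>gauss)"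
    unfolding quadratic_gradient_def
  proof (intro allI)
    fix x h
    have "\<bar>(\<integral>y. f (x + h, y) \<partial>gauss) - (\<integral>y. f (x, y) \<partial>gauss) - (\<integral>y. v (x, y) \<partial>gauss) * h\<bar>
        = \<bar>\<integral>y. f (x + h, y) - f (x, y) - v (x, y) * h \<partial>gauss\<bar>"
      using f_int v_int by simp
    also have "\<dots> \<le> (\<integral>y. \<bar>f (x + h, y) - f (x, y) - v (x, y) * h\<bar> \<partial>gauss)"
      by (rule integral_abs_bound)
    also have "\<dots> \<le> (\<integral>y. K * h\<^sup>2 \<partial>gauss)"
      using f_int v_int quadratic_gradientD[OF grad]
      by (intro integral_mono) auto
    finally show "\<bar>(\<integral>y. f (x + h, y) \<partial>gauss) - (\<integral>y. f (x, y) \<partial>gauss) - (\<integral>y. v (x, y) \<partial>gauss) * h\<bar> \<le> K * h\<^sup>2"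
      using G.prob_space by simp
  qed
qed

section \<open>Gaussian isoperimetry for convex sets\<close>

definition basis_comb :: "('a::euclidean_space \<Rightarrow> real) \<Rightarrow> 'a" where
  "basis_comb x = (\<Sum>b\<in>Basis. x b *\<^sub>R b)"

text \<open>The standard Gaussian law as an image of the product measure, the form that the product theorem
  acts on; its density is computed below.\<close>

definition std_gauss :: "'a::euclidean_space measure" where
  "std_gauss = distr (PiM Basis (\<lambda>_. gauss)) borel basis_comb"

lemma borel_measurable_gauss_component:
  "i \<in> A \<Longrightarrow> (\<lambda>x. x i) \<in> borel_measurable (PiM A (\<lambda>_. gauss))"
  using measurable_component_singleton[of i A "\<lambda>_. gauss"] by (simp cong: measurable_cong_sets)

lemma borel_measurable_basis_comb [measurable]:
  "basis_comb \<in> borel_measurable (PiM Basis (\<lambda>_. gauss))"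
  unfolding basis_comb_def[abs_def]
  by (intro borel_measurable_sum borel_measurable_scaleR borel_measurable_const
      borel_measurable_gauss_component)

lemma prob_space_std_gauss: "prob_space std_gauss"
  unfolding std_gauss_def
  by (intro prob_space.prob_space_distr prob_space_PiM prob_space_gauss borel_measurable_basis_comb)

lemma sets_std_gauss [simp, measurable_cong]: "sets std_gauss = sets borel"
  by (simp add: std_gauss_def)

lemma space_std_gauss [simp]: "space std_gauss = UNIV"
  by (simp add: std_gauss_def)

lemma basis_comb_upd:
  assumes "b \<in> Basis"
  shows "basis_comb (x(b := t + h)) = basis_comb (x(b := t)) + h *\<^sub>R b"
proof -
  have "basis_comb (x(b := s)) = s *\<^sub>R b + (\<Sum>c\<in>Basis - {b}. x c *\<^sub>R c)" for s
    unfolding basis_comb_def using assms by (subst sum.remove[of _ b]) auto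
  then show ?thesis by (simp add: scaleR_left_distrib)
qed

lemma norm_sq_sum_Basis: "(norm (x::'a::euclidean_space))\<^sup>2 = (\<Sum>b\<in>Basis. (x \<bullet> b)\<^sup>2)"
  unfolding power2_norm_eq_inner by (subst euclidean_inner) (simp add: power2_eq_square)

text \<open>Along each basis vector \<open>f\<close> has the inner product of \<open>v\<close> with that vector as derivative, so the product
  theorem applies coordinate by coordinate.\<close>

theorem bobkov_std_gauss:
  fixes f :: "'a::euclidean_space \<Rightarrow> real" and v :: "'a \<Rightarrow> 'a"
  assumes [measurable]: "f \<in> borel_measurable borel" "v \<in> borel_measurable borel"
    and f01: "\<And>x. 0 < f x \<and> f x < 1" and vB: "\<And>x. norm (v x) \<le> B"
    and grad: "\<And>x h. \<bar>f (x + h) - f x - v x \<bullet> h\<bar> \<le> K * (norm h)\<^sup>2"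
  shows "profile (\<integral>x. f x \<partial>std_gauss) \<le> (\<integral>x. sqrt ((profile (f x))\<^sup>2 + (norm (v x))\<^sup>2) \<partial>std_gauss)"
proof -
  have "profile (\<integral>x. f (basis_comb x) \<partial>PiM Basis (\<lambda>_. gauss))
    \<le> (\<integral>x. sqrt ((profile (f (basis_comb x)))\<^sup>2 + (\<Sum>b\<in>Basis. (v (basis_comb x) \<bullet> b)\<^sup>2)) \<partial>PiM Basis (\<lambda>_. gauss))"
  proof (rule gauss.bobkov_product[where K=K and B=B])
    show "\<bar>v (basis_comb x) \<bullet> b\<bar> \<le> B" if "b \<in> Basis" for b x
      using Basis_le_norm[OF that, of "v (basis_comb x)"] vB[of "basis_comb x"] by linarith
    show "quadratic_gradient K (\<lambda>t. f (basis_comb (x(b := t)))) (\<lambda>t. v (basis_comb (x(b := t))) \<bullet> b)"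
      if "b \<in> Basis" for b x
      unfolding quadratic_gradient_def basis_comb_upd[OF that]
    proof (intro allI)
      fix t h
      show "\<bar>f (basis_comb (x(b := t)) + h *\<^sub>R b) - f (basis_comb (x(b := t)))
          - v (basis_comb (x(b := t))) \<bullet> b * h\<bar> \<le> K * h\<^sup>2"
        using grad[of "basis_comb (x(b := t))" "h *\<^sub>R b"] that by (simp add: mult.commute)
    qed
  qed (use f01 in auto)
  then show ?thesis
    by (simp add: std_gauss_def integral_distr norm_sq_sum_Basis)
qed

lemma phi_lipschitz: "\<bar>phi y - phi x\<bar> \<le> \<bar>y - x\<bar>"
proof -
  have "norm (phi y - phi x) \<le> 1 * norm (y - x)"
  proof (rule field_differentiable_bound[where S=UNIV and f'="\<lambda>z. - z * phi z * 1"])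
    show "(phi has_real_derivative - z * phi z * 1) (at z)" for z
      by (rule phi_has_real_derivative[OF DERIV_ident])
    show "norm (- z * phi z * 1) \<le> 1" for z
      using abs_mult_phi_le_one[of z] by simp
  qed auto
  then show ?thesis by simp
qed

text \<open>The density \<open>phi\<close> is Lipschitz with constant \<open>1\<close>.\<close>

lemma quadratic_gradient_Phi: "quadratic_gradient 1 Phi phi"
  unfolding quadratic_gradient_def
proof (intro allI)
  fix x h :: real
  have "norm ((Phi (x + h) - phi x * (x + h)) - (Phi x - phi x * x)) \<le> \<bar>h\<bar> * norm ((x + h) - x)"
  proof (rule field_differentiable_bound[where S="closed_segment x (x + h)" and f'="\<lambda>z. phi z - phi x"])
    show "((\<lambda>z. Phi z - phi x * z) has_real_derivative phi z - phi x) (at z within closed_segment x (x + h))" for z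
      by (auto intro!: derivative_eq_intros)
    show "norm (phi z - phi x) \<le> \<bar>h\<bar>" if "z \<in> closed_segment x (x + h)" for z
    proof -
      have "\<bar>z - x\<bar> \<le> \<bar>h\<bar>"
        using that by (auto simp: closed_segment_eq_real_ivl split: if_splits)
      with phi_lipschitz[of z x] show ?thesis by simp
    qed
  qed auto
  then show "\<bar>Phi (x + h) - Phi x - phi x * h\<bar> \<le> 1 * h\<^sup>2"
    by (simp add: algebra_simps power2_eq_square)
qed

lemma quadratic_gradient_has_derivative:
  assumes "quadratic_gradient K f v"
  shows "(f has_real_derivative v x) (at x)"
proof -
  have "((\<lambda>h. (f (x + h) - f x) / h) \<longlongrightarrow> v x) (at 0)"
  proof (rule LIM_zero_cancel, rule Lim_null_comparison)
    show "\<forall>\<^sub>F h in at 0. norm ((f (x + h) - f x) / h - v x) \<le> K * \<bar>h\<bar>"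
      unfolding eventually_at_filter
    proof (intro always_eventually allI impI)
      fix h :: real
      assume h: "h \<noteq> 0"
      have "(f (x + h) - f x) / h - v x = (f (x + h) - f x - v x * h) / h"
        using h by (simp add: field_simps)
      then have "norm ((f (x + h) - f x) / h - v x) = \<bar>f (x + h) - f x - v x * h\<bar> / \<bar>h\<bar>"
        by simp
      also have "\<dots> \<le> K * h\<^sup>2 / \<bar>h\<bar>"
        by (intro divide_right_mono quadratic_gradientD[OF assms]) simp
      also have "\<dots> = K * \<bar>h\<bar>"
        using h by (simp add: power2_eq_square abs_if)
      finally show "norm ((f (x + h) - f x) / h - v x) \<le> K * \<bar>h\<bar>" .
    qed
    show "((\<lambda>h. K * \<bar>h\<bar>) \<longlongrightarrow> 0) (at 0)" by (auto intro!: tendsto_eq_intros)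
  qed
  then show ?thesis by (simp add: DERIV_def)
qed

locale closed_convex =
  fixes C :: "'a::euclidean_space set"
  assumes closed_C: "closed C" and convex_C: "convex C" and C_nonempty: "C \<noteq> {}"
begin

definition resid :: "'a \<Rightarrow> 'a" where
  "resid x = x - closest_point C x"

lemma norm_resid: "norm (resid x) = infdist x C"
  using setdist_closest_point[OF closed_C C_nonempty, of x]
  by (simp add: resid_def infdist_eq_setdist C_nonempty dist_norm)

lemma continuous_on_resid: "continuous_on S resid"
  unfolding resid_def
  by (intro continuous_on_diff continuous_on_id continuous_on_closest_point convex_C closed_C C_nonempty)

text \<open>The squared distance to a convex set is differentiable with gradient \<open>2 * resid x\<close> and quadratic error. The upper
  bound holds because the projection of \<open>x\<close> competes for the distance at \<open>x + h\<close>. The lower bound uses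
  that the set lies on one side of the hyperplane supporting it at that projection.\<close>

lemma resid_sq_bounds:
  "2 * (resid x \<bullet> h) \<le> (norm (resid (x + h)))\<^sup>2 - (norm (resid x))\<^sup>2"
  "(norm (resid (x + h)))\<^sup>2 - (norm (resid x))\<^sup>2 \<le> 2 * (resid x \<bullet> h) + (norm h)\<^sup>2"
proof -
  have "norm (resid (x + h)) \<le> norm (resid x + h)"
    using closest_point_le[OF closed_C, of "closest_point C x" "x + h"]
      closest_point_in_set[OF closed_C C_nonempty, of x]
    by (simp add: resid_def dist_norm algebra_simps)
  then have "(norm (resid (x + h)))\<^sup>2 \<le> (norm (resid x + h))\<^sup>2" by (intro power_mono) auto
  then show "(norm (resid (x + h)))\<^sup>2 - (norm (resid x))\<^sup>2 \<le> 2 * (resid x \<bullet> h) + (norm h)\<^sup>2"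
    by (simp add: power2_norm_eq_inner inner_add_left inner_add_right inner_commute)
  have "resid x \<bullet> (closest_point C (x + h) - closest_point C x) \<le> 0"
    unfolding resid_def
    by (rule closest_point_dot[OF convex_C closed_C closest_point_in_set[OF closed_C C_nonempty]])
  then have "resid x \<bullet> resid x + resid x \<bullet> h \<le> resid x \<bullet> resid (x + h)"
    by (simp add: resid_def algebra_simps inner_add_left inner_add_right inner_diff_left inner_diff_right)
  moreover have "0 \<le> (resid (x + h) - resid x) \<bullet> (resid (x + h) - resid x)" by simp
  ultimately show "2 * (resid x \<bullet> h) \<le> (norm (resid (x + h)))\<^sup>2 - (norm (resid x))\<^sup>2"
    by (simp add: power2_norm_eq_inner inner_diff_left inner_diff_right inner_commute)
qed

text \<open>The distance has a kink on the boundary of \<open>C\<close>; this approximation has none, agrees with the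
  distance up to \<open>\<epsilon>\<close>, and still has gradient of norm at most \<open>1\<close>.\<close>

definition smooth_dist :: "real \<Rightarrow> 'a \<Rightarrow> real" where
  "smooth_dist \<epsilon> x = sqrt (\<epsilon>\<^sup>2 + (norm (resid x))\<^sup>2)"

lemma smooth_dist_ge: "0 < \<epsilon> \<Longrightarrow> \<epsilon> \<le> smooth_dist \<epsilon> x" "norm (resid x) \<le> smooth_dist \<epsilon> x"
  unfolding smooth_dist_def by (rule real_le_rsqrt; simp)+

lemma smooth_dist_sq: "(smooth_dist \<epsilon> x)\<^sup>2 = \<epsilon>\<^sup>2 + (norm (resid x))\<^sup>2"
  by (simp add: smooth_dist_def)

lemma smooth_dist_on_set: "0 < \<epsilon> \<Longrightarrow> x \<in> C \<Longrightarrow> smooth_dist \<epsilon> x = \<epsilon>"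
  by (simp add: smooth_dist_def resid_def closest_point_self)

lemma continuous_on_smooth_dist: "continuous_on S (smooth_dist \<epsilon>)"
  unfolding smooth_dist_def[abs_def] by (intro continuous_intros continuous_on_resid)

lemma smooth_dist_lipschitz: "\<bar>smooth_dist \<epsilon> (x + h) - smooth_dist \<epsilon> x\<bar> \<le> norm h"
proof -
  have le: "smooth_dist \<epsilon> y \<le> smooth_dist \<epsilon> x + dist x y" for x y
  proof -
    have "norm (resid y) \<le> norm (resid x) + dist x y"
      unfolding norm_resid using infdist_triangle[of y C x] by (simp add: dist_commute)
    then have "smooth_dist \<epsilon> y \<le> sqrt ((\<epsilon> + 0)\<^sup>2 + (norm (resid x) + dist x y)\<^sup>2)"
      unfolding smooth_dist_def by (intro real_sqrt_le_mono add_mono power_mono[of "norm (resid y)"]) auto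
    also have "\<dots> \<le> sqrt (\<epsilon>\<^sup>2 + (norm (resid x))\<^sup>2) + sqrt (0\<^sup>2 + (dist x y)\<^sup>2)"
      by (rule real_sqrt_sum_squares_triangle_ineq)
    finally show ?thesis by (simp add: smooth_dist_def)
  qed
  show ?thesis
    using le[of "x + h" x] le[of x "x + h"] by (simp add: dist_norm abs_le_iff)
qed

text \<open>Divide the expansion of the squared distance by \<open>2 * smooth_dist \<epsilon> x \<ge> 2 * \<epsilon>\<close>. The increment of the square differs from
  \<open>2 * smooth_dist \<epsilon> x\<close> times the increment by the square of the increment, which the Lipschitz bound
  controls.\<close>

lemma smooth_dist_gradient:
  assumes "0 < \<epsilon>"
  shows "\<bar>smooth_dist \<epsilon> (x + h) - smooth_dist \<epsilon> x - (resid x \<bullet> h) / smooth_dist \<epsilon> x\<bar> \<le> (norm h)\<^sup>2 / (2 * \<epsilon>)"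
proof -
  let ?F = "smooth_dist \<epsilon> x" and ?G = "smooth_dist \<epsilon> (x + h)"
  have F: "\<epsilon> \<le> ?F" "0 < ?F" using smooth_dist_ge(1)[OF assms, of x] assms by auto
  define e where "e = ?G - ?F - (resid x \<bullet> h) / ?F"
  have e: "2 * ?F * e = ?G\<^sup>2 - ?F\<^sup>2 - 2 * (resid x \<bullet> h) - (?G - ?F)\<^sup>2"
    using F by (simp add: e_def field_simps power2_eq_square)
  have "(?G - ?F)\<^sup>2 \<le> (norm h)\<^sup>2"
    using smooth_dist_lipschitz[of \<epsilon> x h] by (subst power2_abs[symmetric]) (intro power_mono, auto)
  then have "\<bar>2 * ?F * e\<bar> \<le> (norm h)\<^sup>2"
    using resid_sq_bounds[of x h] zero_le_power2[of "?G - ?F"]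
    unfolding e smooth_dist_sq abs_le_iff by linarith
  then have "2 * \<epsilon> * \<bar>e\<bar> \<le> (norm h)\<^sup>2"
    using F assms mult_right_mono[of "2 * \<epsilon>" "2 * ?F" "\<bar>e\<bar>"] by (simp add: abs_mult)
  then have "\<bar>e\<bar> \<le> (norm h)\<^sup>2 / (2 * \<epsilon>)"
    using assms by (simp add: field_simps)
  then show ?thesis by (simp only: e_def)
qed

text \<open>A smoothed distribution function of the distance: the probability that \<open>smooth_dist \<epsilon> x + Z / R \<le> r\<close> with
  an independent standard normal \<open>Z\<close>.\<close>

definition smooth_mass :: "real \<Rightarrow> real \<Rightarrow> real \<Rightarrow> real" where
  "smooth_mass \<epsilon> R r = (\<integral>x. Phi (R * (r - smooth_dist \<epsilon> x)) \<partial>std_gauss)"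

lemma measurable_smooth_dist [measurable]: "smooth_dist \<epsilon> \<in> borel_measurable borel"
  by (intro borel_measurable_continuous_onI continuous_on_smooth_dist)

lemma smooth_mass_bounds: "0 < smooth_mass \<epsilon> R r" "smooth_mass \<epsilon> R r < 1"
proof -
  interpret prob_space "std_gauss :: 'a measure" by (rule prob_space_std_gauss)
  show "0 < smooth_mass \<epsilon> R r" "smooth_mass \<epsilon> R r < 1"
    unfolding smooth_mass_def
    by (auto intro!: integral_between(1)[where b=1] integral_between(2)[where a=0] simp: Phi_bounds)
qed

lemma smooth_mass_derivative:
  "(smooth_mass \<epsilon> R has_real_derivative R * (\<integral>x. phi (R * (r - smooth_dist \<epsilon> x)) \<partial>std_gauss)) (at r)"
proof -
  interpret prob_space "std_gauss :: 'a measure" by (rule prob_space_std_gauss)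
  have int: "integrable std_gauss (\<lambda>x. phi (R * (r - smooth_dist \<epsilon> x)))"
    "integrable std_gauss (\<lambda>x. Phi (R * (r - smooth_dist \<epsilon> x)))" for r
    by (auto intro!: integrable_const_bound[where B=1] AE_I2 simp: Phi_bounds phi_le_one less_imp_le)
  have "quadratic_gradient (R\<^sup>2) (smooth_mass \<epsilon> R) (\<lambda>r. R * (\<integral>x. phi (R * (r - smooth_dist \<epsilon> x)) \<partial>std_gauss))"
    unfolding quadratic_gradient_def
  proof (intro allI)
    fix r h
    let ?a = "\<lambda>r x. R * (r - smooth_dist \<epsilon> x)"
    have "\<bar>smooth_mass \<epsilon> R (r + h) - smooth_mass \<epsilon> R r - R * (\<integral>x. phi (?a r x) \<partial>std_gauss) * h\<bar>
      = \<bar>\<integral>x. Phi (?a (r + h) x) - Phi (?a r x) - phi (?a r x) * (R * h) \<partial>std_gauss\<bar>"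
      using int by (simp add: smooth_mass_def mult_ac)
    also have "\<dots> \<le> (\<integral>x. \<bar>Phi (?a (r + h) x) - Phi (?a r x) - phi (?a r x) * (R * h)\<bar> \<partial>std_gauss)"
      by (rule integral_abs_bound)
    also have "\<dots> \<le> (\<integral>x. R\<^sup>2 * h\<^sup>2 \<partial>(std_gauss :: 'a measure))"
    proof (rule integral_mono)
      show "integrable std_gauss (\<lambda>x. \<bar>Phi (?a (r + h) x) - Phi (?a r x) - phi (?a r x) * (R * h)\<bar>)"
        using int by simp
      show "\<bar>Phi (?a (r + h) x) - Phi (?a r x) - phi (?a r x) * (R * h)\<bar> \<le> R\<^sup>2 * h\<^sup>2" for x
        using quadratic_gradientD[OF quadratic_gradient_Phi, of "?a r x" "R * h"]
        by (simp add: algebra_simps power_mult_distrib)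
    qed simp
    finally show "\<bar>smooth_mass \<epsilon> R (r + h) - smooth_mass \<epsilon> R r - R * (\<integral>x. phi (?a r x) \<partial>std_gauss) * h\<bar> \<le> R\<^sup>2 * h\<^sup>2"
      using prob_space by simp
  qed
  then show ?thesis by (rule quadratic_gradient_has_derivative)
qed

text \<open>For \<open>f = Phi (R * (r - F))\<close> with a function \<open>F\<close> of gradient at most \<open>1\<close>, the profile term \<open>I(f)\<close> is
  \<open>phi (R * (r - F))\<close> and the gradient term is at most \<open>R\<close> times the same quantity, so the square root in
  the functional inequality collapses.\<close>

lemma smooth_mass_bobkov:
  assumes \<epsilon>: "0 < \<epsilon>" and R: "0 < R"
  shows "profile (smooth_mass \<epsilon> R r) \<le> sqrt (1 + R\<^sup>2) * (\<integral>x. phi (R * (r - smooth_dist \<epsilon> x)) \<partial>std_gauss)"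
proof -
  interpret prob_space "std_gauss :: 'a measure" by (rule prob_space_std_gauss)
  let ?a = "\<lambda>x. R * (r - smooth_dist \<epsilon> x)"
  let ?v = "\<lambda>x. (- R * phi (?a x) / smooth_dist \<epsilon> x) *\<^sub>R resid x"
  have pos: "0 < smooth_dist \<epsilon> x" for x using smooth_dist_ge(1)[OF \<epsilon>, of x] \<epsilon> by simp
  have cont_v: "continuous_on UNIV ?v"
    using pos by (intro continuous_intros continuous_on_smooth_dist continuous_on_resid)
      (auto simp: less_imp_neq[THEN not_sym])
  have norm_v: "norm (?v x) \<le> R * phi (?a x)" for x
  proof -
    have "norm (?v x) = R * phi (?a x) * (norm (resid x) / smooth_dist \<epsilon> x)"
      using R pos[of x] phi_pos[of "?a x"] by (simp add: abs_mult)
    also have "\<dots> \<le> R * phi (?a x) * 1"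
      using R pos[of x] phi_pos[of "?a x"] smooth_dist_ge(2)[of x \<epsilon>]
      by (intro mult_left_mono) (auto simp: field_simps)
    finally show ?thesis by simp
  qed
  have "profile (smooth_mass \<epsilon> R r) \<le> (\<integral>x. sqrt ((profile (Phi (?a x)))\<^sup>2 + (norm (?v x))\<^sup>2) \<partial>std_gauss)"
    unfolding smooth_mass_def
  proof (rule bobkov_std_gauss[where B=R and K="R\<^sup>2 + R / (2 * \<epsilon>)"])
    show "?v \<in> borel_measurable borel"
      by (rule borel_measurable_continuous_onI[OF cont_v])
    show "norm (?v x) \<le> R" for x
    proof -
      have "R * phi (?a x) \<le> R * 1" using R by (intro mult_left_mono phi_le_one) simp
      with norm_v[of x] show ?thesis by linarith
    qed
    show "0 < Phi (?a x) \<and> Phi (?a x) < 1" for x by (simp add: Phi_bounds)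
    fix x h
    let ?d = "smooth_dist \<epsilon> (x + h) - smooth_dist \<epsilon> x"
    have "?a (x + h) = ?a x + - R * ?d" by (simp add: algebra_simps)
    then have "\<bar>Phi (?a (x + h)) - Phi (?a x) - phi (?a x) * (- R * ?d)\<bar> \<le> 1 * (- R * ?d)\<^sup>2"
      using quadratic_gradientD[OF quadratic_gradient_Phi, of "?a x" "- R * ?d"] by simp
    also have "\<dots> \<le> R\<^sup>2 * (norm h)\<^sup>2"
    proof -
      have "?d\<^sup>2 \<le> (norm h)\<^sup>2"
        using smooth_dist_lipschitz[of \<epsilon> x h] by (subst power2_abs[symmetric]) (intro power_mono, auto)
      then show ?thesis by (simp add: power_mult_distrib mult_left_mono)
    qed
    finally have A: "\<bar>Phi (?a (x + h)) - Phi (?a x) - phi (?a x) * (- R * ?d)\<bar> \<le> R\<^sup>2 * (norm h)\<^sup>2" .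
    have "\<bar>phi (?a x) * R * (?d - (resid x \<bullet> h) / smooth_dist \<epsilon> x)\<bar>
        = phi (?a x) * R * \<bar>?d - (resid x \<bullet> h) / smooth_dist \<epsilon> x\<bar>"
      using R phi_pos[of "?a x"] by (simp add: abs_mult)
    also have "\<dots> \<le> (1 * R) * ((norm h)\<^sup>2 / (2 * \<epsilon>))"
      using R phi_pos[of "?a x"] phi_le_half[of "?a x"] smooth_dist_gradient[OF \<epsilon>, of x h]
      by (intro mult_mono) (auto simp: less_imp_le)
    finally have B: "\<bar>phi (?a x) * R * (?d - (resid x \<bullet> h) / smooth_dist \<epsilon> x)\<bar> \<le> R / (2 * \<epsilon>) * (norm h)\<^sup>2"
      by simp
    have "Phi (?a (x + h)) - Phi (?a x) - ?v x \<bullet> h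
        = (Phi (?a (x + h)) - Phi (?a x) - phi (?a x) * (- R * ?d))
          - phi (?a x) * R * (?d - (resid x \<bullet> h) / smooth_dist \<epsilon> x)"
      by (simp add: algebra_simps)
    then show "\<bar>Phi (?a (x + h)) - Phi (?a x) - ?v x \<bullet> h\<bar> \<le> (R\<^sup>2 + R / (2 * \<epsilon>)) * (norm h)\<^sup>2"
      using A B unfolding distrib_right by linarith
  qed measurable
  also have "\<dots> \<le> (\<integral>x. sqrt (1 + R\<^sup>2) * phi (?a x) \<partial>std_gauss)"
  proof (rule integral_mono_AE')
    show "integrable std_gauss (\<lambda>x. sqrt (1 + R\<^sup>2) * phi (?a x))"
      by (intro integrable_mult_right integrable_const_bound[where B=1] AE_I2) (auto simp: phi_le_one)
    show "AE x in std_gauss. 0 \<le> sqrt (1 + R\<^sup>2) * phi (?a x)" by simp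
    show "AE x in std_gauss. sqrt ((profile (Phi (?a x)))\<^sup>2 + (norm (?v x))\<^sup>2) \<le> sqrt (1 + R\<^sup>2) * phi (?a x)"
    proof (rule AE_I2)
      fix x
      have "sqrt ((profile (Phi (?a x)))\<^sup>2 + (norm (?v x))\<^sup>2) \<le> sqrt ((phi (?a x))\<^sup>2 + (R * phi (?a x))\<^sup>2)"
        using norm_v[of x] by (intro real_sqrt_le_mono add_mono power_mono) auto
      also have "(phi (?a x))\<^sup>2 + (R * phi (?a x))\<^sup>2 = (1 + R\<^sup>2) * (phi (?a x))\<^sup>2"
        by (simp add: power_mult_distrib algebra_simps)
      finally show "sqrt ((profile (Phi (?a x)))\<^sup>2 + (norm (?v x))\<^sup>2) \<le> sqrt (1 + R\<^sup>2) * phi (?a x)"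
        using phi_pos[of "?a x"] by (simp add: real_sqrt_mult)
    qed
  qed
  finally show ?thesis by simp
qed

text \<open>The derivative of \<open>smooth_mass\<close> is \<open>R\<close> times the integral that bounds its profile, so \<open>inv Phi\<close> of it
  grows at least at rate \<open>R / sqrt (1 + R\<^sup>2)\<close>.\<close>

lemma smooth_mass_growth:
  assumes \<epsilon>: "0 < \<epsilon>" and R: "0 < R" and t: "0 \<le> t"
  shows "inv Phi (smooth_mass \<epsilon> R r) + R / sqrt (1 + R\<^sup>2) * t \<le> inv Phi (smooth_mass \<epsilon> R (r + t))"
proof -
  let ?I = "\<lambda>s. (\<integral>x. phi (R * (s - smooth_dist \<epsilon> x)) \<partial>std_gauss)"
  let ?g = "\<lambda>s. inv Phi (smooth_mass \<epsilon> R s) - R / sqrt (1 + R\<^sup>2) * s"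
  have "?g r \<le> ?g (r + t)"
  proof (rule DERIV_nonneg_imp_nondecreasing[of r "r + t" ?g])
    fix s
    let ?D = "R * ?I s / profile (smooth_mass \<epsilon> R s) - R / sqrt (1 + R\<^sup>2)"
    have "(?g has_real_derivative R * ?I s / phi (inv Phi (smooth_mass \<epsilon> R s)) - R / sqrt (1 + R\<^sup>2) * 1) (at s)"
      by (intro DERIV_diff inv_Phi_has_real_derivative smooth_mass_derivative smooth_mass_bounds
          DERIV_cmult DERIV_ident)
    then have "(?g has_real_derivative ?D) (at s)" by (simp add: profile_def)
    moreover have "0 \<le> ?D"
    proof -
      have q: "0 < sqrt (1 + R\<^sup>2)" by (simp add: add_pos_nonneg)
      have "R * profile (smooth_mass \<epsilon> R s) \<le> R * (sqrt (1 + R\<^sup>2) * ?I s)"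
        using smooth_mass_bobkov[OF \<epsilon> R] R by (intro mult_left_mono) auto
      then have "R / sqrt (1 + R\<^sup>2) \<le> R * ?I s / profile (smooth_mass \<epsilon> R s)"
        using q profile_pos[of "smooth_mass \<epsilon> R s"] by (simp add: divide_le_eq le_divide_eq mult_ac)
      then show ?thesis by simp
    qed
    ultimately show "\<exists>y. (?g has_real_derivative y) (at s) \<and> 0 \<le> y" by blast
  qed (use t in simp)
  then show ?thesis by (simp add: algebra_simps add_divide_distrib)
qed

text \<open>On \<open>C\<close> the smoothed distance equals \<open>\<epsilon>\<close>. At level \<open>2 * \<epsilon>\<close> with \<open>R = 1 / \<epsilon>\<^sup>2\<close> the argument of \<open>Phi\<close> is
  \<open>1 / \<epsilon>\<close> there, which tends to infinity although the level tends to \<open>0\<close>.\<close>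

lemma smooth_mass_lower:
  assumes "0 < \<epsilon>"
  shows "Phi (1 / \<epsilon>) * measure std_gauss C \<le> smooth_mass \<epsilon> (1 / \<epsilon>\<^sup>2) (2 * \<epsilon>)"
proof -
  interpret prob_space "std_gauss :: 'a measure" by (rule prob_space_std_gauss)
  have C [measurable]: "C \<in> sets borel" using closed_C by simp
  have "Phi (1 / \<epsilon>) * measure std_gauss C = (\<integral>x. Phi (1 / \<epsilon>) * indicator C x \<partial>std_gauss)"
    by simp
  also have "\<dots> \<le> smooth_mass \<epsilon> (1 / \<epsilon>\<^sup>2) (2 * \<epsilon>)"
    unfolding smooth_mass_def
  proof (rule integral_mono)
    show "integrable std_gauss (\<lambda>x. Phi (1 / \<epsilon>) * indicator C x)"
      by (intro integrable_mult_right integrable_real_indicator) (auto simp: emeasure_eq_measure)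
    show "integrable std_gauss (\<lambda>x. Phi (1 / \<epsilon>\<^sup>2 * (2 * \<epsilon> - smooth_dist \<epsilon> x)))"
      by (intro integrable_const_bound[where B=1] AE_I2) (auto simp: Phi_bounds less_imp_le)
    show "Phi (1 / \<epsilon>) * indicator C x \<le> Phi (1 / \<epsilon>\<^sup>2 * (2 * \<epsilon> - smooth_dist \<epsilon> x))" for x
      using smooth_dist_on_set[OF assms, of x] assms
      by (auto simp: indicator_def Phi_bounds less_imp_le power2_eq_square)
  qed
  finally show ?thesis .
qed

lemma smooth_mass_upper:
  assumes "0 < \<epsilon>"
  shows "smooth_mass \<epsilon> (1 / \<epsilon>\<^sup>2) (2 * \<epsilon> + t)
    \<le> measure std_gauss {x. infdist x C \<le> t + 3 * \<epsilon>} + Phi (- (1 / \<epsilon>))"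
proof -
  interpret prob_space "std_gauss :: 'a measure" by (rule prob_space_std_gauss)
  let ?T = "{x. infdist x C \<le> t + 3 * \<epsilon>}"
  have T [measurable]: "?T \<in> sets borel"
    by (intro borel_closed closed_Collect_le continuous_intros)
  have iT: "integrable std_gauss (indicator ?T :: 'a \<Rightarrow> real)"
    by (intro integrable_real_indicator) (auto simp: emeasure_eq_measure)
  have "smooth_mass \<epsilon> (1 / \<epsilon>\<^sup>2) (2 * \<epsilon> + t) \<le> (\<integral>x. indicator ?T x + Phi (- (1 / \<epsilon>)) \<partial>std_gauss)"
    unfolding smooth_mass_def
  proof (rule integral_mono)
    show "integrable std_gauss (\<lambda>x. Phi (1 / \<epsilon>\<^sup>2 * (2 * \<epsilon> + t - smooth_dist \<epsilon> x)))"
      by (intro integrable_const_bound[where B=1] AE_I2) (auto simp: Phi_bounds less_imp_le)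
    show "integrable std_gauss (\<lambda>x. indicator ?T x + Phi (- (1 / \<epsilon>)))"
      using iT by simp
    show "Phi (1 / \<epsilon>\<^sup>2 * (2 * \<epsilon> + t - smooth_dist \<epsilon> x)) \<le> indicator ?T x + Phi (- (1 / \<epsilon>))" for x
    proof (cases "x \<in> ?T")
      case True
      then show ?thesis
        using Phi_bounds[of "1 / \<epsilon>\<^sup>2 * (2 * \<epsilon> + t - smooth_dist \<epsilon> x)"] Phi_bounds[of "- (1 / \<epsilon>)"] by simp
    next
      case False
      then have "t + 3 * \<epsilon> < smooth_dist \<epsilon> x"
        using smooth_dist_ge(2)[of x \<epsilon>] by (simp add: norm_resid)
      then have "2 * \<epsilon> + t - smooth_dist \<epsilon> x \<le> - \<epsilon>" by simp
      then have "1 / \<epsilon>\<^sup>2 * (2 * \<epsilon> + t - smooth_dist \<epsilon> x) \<le> 1 / \<epsilon>\<^sup>2 * (- \<epsilon>)"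
        by (intro mult_left_mono) auto
      also have "\<dots> = - (1 / \<epsilon>)" using assms by (simp add: power2_eq_square)
      finally show ?thesis using False by simp
    qed
  qed
  also have "\<dots> = measure std_gauss ?T + Phi (- (1 / \<epsilon>))"
    using iT prob_space by simp
  finally show ?thesis .
qed

text \<open>Between the levels \<open>2 * \<epsilon>\<close> and \<open>2 * \<epsilon> + t\<close> the quantity \<open>inv Phi\<close> of the smoothed mass grows by almost \<open>t\<close>.
  The smoothed masses at these levels are close to the masses of \<open>C\<close> and of its \<open>t\<close>-neighbourhood, and
  \<open>\<epsilon>\<close> tends to \<open>0\<close>.\<close>

theorem gaussian_isoperimetry:
  assumes p: "0 < p" "p < 1" "p \<le> measure std_gauss C" and t: "0 \<le> t"
  shows "Phi (inv Phi p + t) \<le> measure std_gauss {x. infdist x C \<le> t}"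
proof -
  interpret prob_space "std_gauss :: 'a measure" by (rule prob_space_std_gauss)
  define \<epsilon> where "\<epsilon> n = 1 / real (Suc n)" for n
  have \<epsilon>: "0 < \<epsilon> n" for n by (simp add: \<epsilon>_def)
  have \<epsilon>0: "\<epsilon> \<longlonglongrightarrow> 0" unfolding \<epsilon>_def by (rule LIMSEQ_Suc[OF lim_1_over_n])
  have inv\<epsilon>: "filterlim (\<lambda>n. 1 / \<epsilon> n) at_top sequentially"
    unfolding \<epsilon>_def
    by (simp add: filterlim_tendsto_add_at_top[OF tendsto_const filterlim_real_sequentially])
  have P1: "(\<lambda>n. Phi (1 / \<epsilon> n)) \<longlonglongrightarrow> 1"
    by (rule filterlim_compose[OF Phi_at_top inv\<epsilon>])
  have P0: "(\<lambda>n. Phi (- (1 / \<epsilon> n))) \<longlonglongrightarrow> 0"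
    by (rule filterlim_compose[OF Phi_at_bot]) (simp add: filterlim_uminus_at_bot inv\<epsilon>)
  let ?rho = "\<lambda>n. 1 / sqrt (1 + (\<epsilon> n) ^ 4)"
  let ?T = "\<lambda>n. {x :: 'a. infdist x C \<le> t + 3 * \<epsilon> n}"
  have step: "Phi (inv Phi (Phi (1 / \<epsilon> n) * p) + ?rho n * t) \<le> measure std_gauss (?T n) + Phi (- (1 / \<epsilon> n))" for n
  proof -
    \<comment> \<open>The exponent in \<open>?rho\<close> comes from the choice \<open>R = 1 / \<epsilon>\<^sup>2\<close> in the growth rate.\<close>
    let ?R = "1 / (\<epsilon> n)\<^sup>2"
    have R: "0 < ?R" using \<epsilon>[of n] by simp
    have rho: "?R / sqrt (1 + ?R\<^sup>2) = ?rho n"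
    proof -
      have "1 + ?R\<^sup>2 = (1 + (\<epsilon> n) ^ 4) * ?R\<^sup>2"
        using \<epsilon>[of n] by (simp add: field_simps power_divide flip: power_mult)
      then have "sqrt (1 + ?R\<^sup>2) = sqrt (1 + (\<epsilon> n) ^ 4) * ?R"
        using R by (simp add: real_sqrt_mult)
      then show ?thesis using R by simp
    qed
    have "Phi (1 / \<epsilon> n) * p \<le> Phi (1 / \<epsilon> n) * measure std_gauss C"
      using p Phi_bounds(1) by (intro mult_left_mono) (auto simp: less_imp_le)
    also have "\<dots> \<le> smooth_mass (\<epsilon> n) ?R (2 * \<epsilon> n)" by (rule smooth_mass_lower[OF \<epsilon>])
    finally have "inv Phi (Phi (1 / \<epsilon> n) * p) \<le> inv Phi (smooth_mass (\<epsilon> n) ?R (2 * \<epsilon> n))"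
      using p Phi_bounds by (intro inv_Phi_mono smooth_mass_bounds) auto
    also have "\<dots> + ?rho n * t \<le> inv Phi (smooth_mass (\<epsilon> n) ?R (2 * \<epsilon> n + t))"
      using smooth_mass_growth[OF \<epsilon> R t, of n "2 * \<epsilon> n"] unfolding rho .
    finally have "Phi (inv Phi (Phi (1 / \<epsilon> n) * p) + ?rho n * t) \<le> smooth_mass (\<epsilon> n) ?R (2 * \<epsilon> n + t)"
      using Phi_inv_Phi[OF smooth_mass_bounds, of "\<epsilon> n" ?R "2 * \<epsilon> n + t"] by (metis Phi_le_iff add_le_cancel_right)
    also have "\<dots> \<le> measure std_gauss (?T n) + Phi (- (1 / \<epsilon> n))"
      by (rule smooth_mass_upper[OF \<epsilon>])
    finally show ?thesis .
  qed
  have lhs: "(\<lambda>n. Phi (inv Phi (Phi (1 / \<epsilon> n) * p) + ?rho n * t)) \<longlonglongrightarrow> Phi (inv Phi p + 1 * t)"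
  proof (rule isCont_tendsto_compose[OF DERIV_isCont[OF Phi_has_real_derivative_at]], rule tendsto_add)
    show "(\<lambda>n. inv Phi (Phi (1 / \<epsilon> n) * p)) \<longlonglongrightarrow> inv Phi p"
      using tendsto_mult[OF P1 tendsto_const[of p]]
      by (intro isCont_tendsto_compose[OF DERIV_isCont[OF inv_Phi_has_real_derivative_at[OF p(1,2)]]]) simp
    have "?rho \<longlonglongrightarrow> 1 / sqrt (1 + 0 ^ 4)"
      by (intro tendsto_intros \<epsilon>0) simp
    then show "(\<lambda>n. ?rho n * t) \<longlonglongrightarrow> 1 * t"
      by (intro tendsto_mult tendsto_const) simp
  qed
  have "(\<lambda>n. measure std_gauss (?T n)) \<longlonglongrightarrow> measure std_gauss (\<Inter>n. ?T n)"
  proof (rule finite_Lim_measure_decseq)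
    show "range ?T \<subseteq> sets std_gauss"
      by (auto intro!: borel_closed closed_Collect_le continuous_intros)
    show "decseq ?T"
    proof (rule antimonoI)
      fix m n :: nat
      assume "m \<le> n"
      then have "\<epsilon> n \<le> \<epsilon> m" by (simp add: \<epsilon>_def frac_le)
      then show "?T n \<subseteq> ?T m" by auto
    qed
  qed
  also have "(\<Inter>n. ?T n) = {x. infdist x C \<le> t}"
  proof (intro equalityI subsetI)
    fix x assume "x \<in> (\<Inter>n. ?T n)"
    then have "\<And>n. infdist x C \<le> t + 3 * \<epsilon> n" by auto
    moreover have "(\<lambda>n. t + 3 * \<epsilon> n) \<longlonglongrightarrow> t + 3 * 0"
      by (intro tendsto_intros \<epsilon>0)
    ultimately have "infdist x C \<le> t + 3 * 0"
      by (intro tendsto_lowerbound[OF _ always_eventually]) auto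
    then show "x \<in> {x. infdist x C \<le> t}" by simp
  next
    fix x assume "x \<in> {x. infdist x C \<le> t}"
    then have "infdist x C \<le> t + 3 * \<epsilon> n" for n using \<epsilon>[of n] by auto
    then show "x \<in> (\<Inter>n. ?T n)" by auto
  qed
  finally have "(\<lambda>n. measure std_gauss (?T n) + Phi (- (1 / \<epsilon> n))) \<longlonglongrightarrow> measure std_gauss {x. infdist x C \<le> t} + 0"
    by (intro tendsto_add P0)
  with lhs have "Phi (inv Phi p + 1 * t) \<le> measure std_gauss {x. infdist x C \<le> t} + 0"
    by (rule LIMSEQ_le) (use step in blast)
  then show ?thesis by simp
qed

end

section \<open>Gaussian tails and slabs\<close>

lemma exp_square_decay: "((\<lambda>t::real. exp (- t\<^sup>2 / 2)) \<longlongrightarrow> 0) at_top"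
  by real_asymp

text \<open>The difference \<open>c * exp (- t\<^sup>2 / 2) - (1 - Phi t)\<close> increases up to \<open>t = 1 / (c * sqrt (2 * pi))\<close> and afterwards decreases to
  \<open>0\<close>, so once nonnegative it stays nonnegative.\<close>

lemma Phi_tail_propagates:
  assumes c: "0 \<le> c" and t0: "1 - Phi t\<^sub>0 \<le> c * exp (- t\<^sub>0\<^sup>2 / 2)" and t: "t\<^sub>0 \<le> t"
  shows "1 - Phi t \<le> c * exp (- t\<^sup>2 / 2)"
proof -
  define D where "D s = c * exp (- s\<^sup>2 / 2) - (1 - Phi s)" for s
  have D': "(D has_real_derivative exp (- s\<^sup>2 / 2) * (1 / sqrt (2 * pi) - c * s)) (at s)" for s
    unfolding D_def by (auto intro!: derivative_eq_intros simp: std_normal_density_def algebra_simps)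
  show ?thesis
  proof (cases "c * t \<le> 1 / sqrt (2 * pi)")
    case True
    have "D t\<^sub>0 \<le> D t"
    proof (rule DERIV_nonneg_imp_nondecreasing[OF t])
      fix s
      assume "t\<^sub>0 \<le> s" "s \<le> t"
      then have "c * s \<le> 1 / sqrt (2 * pi)" using True mult_left_mono[of s t c] c by linarith
      then show "\<exists>y. (D has_real_derivative y) (at s) \<and> 0 \<le> y"
        using D'[of s] by (intro exI[of _ "exp (- s\<^sup>2 / 2) * (1 / sqrt (2 * pi) - c * s)"]) simp
    qed
    with t0 show ?thesis by (simp add: D_def)
  next
    case False
    have le: "D s \<le> D t" if "t \<le> s" for s
    proof (rule DERIV_nonpos_imp_nonincreasing[OF that])
      fix u
      assume "t \<le> u" "u \<le> s"
      then have "1 / sqrt (2 * pi) \<le> c * u" using False mult_left_mono[of t u c] c by linarith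
      then show "\<exists>y. (D has_real_derivative y) (at u) \<and> y \<le> 0"
        using D'[of u]
        by (intro exI[of _ "exp (- u\<^sup>2 / 2) * (1 / sqrt (2 * pi) - c * u)"]) (simp add: mult_nonneg_nonpos)
    qed
    have "(D \<longlongrightarrow> c * 0 - (1 - 1)) at_top"
      unfolding D_def by (intro tendsto_intros exp_square_decay Phi_at_top)
    then have "(D \<longlongrightarrow> 0) at_top" by simp
    then have "0 \<le> D t"
      by (rule tendsto_upperbound) (use le in \<open>auto simp: eventually_at_top_linorder\<close>)
    then show ?thesis by (simp add: D_def)
  qed
qed

lemma Phi_tail_exp_half: "0 \<le> t \<Longrightarrow> 1 - Phi t \<le> 1/2 * exp (- t\<^sup>2 / 2)"
  by (rule Phi_tail_propagates[where t\<^sub>0=0]) (auto simp: Phi_zero)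

lemma inv_Phi_upper_tail:
  assumes "0 < \<delta>" "\<delta> < 1"
  shows "inv Phi (1 - \<delta>) \<le> sqrt (2 * ln (1 / \<delta>))"
proof (cases "inv Phi (1 - \<delta>) \<le> 0")
  case True
  moreover have "0 \<le> sqrt (2 * ln (1 / \<delta>))" using assms by simp
  ultimately show ?thesis by linarith
next
  case False
  let ?q = "inv Phi (1 - \<delta>)"
  have "\<delta> = 1 - Phi ?q" using assms by (simp add: Phi_inv_Phi)
  also have "\<dots> \<le> 1/2 * exp (- ?q\<^sup>2 / 2)" using False by (intro Phi_tail_exp_half) simp
  also have "\<dots> \<le> exp (- ?q\<^sup>2 / 2)" by simp
  finally have "ln \<delta> \<le> - ?q\<^sup>2 / 2"
    using assms by (metis exp_gt_zero ln_exp ln_le_cancel_iff)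
  then have "?q\<^sup>2 \<le> 2 * ln (1 / \<delta>)" using assms by (simp add: ln_div)
  then show ?thesis by (rule real_le_rsqrt)
qed

lemma exp_minus_cubic_lower:
  fixes u :: real
  shows "1 - u + u\<^sup>2 / 2 - u ^ 3 / 6 \<le> exp (- u)"
proof -
  obtain s where "exp (- u) = (\<Sum>m<4. (- u) ^ m / fact m) + exp s / fact 4 * (- u) ^ 4"
    using Maclaurin_exp_le[of "- u" 4] by blast
  moreover have "(\<Sum>m<4. (- u) ^ m / fact m) = 1 - u + u\<^sup>2 / 2 - u ^ 3 / 6"
    by (simp add: numeral_eq_Suc field_simps)
  ultimately show ?thesis by simp
qed

lemma Phi_lower_taylor:
  assumes "0 \<le> t"
  shows "1/2 + (t - t ^ 3 / 6 + t ^ 5 / 40 - t ^ 7 / 336) / sqrt (2 * pi) \<le> Phi t"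
proof -
  let ?g = "\<lambda>s. Phi s - (s - s ^ 3 / 6 + s ^ 5 / 40 - s ^ 7 / 336) / sqrt (2 * pi)"
  have "?g 0 \<le> ?g t"
  proof (rule DERIV_nonneg_imp_nondecreasing[OF assms])
    fix s :: real
    let ?D = "phi s - (1 - s\<^sup>2 / 2 + s ^ 4 / 8 - s ^ 6 / 48) / sqrt (2 * pi)"
    have poly: "((\<lambda>s. s - s ^ 3 / 6 + s ^ 5 / 40 - s ^ 7 / 336) has_real_derivative
        1 - s\<^sup>2 / 2 + s ^ 4 / 8 - s ^ 6 / 48) (at s)"
      by (auto intro!: derivative_eq_intros)
    have "(?g has_real_derivative ?D) (at s)"
      by (intro DERIV_diff Phi_has_real_derivative_at DERIV_cdivide poly)
    moreover have "1 - s\<^sup>2 / 2 + s ^ 4 / 8 - s ^ 6 / 48 \<le> exp (- (s\<^sup>2 / 2))"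
      using exp_minus_cubic_lower[of "s\<^sup>2 / 2"] by (simp add: power_divide flip: power_mult)
    then have "0 \<le> ?D"
      by (simp add: std_normal_density_def divide_right_mono)
    ultimately show "\<exists>y. (?g has_real_derivative y) (at s) \<and> 0 \<le> y" by blast
  qed
  moreover have "?g 0 = 1/2" by (simp add: Phi_zero)
  ultimately show ?thesis by linarith
qed

text \<open>The margin is small: the true value is about \<open>0.88\<close>. It decides the case of two columns in the union
  bound. The rational \<open>1.1547\<close> lies just below \<open>sqrt (4/3)\<close>, a lower bound of \<open>sqrt (2 * ln 2)\<close>.\<close>

lemma Phi_sqrt_two_ln_two: "7/8 \<le> Phi (sqrt (2 * ln 2))"
proof -
  have "(11547 / 10000 :: real) \<le> sqrt (2 * ln 2)"
    by (rule real_le_rsqrt) (use ln2_ge_two_thirds in \<open>simp add: power2_eq_square\<close>)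
  then have "Phi (11547 / 10000) \<le> Phi (sqrt (2 * ln 2))" by simp
  moreover have "sqrt (2 * pi) \<le> 2507 / 1000"
    by (rule real_le_lsqrt) (use pi_approx(2) in \<open>auto simp: power2_eq_square\<close>)
  then have "3/8 \<le> (94015 / 100000) / sqrt (2 * pi)"
    by (simp add: le_divide_eq)
  moreover have "(94015 / 100000 :: real) / sqrt (2 * pi)
      \<le> (11547 / 10000 - (11547 / 10000) ^ 3 / 6 + (11547 / 10000) ^ 5 / 40 - (11547 / 10000) ^ 7 / 336) / sqrt (2 * pi)"
    by (rule divide_right_mono) (simp_all add: power_divide)
  ultimately show ?thesis
    using Phi_lower_taylor[of "11547 / 10000"] by linarith
qed

text \<open>Half of what the estimate \<open>1 - Phi t \<le> exp (- t\<^sup>2 / 2) / 2\<close> yields; the weaker constant would leave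
  nothing of the probability after summation over the two sides of \<open>p\<close> slabs.\<close>

lemma Phi_tail_union_bound:
  fixes p :: real
  assumes "2 \<le> p"
  shows "1 - Phi (sqrt (2 * ln p)) \<le> 1 / (4 * p)"
proof -
  have "1 - Phi (sqrt (2 * ln 2)) \<le> 1/4 * exp (- (sqrt (2 * ln 2))\<^sup>2 / 2)"
    using Phi_sqrt_two_ln_two by (simp add: exp_minus)
  then have "1 - Phi (sqrt (2 * ln p)) \<le> 1/4 * exp (- (sqrt (2 * ln p))\<^sup>2 / 2)"
    by (rule Phi_tail_propagates[rotated]) (use assms in simp_all)
  then show ?thesis using assms by (simp add: exp_minus field_simps)
qed

lemma nn_integral_layer_cake:
  assumes "sigma_finite_measure M" and [measurable]: "X \<in> borel_measurable M"
  shows "(\<integral>\<^sup>+\<omega>. ennreal (X \<omega>) \<partial>M)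
    = (\<integral>\<^sup>+t. emeasure M {\<omega>\<in>space M. t < X \<omega>} * indicator {0..} t \<partial>lborel)"
proof -
  interpret sigma_finite_measure M by fact
  interpret pair_sigma_finite lborel M ..
  have "(\<integral>\<^sup>+\<omega>. ennreal (X \<omega>) \<partial>M) = (\<integral>\<^sup>+\<omega>. (\<integral>\<^sup>+t. indicator {0..<X \<omega>} t \<partial>lborel) \<partial>M)"
  proof (rule nn_integral_cong)
    show "ennreal (X \<omega>) = (\<integral>\<^sup>+t. indicator {0..<X \<omega>} t \<partial>lborel)" for \<omega>
      by (cases "0 \<le> X \<omega>") (auto simp: ennreal_neg)
  qed
  also have "\<dots> = (\<integral>\<^sup>+\<omega>. (\<integral>\<^sup>+t. indicator {0..} t * indicator {\<omega>\<in>space M. t < X \<omega>} \<omega> \<partial>lborel) \<partial>M)"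
    by (intro nn_integral_cong) (auto simp: indicator_def intro!: nn_integral_cong)
  also have "\<dots> = (\<integral>\<^sup>+t. (\<integral>\<^sup>+\<omega>. indicator {0..} t * indicator {\<omega>\<in>space M. t < X \<omega>} \<omega> \<partial>M) \<partial>lborel)"
  proof (rule Fubini')
    show "(\<lambda>(t, \<omega>). indicator {0..} t * indicator {\<omega>\<in>space M. t < X \<omega>} \<omega> :: ennreal)
        \<in> borel_measurable (lborel \<Otimes>\<^sub>M M)"
      unfolding indicator_def by measurable
  qed
  also have "\<dots> = (\<integral>\<^sup>+t. emeasure M {\<omega>\<in>space M. t < X \<omega>} * indicator {0..} t \<partial>lborel)"
    by (intro nn_integral_cong) (simp add: nn_integral_cmult mult.commute)
  finally show ?thesis .
qed

text \<open>An antiderivative of \<open>1 - Phi t\<close> is \<open>t * (1 - Phi t) - phi t\<close>, and it vanishes at infinity.\<close>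

lemma nn_integral_Phi_tail:
  "(\<integral>\<^sup>+t. ennreal (1 - Phi t) * indicator {0..} t \<partial>lborel) = ennreal (1 / sqrt (2 * pi))"
proof -
  have "(\<integral>\<^sup>+t. ennreal (1 - Phi t) * indicator {0..} t \<partial>lborel) = ennreal (0 - (0 * (1 - Phi 0) - phi 0))"
  proof (rule nn_integral_FTC_atLeast[where F="\<lambda>t. t * (1 - Phi t) - phi t" and T=0 and a=0])
    show "((\<lambda>t. t * (1 - Phi t) - phi t) has_real_derivative 1 - Phi x) (at x)" for x
      by (auto intro!: derivative_eq_intros simp: algebra_simps)
    show "0 \<le> 1 - Phi x" for x using Phi_bounds[of x] by simp
    have "((\<lambda>t. t * (1 - Phi t)) \<longlongrightarrow> 0) at_top"
    proof (rule Lim_null_comparison)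
      show "\<forall>\<^sub>F t in at_top. norm (t * (1 - Phi t)) \<le> t * (1/2 * exp (- t\<^sup>2 / 2))"
        using eventually_ge_at_top[of 0]
      proof eventually_elim
        case (elim t)
        have "t * (1 - Phi t) \<le> t * (1/2 * exp (- t\<^sup>2 / 2))"
          by (intro mult_left_mono Phi_tail_exp_half elim)
        then show ?case using elim Phi_bounds[of t] by simp
      qed
      show "((\<lambda>t::real. t * (1/2 * exp (- t\<^sup>2 / 2))) \<longlongrightarrow> 0) at_top" by real_asymp
    qed
    moreover have "(phi \<longlongrightarrow> 1 / sqrt (2 * pi) * 0) at_top"
      unfolding std_normal_density_def by (intro tendsto_mult tendsto_const exp_square_decay)
    ultimately show "((\<lambda>t. t * (1 - Phi t) - phi t) \<longlongrightarrow> 0) at_top"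
      using tendsto_diff by fastforce
  qed measurable
  then show ?thesis by (simp add: std_normal_density_def)
qed

text \<open>A nonnegative variable whose tail is dominated by that of a standard normal has expectation at most that
  of the positive part of the normal variable.\<close>

lemma (in prob_space) expectation_le_of_Phi_tail:
  fixes X :: "'a \<Rightarrow> real"
  assumes [measurable]: "X \<in> borel_measurable M" and nonneg: "\<And>\<omega>. \<omega> \<in> space M \<Longrightarrow> 0 \<le> X \<omega>"
    and tail: "\<And>t. 0 \<le> t \<Longrightarrow> Phi t \<le> prob {\<omega>\<in>space M. X \<omega> \<le> t}"
  shows "integrable M X" "expectation X \<le> 1 / sqrt (2 * pi)"
proof -
  have "(\<integral>\<^sup>+\<omega>. ennreal (X \<omega>) \<partial>M) \<le> (\<integral>\<^sup>+t. ennreal (1 - Phi t) * indicator {0..} t \<partial>lborel)"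
    unfolding nn_integral_layer_cake[OF sigma_finite_measure_axioms assms(1)]
  proof (rule nn_integral_mono)
    fix t
    have "prob {\<omega>\<in>space M. t < X \<omega>} = 1 - prob {\<omega>\<in>space M. X \<omega> \<le> t}"
      by (subst prob_compl[symmetric]) (auto intro!: arg_cong[where f=prob])
    then have "emeasure M {\<omega>\<in>space M. t < X \<omega>} \<le> ennreal (1 - Phi t)" if "0 \<le> t"
      using tail[OF that] by (simp add: emeasure_eq_measure ennreal_leI)
    then show "emeasure M {\<omega>\<in>space M. t < X \<omega>} * indicator {0..} t \<le> ennreal (1 - Phi t) * indicator {0..} t"
      by (auto simp: indicator_def)
  qed
  also have "\<dots> = ennreal (1 / sqrt (2 * pi))" by (rule nn_integral_Phi_tail)
  finally have le: "(\<integral>\<^sup>+\<omega>. ennreal (X \<omega>) \<partial>M) \<le> ennreal (1 / sqrt (2 * pi))" .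
  show int: "integrable M X"
    by (rule integrableI_nonneg) (use nonneg le in \<open>auto intro!: AE_I2 le_less_trans[OF le]\<close>)
  have "ennreal (expectation X) \<le> ennreal (1 / sqrt (2 * pi))"
    using le nonneg int by (subst nn_integral_eq_integral[symmetric]) (auto intro!: AE_I2)
  then show "expectation X \<le> 1 / sqrt (2 * pi)" by (simp add: ennreal_le_iff)
qed

lemma PiM_gauss_density:
  "PiM Basis (\<lambda>_. gauss) = density (PiM Basis (\<lambda>_. lborel)) (\<lambda>x. ennreal (\<Prod>b\<in>Basis. phi (x b)))"
  (is "_ = ?D")
proof -
  interpret G: product_sigma_finite "\<lambda>_::'a. gauss"
    using prob_space_gauss by (auto simp: product_sigma_finite_def intro: prob_space_imp_sigma_finite)
  interpret L: product_sigma_finite "\<lambda>_::'a. lborel :: real measure" ..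
  have [measurable]: "(\<lambda>x. phi (x b)) \<in> borel_measurable (PiM Basis (\<lambda>_. lborel :: real measure))"
    if "b \<in> Basis" for b :: 'a
    using that by measurable
  have "?D = PiM Basis (\<lambda>_. gauss)"
  proof (rule G.PiM_eqI)
    show "sets ?D = sets (PiM Basis (\<lambda>_. gauss))"
      by (simp cong: sets_PiM_cong)
    fix A :: "'a \<Rightarrow> real set"
    assume A: "\<And>b. b \<in> Basis \<Longrightarrow> A b \<in> sets gauss"
    then have A' [measurable]: "A b \<in> sets borel" if "b \<in> Basis" for b using that by simp
    have PA: "PiE Basis A \<in> sets (PiM Basis (\<lambda>_. lborel :: real measure))"
      using A by (intro sets_PiM_I_finite) auto
    have "emeasure ?D (PiE Basis A)
      = (\<integral>\<^sup>+x. ennreal (\<Prod>b\<in>Basis. phi (x b)) * indicator (PiE Basis A) x \<partial>PiM Basis (\<lambda>_. lborel))"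
      by (rule emeasure_density[OF _ PA]) measurable
    also have "\<dots> = (\<integral>\<^sup>+x. (\<Prod>b\<in>Basis. ennreal (phi (x b)) * indicator (A b) (x b)) \<partial>PiM Basis (\<lambda>_. lborel))"
    proof (rule nn_integral_cong)
      fix x :: "'a \<Rightarrow> real"
      assume x: "x \<in> space (PiM Basis (\<lambda>_. lborel))"
      have "(indicator (PiE Basis A) x :: ennreal) = (\<Prod>b\<in>Basis. indicator (A b) (x b))"
        using x by (auto simp: indicator_def space_PiM PiE_def Pi_iff prod_zero_iff)
      then show "ennreal (\<Prod>b\<in>Basis. phi (x b)) * indicator (PiE Basis A) x
        = (\<Prod>b\<in>Basis. ennreal (phi (x b)) * indicator (A b) (x b))"
        by (simp add: prod.distrib prod_ennreal)
    qed
    also have "\<dots> = (\<Prod>b\<in>Basis. \<integral>\<^sup>+t. ennreal (phi t) * indicator (A b) t \<partial>lborel)"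
      by (rule L.product_nn_integral_prod) (auto intro!: borel_measurable_times_ennreal borel_measurable_indicator)
    also have "\<dots> = (\<Prod>b\<in>Basis. emeasure gauss (A b))"
      using A' by (intro prod.cong refl emeasure_density[symmetric]) auto
    finally show "emeasure ?D (PiE Basis A) = (\<Prod>b\<in>Basis. emeasure gauss (A b))" .
  qed simp
  then show ?thesis by simp
qed

lemma basis_comb_component: "b \<in> Basis \<Longrightarrow> basis_comb x \<bullet> b = x b"
  unfolding basis_comb_def by (simp add: inner_sum_left inner_Basis if_distrib cong: if_cong)

lemma prod_phi: "(\<Prod>b\<in>Basis. phi (x \<bullet> b)) = exp (- (norm (x::'a::euclidean_space))\<^sup>2 / 2) / sqrt (2 * pi) ^ DIM('a)"
proof -
  have "(\<Prod>b\<in>Basis. phi (x \<bullet> b)) = (1 / sqrt (2 * pi)) ^ DIM('a) * (\<Prod>b\<in>Basis. exp (- (x \<bullet> b)\<^sup>2 / 2))"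
    unfolding std_normal_density_def prod.distrib by simp
  also have "(\<Prod>b\<in>Basis. exp (- (x \<bullet> b)\<^sup>2 / 2)) = exp (\<Sum>b\<in>Basis. - (x \<bullet> b)\<^sup>2 / 2)"
    by (simp add: exp_sum)
  also have "(\<Sum>b\<in>Basis. - (x \<bullet> b)\<^sup>2 / 2) = - (norm x)\<^sup>2 / 2"
    by (simp add: norm_sq_sum_Basis sum_negf sum_divide_distrib)
  finally show ?thesis by (simp add: power_divide)
qed

lemma std_gauss_density:
  "(std_gauss :: 'a::euclidean_space measure)
    = density lborel (\<lambda>x. ennreal (exp (- (norm x)\<^sup>2 / 2) / sqrt (2 * pi) ^ DIM('a)))"
proof -
  have bc: "basis_comb \<in> borel_measurable (PiM Basis (\<lambda>_. lborel :: real measure))"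
    unfolding basis_comb_def[abs_def] by measurable
  have "(std_gauss :: 'a measure) = distr (density (PiM Basis (\<lambda>_. lborel))
      (\<lambda>x. ennreal (\<Prod>b\<in>Basis. phi (basis_comb x \<bullet> b)))) borel basis_comb"
    unfolding std_gauss_def PiM_gauss_density by (simp add: basis_comb_component)
  also have "\<dots> = density (distr (PiM Basis (\<lambda>_. lborel)) borel basis_comb) (\<lambda>x. ennreal (\<Prod>b\<in>Basis. phi (x \<bullet> b)))"
    by (rule density_distr[symmetric, OF _ bc]) measurable
  also have "distr (PiM Basis (\<lambda>_. lborel)) borel basis_comb = (lborel :: 'a measure)"
    unfolding basis_comb_def[abs_def] by (rule lborel_eq[symmetric])
  finally show ?thesis by (simp add: prod_phi)
qed

lemma std_gauss_scaled:
  assumes "c \<noteq> 0"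
  shows "distr (std_gauss :: 'a::euclidean_space measure) borel (\<lambda>x. c *\<^sub>R x)
    = density lborel (\<lambda>x. ennreal (exp (- (norm x)\<^sup>2 / (2 * c\<^sup>2)) / sqrt (2 * pi * c\<^sup>2) ^ DIM('a)))"
    (is "_ = density lborel ?f")
proof -
  have "density (lborel :: 'a measure) ?f = density (density (distr lborel borel (\<lambda>x. 0 + c *\<^sub>R x)) (\<lambda>_. ennreal (\<bar>c\<bar> ^ DIM('a)))) ?f"
    using lborel_affine[OF assms, of "0::'a"] by simp
  also have "\<dots> = density (distr lborel borel (\<lambda>x. c *\<^sub>R x)) (\<lambda>x. ennreal (\<bar>c\<bar> ^ DIM('a)) * ?f x)"
    by (subst density_density_eq) auto
  also have "\<dots> = distr (density lborel (\<lambda>x. ennreal (\<bar>c\<bar> ^ DIM('a)) * ?f (c *\<^sub>R x))) borel (\<lambda>x. c *\<^sub>R x)"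
    by (rule density_distr) measurable
  also have "(\<lambda>x. ennreal (\<bar>c\<bar> ^ DIM('a)) * ?f (c *\<^sub>R x))
    = (\<lambda>x :: 'a. ennreal (exp (- (norm x)\<^sup>2 / 2) / sqrt (2 * pi) ^ DIM('a)))"
  proof
    fix x :: 'a
    have "\<bar>c\<bar> ^ DIM('a) * (exp (- (norm (c *\<^sub>R x))\<^sup>2 / (2 * c\<^sup>2)) / sqrt (2 * pi * c\<^sup>2) ^ DIM('a))
      = exp (- (norm x)\<^sup>2 / 2) / sqrt (2 * pi) ^ DIM('a)"
      using assms by (simp add: power_mult_distrib real_sqrt_mult)
    then show "ennreal (\<bar>c\<bar> ^ DIM('a)) * ?f (c *\<^sub>R x) = ennreal (exp (- (norm x)\<^sup>2 / 2) / sqrt (2 * pi) ^ DIM('a))"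
      by (subst ennreal_mult[symmetric]) simp_all
  qed
  finally show ?thesis by (simp add: std_gauss_density)
qed

lemma std_gauss_uminus: "distr (std_gauss :: 'a::euclidean_space measure) borel uminus = std_gauss"
  using std_gauss_scaled[of "- 1", where 'a='a] by (simp add: std_gauss_density)

text \<open>A half-space through the origin has measure at least \<open>1/2\<close> by symmetry, and its \<open>t\<close>-neighbourhood lies in
  the half-space at distance \<open>t\<close>; isoperimetry then replaces the computation of the law of \<open>a \<bullet> x\<close>.\<close>

lemma std_gauss_halfspace:
  fixes a :: "'a::euclidean_space"
  assumes t: "0 \<le> t"
  shows "Phi t \<le> measure std_gauss {x. a \<bullet> x \<le> t * norm a}"
proof -
  interpret prob_space "std_gauss :: 'a measure" by (rule prob_space_std_gauss)
  let ?H = "{x. a \<bullet> x \<le> 0}"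
  have "measure std_gauss ?H = measure (distr std_gauss borel uminus) ?H"
    by (simp add: std_gauss_uminus)
  also have "\<dots> = measure std_gauss {x. 0 \<le> a \<bullet> x}"
    by (subst measure_distr) (auto simp: vimage_def intro!: borel_closed closed_halfspace_le)
  finally have eq: "measure std_gauss ?H = measure std_gauss {x. 0 \<le> a \<bullet> x}" .
  have "1 = measure std_gauss (?H \<union> {x. 0 \<le> a \<bullet> x})"
    using prob_space by (simp add: Un_def linear flip: UNIV_def)
  also have "\<dots> \<le> measure std_gauss ?H + measure std_gauss {x. 0 \<le> a \<bullet> x}"
    by (rule measure_Un_le) (auto intro!: borel_closed closed_halfspace_le closed_halfspace_ge)
  finally have half: "1/2 \<le> measure std_gauss ?H" using eq by simp
  interpret H: closed_convex ?H
    by unfold_locales (auto intro: closed_halfspace_le convex_halfspace_le exI[of _ 0])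
  have "Phi t = Phi (inv Phi (1/2) + t)"
    by (simp flip: Phi_zero)
  also have "\<dots> \<le> measure std_gauss {x. infdist x ?H \<le> t}"
    using half t by (intro H.gaussian_isoperimetry) auto
  also have "\<dots> \<le> measure std_gauss {x. a \<bullet> x \<le> t * norm a}"
  proof (rule finite_measure_mono)
    show "{x. infdist x ?H \<le> t} \<subseteq> {x. a \<bullet> x \<le> t * norm a}"
    proof clarsimp
      fix x
      assume "infdist x ?H \<le> t"
      then have "norm (H.resid x) \<le> t" by (simp add: H.norm_resid)
      then have "norm a * norm (H.resid x) \<le> norm a * t" by (intro mult_left_mono) auto
      moreover have "a \<bullet> H.resid x \<le> norm a * norm (H.resid x)" by (rule norm_cauchy_schwarz)
      moreover have "a \<bullet> closest_point ?H x \<le> 0"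
        using closest_point_in_set[OF H.closed_C H.C_nonempty, of x] by simp
      ultimately show "a \<bullet> x \<le> t * norm a"
        by (simp add: H.resid_def inner_diff_right mult.commute)
    qed
  qed (auto intro!: borel_closed closed_halfspace_le)
  finally show ?thesis .
qed

text \<open>Union bound over the two sides of each slab, each of probability at most \<open>1 / (4 * p)\<close>.\<close>

lemma std_gauss_slabs:
  fixes a :: "'j::finite \<Rightarrow> 'a::euclidean_space"
  assumes p: "2 \<le> CARD('j)" and a: "\<And>j. sqrt (2 * ln (real CARD('j))) * norm (a j) \<le> \<tau>"
  shows "1/2 \<le> measure std_gauss {x. \<forall>j. \<bar>a j \<bullet> x\<bar> \<le> \<tau>}"
proof -
  interpret prob_space "std_gauss :: 'a measure" by (rule prob_space_std_gauss)
  let ?p = "real CARD('j)"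
  let ?t = "sqrt (2 * ln ?p)"
  have t: "0 \<le> ?t" using p by simp
  have closed_le: "{x. b \<bullet> x \<le> s} \<in> sets std_gauss" for b :: 'a and s
    by (auto intro!: borel_closed closed_halfspace_le)
  have open_gt: "{x. s < b \<bullet> x} \<in> sets std_gauss" for b :: 'a and s
    by (auto intro!: borel_open open_halfspace_gt)
  have tail: "prob {x. \<tau> < b \<bullet> x} \<le> 1 / (4 * ?p)" if "?t * norm b \<le> \<tau>" for b
  proof -
    have "Phi ?t \<le> prob {x. b \<bullet> x \<le> ?t * norm b}" by (rule std_gauss_halfspace[OF t])
    also have "\<dots> \<le> prob {x. b \<bullet> x \<le> \<tau>}"
      using that closed_le by (intro finite_measure_mono) auto
    also have "\<dots> = 1 - prob {x. \<tau> < b \<bullet> x}"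
      using prob_compl[OF open_gt[of \<tau> b]] by (simp add: Compl_eq_Diff_UNIV[symmetric] Collect_neg_eq[symmetric] not_less)
    finally show ?thesis using Phi_tail_union_bound[of ?p] p by simp
  qed
  let ?B = "\<lambda>j. {x. \<tau> < a j \<bullet> x} \<union> {x. \<tau> < (- a j) \<bullet> x}"
  have B: "?B j \<in> sets std_gauss" for j using open_gt by blast
  have "prob (\<Union>j. ?B j) \<le> (\<Sum>j\<in>UNIV. prob (?B j))"
    by (rule finite_measure_subadditive_finite) (use B in auto)
  also have "\<dots> \<le> (\<Sum>j\<in>(UNIV::'j set). 1 / (2 * ?p))"
  proof (rule sum_mono)
    fix j
    have "prob (?B j) \<le> prob {x. \<tau> < a j \<bullet> x} + prob {x. \<tau> < (- a j) \<bullet> x}"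
      by (rule measure_Un_le[OF open_gt open_gt])
    also have "\<dots> \<le> 1 / (4 * ?p) + 1 / (4 * ?p)"
      using a[of j] by (intro add_mono tail) auto
    finally show "prob (?B j) \<le> 1 / (2 * ?p)" by simp
  qed
  also have "\<dots> = 1/2" by simp
  finally have "prob (\<Union>j. ?B j) \<le> 1/2" .
  moreover have "prob {x. \<forall>j. \<bar>a j \<bullet> x\<bar> \<le> \<tau>} = 1 - prob (\<Union>j. ?B j)"
  proof -
    have "{x. \<forall>j. \<bar>a j \<bullet> x\<bar> \<le> \<tau>} = space std_gauss - (\<Union>j. ?B j)"
      by (auto simp: abs_le_iff) (metis not_less)+
    then show ?thesis using B by (subst prob_compl[symmetric]) auto
  qed
  ultimately show ?thesis by simp
qed

section \<open>The LASSO\<close>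

lemma scaled_norm_eq: "scaled_norm (u :: real ^ 'n::finite) = norm u / sqrt (real CARD('n))"
  by (simp add: scaled_norm_def norm_vec_def L2_set_def real_sqrt_mult real_sqrt_divide)

lemma scaled_norm_sq: "(scaled_norm (u :: real ^ 'n::finite))\<^sup>2 = (norm u)\<^sup>2 / real CARD('n)"
  by (simp add: scaled_norm_eq power_divide)

lemma scaled_norm_nonneg: "0 \<le> scaled_norm u"
  by (simp add: scaled_norm_eq)

lemma l1_norm_convex:
  fixes b d :: "real ^ 'p::finite"
  assumes "0 \<le> s" "s \<le> 1"
  shows "l1_norm (b + s *\<^sub>R (d - b)) \<le> (1 - s) * l1_norm b + s * l1_norm d"
proof -
  have "\<bar>(b + s *\<^sub>R (d - b)) $ j\<bar> \<le> (1 - s) * \<bar>b $ j\<bar> + s * \<bar>d $ j\<bar>" for j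
  proof -
    have "(b + s *\<^sub>R (d - b)) $ j = (1 - s) * b $ j + s * d $ j" by (simp add: algebra_simps)
    then have "\<bar>(b + s *\<^sub>R (d - b)) $ j\<bar> \<le> \<bar>(1 - s) * b $ j\<bar> + \<bar>s * d $ j\<bar>"
      by (simp only: abs_triangle_ineq)
    then show ?thesis using assms by (simp add: abs_mult)
  qed
  then have "l1_norm (b + s *\<^sub>R (d - b)) \<le> (\<Sum>j\<in>UNIV. (1 - s) * \<bar>b $ j\<bar> + s * \<bar>d $ j\<bar>)"
    unfolding l1_norm_def by (intro sum_mono)
  then show ?thesis by (simp add: l1_norm_def sum.distrib sum_distrib_left)
qed

lemma nonneg_slope:
  fixes G Q :: real
  assumes "\<And>s. 0 < s \<Longrightarrow> s \<le> 1 \<Longrightarrow> 0 \<le> s * G + s\<^sup>2 * Q"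
  shows "0 \<le> G"
proof (rule tendsto_lowerbound)
  show "((\<lambda>s. G + s * Q) \<longlongrightarrow> G) (at_right 0)"
    by (auto intro!: tendsto_eq_intros)
  show "\<forall>\<^sub>F s in at_right 0. 0 \<le> G + s * Q"
  proof (rule eventually_at_rightI[of 0 1])
    fix s :: real
    assume s: "s \<in> {0<..<1}"
    then have "0 \<le> s * (G + s * Q)"
      using assms[of s] by (simp add: algebra_simps power2_eq_square)
    then show "0 \<le> G + s * Q" using s by (simp add: zero_le_mult_iff)
  qed simp
qed simp

text \<open>Moving from a minimiser towards \<open>d\<close> by a fraction \<open>s\<close> cannot decrease the objective. The first-order term in \<open>s\<close> is
  therefore nonnegative, and the second-order term of the quadratic loss remains as a bonus.\<close>

lemma lasso_strong_optimality:
  fixes X :: "real ^ 'p::finite ^ 'n::finite"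
  assumes b: "b \<in> lasso X y lam" and lam: "0 \<le> lam"
  shows "(norm (y - X *v b))\<^sup>2 + 2 * real CARD('n) * lam * l1_norm b + (norm (X *v (d - b)))\<^sup>2
    \<le> (norm (y - X *v d))\<^sup>2 + 2 * real CARD('n) * lam * l1_norm d"
proof -
  let ?n = "real CARD('n)"
  let ?r = "y - X *v b" and ?h = "X *v (d - b)"
  have min: "(norm (y - X *v b))\<^sup>2 + 2 * ?n * lam * l1_norm b \<le> (norm (y - X *v c))\<^sup>2 + 2 * ?n * lam * l1_norm c" for c
  proof -
    have "(scaled_norm (y - X *v b))\<^sup>2 + 2 * lam * l1_norm b \<le> (scaled_norm (y - X *v c))\<^sup>2 + 2 * lam * l1_norm c"
      using b by (simp add: lasso_def is_arg_min_linorder)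
    then have "?n * ((scaled_norm (y - X *v b))\<^sup>2 + 2 * lam * l1_norm b)
        \<le> ?n * ((scaled_norm (y - X *v c))\<^sup>2 + 2 * lam * l1_norm c)"
      by (intro mult_left_mono) auto
    then show ?thesis by (simp add: scaled_norm_sq algebra_simps)
  qed
  have expand: "(norm (y - X *v (b + s *\<^sub>R (d - b))))\<^sup>2 = (norm ?r)\<^sup>2 - 2 * s * (?r \<bullet> ?h) + s\<^sup>2 * (norm ?h)\<^sup>2" for s
  proof -
    have "y - X *v (b + s *\<^sub>R (d - b)) = ?r - s *\<^sub>R ?h"
      using linear_add[OF matrix_vector_mul_linear[of X]] linear_scale[OF matrix_vector_mul_linear[of X]] by simp
    moreover have "(norm (r - s *\<^sub>R h))\<^sup>2 = (norm r)\<^sup>2 - 2 * s * (r \<bullet> h) + s\<^sup>2 * (norm h)\<^sup>2"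
      for r h :: "real ^ 'n"
      unfolding power2_norm_eq_inner
      by (simp add: inner_diff_left inner_diff_right inner_commute[of h r] power2_eq_square algebra_simps)
    ultimately show ?thesis by (simp only:)
  qed
  have "0 \<le> 2 * ?n * lam * (l1_norm d - l1_norm b) - 2 * (?r \<bullet> ?h)"
  proof (rule nonneg_slope)
    fix s :: real
    assume s: "0 < s" "s \<le> 1"
    have "2 * ?n * lam * l1_norm (b + s *\<^sub>R (d - b)) \<le> 2 * ?n * lam * ((1 - s) * l1_norm b + s * l1_norm d)"
      using s lam by (intro mult_left_mono l1_norm_convex) auto
    then show "0 \<le> s * (2 * ?n * lam * (l1_norm d - l1_norm b) - 2 * (?r \<bullet> ?h)) + s\<^sup>2 * (norm ?h)\<^sup>2"
      using min[of "b + s *\<^sub>R (d - b)"] unfolding expand by (simp add: algebra_simps)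
  qed
  then show ?thesis
    using expand[of 1] by (simp add: algebra_simps)
qed

text \<open>Add the strong optimality inequalities of both estimators, each with the other as competitor; the
  penalties cancel. In particular the fitted vector does not depend on the choice of minimiser.\<close>

lemma lasso_fit_lipschitz:
  fixes X :: "real ^ 'p::finite ^ 'n::finite"
  assumes "b1 \<in> lasso X y1 lam" "b2 \<in> lasso X y2 lam" "0 \<le> lam"
  shows "norm (X *v b1 - X *v b2) \<le> norm (y1 - y2)"
proof -
  let ?p = "X *v b1" and ?q = "X *v b2"
  have d: "X *v (b2 - b1) = ?q - ?p" "X *v (b1 - b2) = ?p - ?q"
    by (simp_all add: matrix_vector_mult_diff_distrib)
  have "(norm (y1 - ?p))\<^sup>2 + (norm (?q - ?p))\<^sup>2 + (norm (y2 - ?q))\<^sup>2 + (norm (?p - ?q))\<^sup>2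
      \<le> (norm (y1 - ?q))\<^sup>2 + (norm (y2 - ?p))\<^sup>2"
    using lasso_strong_optimality[OF assms(1,3), of b2] lasso_strong_optimality[OF assms(2,3), of b1]
    unfolding d by linarith
  then have "(norm (?p - ?q))\<^sup>2 \<le> (y1 - y2) \<bullet> (?p - ?q)"
    by (simp add: power2_norm_eq_inner inner_diff_left inner_diff_right inner_commute algebra_simps)
  also have "\<dots> \<le> norm (y1 - y2) * norm (?p - ?q)" by (rule norm_cauchy_schwarz)
  finally have "norm (?p - ?q) * norm (?p - ?q) \<le> norm (y1 - y2) * norm (?p - ?q)"
    by (simp add: power2_eq_square)
  then show ?thesis
    by (cases "?p = ?q") (simp_all add: mult_le_cancel_right)
qed

lemma l1_norm_restrict_split:
  "l1_norm u = l1_norm (restrict_vec u S) + l1_norm (restrict_vec u (- S))"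
  unfolding l1_norm_def restrict_vec_def
  by (subst sum.distrib[symmetric], rule sum.cong) auto

lemma l1_norm_nonneg: "0 \<le> l1_norm u"
  by (simp add: l1_norm_def sum_nonneg)

lemma l1_norm_support_diff:
  "l1_norm d - l1_norm b
    \<le> l1_norm (restrict_vec (b - d) (Supp d)) - l1_norm (restrict_vec (b - d) (- Supp d))"
  unfolding l1_norm_def sum_subtractf[symmetric]
  by (rule sum_mono) (auto simp: restrict_vec_def Supp_def)

lemma l1_norm_restrict_le: "l1_norm (restrict_vec u S) \<le> sqrt (real (card S)) * norm u"
proof -
  have "l1_norm (restrict_vec u S) = (\<Sum>j\<in>S. \<bar>1\<bar> * \<bar>u $ j\<bar>)"
    unfolding l1_norm_def restrict_vec_def
    by (rule sum.mono_neutral_cong_right) auto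
  also have "\<dots> \<le> L2_set (\<lambda>_. 1) S * L2_set (\<lambda>j. u $ j) S" by (rule L2_set_mult_ineq)
  also have "\<dots> \<le> sqrt (real (card S)) * norm u"
  proof -
    have "L2_set (\<lambda>j. u $ j) S \<le> norm u"
      unfolding norm_vec_def L2_set_def by (intro real_sqrt_le_mono) (auto intro!: sum_mono2)
    then show ?thesis by (simp add: L2_set_constant mult_left_mono)
  qed
  finally show ?thesis .
qed

lemma inner_matrix_vector_le:
  fixes X :: "real ^ 'p::finite ^ 'n::finite"
  assumes "\<And>j. \<bar>column j X \<bullet> z\<bar> \<le> m"
  shows "z \<bullet> (X *v u) \<le> m * l1_norm u"
proof -
  have "z \<bullet> (X *v u) = (\<Sum>j\<in>UNIV. (column j X \<bullet> z) * u $ j)"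
    unfolding dot_lmul_matrix[symmetric]
    by (simp add: inner_vec_def vector_matrix_mult_def column_def mult.commute)
  also have "\<dots> \<le> (\<Sum>j\<in>UNIV. m * \<bar>u $ j\<bar>)"
  proof (rule sum_mono)
    fix j
    have "(column j X \<bullet> z) * u $ j \<le> \<bar>column j X \<bullet> z\<bar> * \<bar>u $ j\<bar>"
      by (metis abs_ge_self abs_mult)
    also have "\<dots> \<le> m * \<bar>u $ j\<bar>" by (intro mult_right_mono assms) simp
    finally show "(column j X \<bullet> z) * u $ j \<le> m * \<bar>u $ j\<bar>" .
  qed
  finally show ?thesis by (simp add: l1_norm_def sum_distrib_left)
qed

text \<open>The competitor \<open>d\<close> and the vector \<open>z\<close> of small correlations are arbitrary. With \<open>D = \<parallel>X u\<parallel>\<close> and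
  \<open>E = \<parallel>\<xi> - z\<parallel> + sqrt n * a\<close> the basic inequality reads \<open>A\<^sup>2 + D\<^sup>2 \<le> B\<^sup>2 + 2 * E * D\<close>, and
  \<open>2 * E * D \<le> E\<^sup>2 + D\<^sup>2\<close>. The constant \<open>a\<close> stands for \<open>3 * lam * sqrt \<bar>S\<bar> / (2 * \<kappa>)\<close>; stating its defining property
  instead of its value also covers an infinite \<open>\<kappa>\<close>, where \<open>a = 0\<close>.\<close>

lemma lasso_oracle_inequality:
  fixes X :: "real ^ 'p::finite ^ 'n::finite" and f \<xi> z :: "real ^ 'n"
  assumes b: "b \<in> lasso X (f + \<xi>) lam" and lam: "0 \<le> lam"
    and noise: "\<And>j. \<bar>column j X \<bullet> z\<bar> \<le> real CARD('n) * lam / 2"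
    and a: "0 \<le> a"
    and compat: "\<And>\<Delta>. l1_norm (restrict_vec \<Delta> (- Supp d)) \<le> 3 * l1_norm (restrict_vec \<Delta> (Supp d)) \<Longrightarrow>
      3 * lam * l1_norm (restrict_vec \<Delta> (Supp d)) \<le> 2 * a * scaled_norm (X *v \<Delta>)"
  shows "scaled_norm (X *v b - f) \<le> scaled_norm (X *v d - f) + a + norm (\<xi> - z) / sqrt (real CARD('n))"
proof -
  let ?n = "real CARD('n)"
  define u where "u = b - d"
  define A B D W where "A = norm (X *v b - f)" and "B = norm (X *v d - f)"
    and "D = norm (X *v u)" and "W = norm (\<xi> - z)"
  have nn: "0 \<le> A" "0 \<le> B" "0 \<le> D" "0 \<le> W" by (simp_all add: A_def B_def D_def W_def)
  have n: "0 < ?n" by simp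
  let ?uS = "l1_norm (restrict_vec u (Supp d))" and ?uC = "l1_norm (restrict_vec u (- Supp d))"
  have Xu: "X *v u = X *v b - X *v d" "X *v (d - b) = - (X *v u)"
    by (simp_all add: u_def matrix_vector_mult_diff_distrib)
  have "(norm (f + \<xi> - X *v b))\<^sup>2 + 2 * ?n * lam * l1_norm b + D\<^sup>2
      \<le> (norm (f + \<xi> - X *v d))\<^sup>2 + 2 * ?n * lam * l1_norm d"
    using lasso_strong_optimality[OF b lam, of d] unfolding Xu(2) by (simp add: D_def)
  moreover have expand: "(norm (f + \<xi> - X *v c))\<^sup>2 = (norm (X *v c - f))\<^sup>2 - 2 * (\<xi> \<bullet> (X *v c - f)) + (norm \<xi>)\<^sup>2" for c
    by (simp add: power2_norm_eq_inner inner_diff_left inner_diff_right inner_add_left inner_add_right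
        inner_commute algebra_simps)
  moreover have "\<xi> \<bullet> (X *v u) = \<xi> \<bullet> (X *v b - f) - \<xi> \<bullet> (X *v d - f)"
    by (simp add: Xu(1) inner_diff_right)
  ultimately have basic: "A\<^sup>2 + D\<^sup>2 \<le> B\<^sup>2 + 2 * (\<xi> \<bullet> (X *v u)) + 2 * ?n * lam * (l1_norm d - l1_norm b)"
    unfolding A_def B_def right_diff_distrib using expand[of b] expand[of d] by linarith
  have "\<xi> \<bullet> (X *v u) = z \<bullet> (X *v u) + (\<xi> - z) \<bullet> (X *v u)" by (simp add: inner_diff_left)
  also have "\<dots> \<le> ?n * lam / 2 * l1_norm u + W * D"
    unfolding W_def D_def by (intro add_mono inner_matrix_vector_le noise norm_cauchy_schwarz)
  finally have noise_term: "\<xi> \<bullet> (X *v u) \<le> ?n * lam / 2 * l1_norm u + W * D" .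
  have "2 * ?n * lam * (l1_norm d - l1_norm b) \<le> 2 * ?n * lam * (?uS - ?uC)"
    using l1_norm_support_diff[of d b] lam unfolding u_def by (intro mult_left_mono) auto
  with basic noise_term have "A\<^sup>2 + D\<^sup>2 \<le> B\<^sup>2 + 2 * W * D + ?n * lam * (?uS + ?uC) + 2 * ?n * lam * (?uS - ?uC)"
    unfolding l1_norm_restrict_split[of u "Supp d"] by (simp add: algebra_simps)
  then have main: "A\<^sup>2 + D\<^sup>2 \<le> B\<^sup>2 + 2 * W * D + ?n * (lam * (3 * ?uS - ?uC))"
    by (simp add: algebra_simps)
  have pen: "lam * (3 * ?uS - ?uC) \<le> 2 * a * (D / sqrt ?n)"
  proof (cases "?uC \<le> 3 * ?uS")
    case True
    have "lam * (3 * ?uS - ?uC) \<le> 3 * lam * ?uS"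
      using lam l1_norm_nonneg[of "restrict_vec u (- Supp d)"] by (simp add: algebra_simps)
    also have "\<dots> \<le> 2 * a * (D / sqrt ?n)"
      using compat[OF True] by (simp add: scaled_norm_eq D_def)
    finally show ?thesis .
  next
    case False
    then have "lam * (3 * ?uS - ?uC) \<le> 0" using lam by (intro mult_nonneg_nonpos) auto
    also have "0 \<le> 2 * a * (D / sqrt ?n)" using a nn by simp
    finally show ?thesis .
  qed
  define E where "E = W + sqrt ?n * a"
  have E: "0 \<le> E" using nn a by (simp add: E_def)
  have "?n * (lam * (3 * ?uS - ?uC)) \<le> ?n * (2 * a * (D / sqrt ?n))"
    by (intro mult_left_mono pen) simp
  also have "?n * (2 * a * (D / sqrt ?n)) = 2 * (sqrt ?n * a) * D"
    using real_div_sqrt[of ?n] by (simp add: mult_ac field_simps)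
  finally have "A\<^sup>2 \<le> B\<^sup>2 + 2 * E * D - D\<^sup>2"
    using main by (simp add: E_def algebra_simps)
  also have "\<dots> \<le> B\<^sup>2 + E\<^sup>2"
    using zero_le_power2[of "E - D"] by (simp add: power2_diff algebra_simps)
  also have "\<dots> \<le> (B + E)\<^sup>2" using nn E by (simp add: power2_sum)
  finally have "A \<le> B + E" by (rule power2_le_imp_le) (use nn E in simp)
  then have "A / sqrt ?n \<le> (B + E) / sqrt ?n" by (intro divide_right_mono) auto
  also have "\<dots> = B / sqrt ?n + a + W / sqrt ?n"
    by (simp add: E_def add_divide_distrib)
  finally show ?thesis by (simp add: scaled_norm_eq A_def B_def W_def)
qed

lemma restricted_eigenvalue_le:
  assumes "l1_norm (restrict_vec \<Delta> (- S)) \<le> c\<^sub>0 * l1_norm (restrict_vec \<Delta> S)"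
    and k: "restricted_eigenvalue X S c\<^sub>0 = ereal k"
  shows "k * norm \<Delta> \<le> scaled_norm (X *v \<Delta>)"
proof (cases "\<Delta> = 0")
  case False
  have k0: "0 \<le> k" using restricted_eigenvalue_nonneg[of X S c\<^sub>0] k by simp
  have "ereal (k\<^sup>2) = restricted_eigenvalue_sq X S c\<^sub>0"
    using restricted_eigenvalue_square[of X S c\<^sub>0] k by simp
  also have "\<dots> \<le> ereal ((scaled_norm (X *v \<Delta>))\<^sup>2 / (norm \<Delta>)\<^sup>2)"
    unfolding restricted_eigenvalue_sq_def by (rule INF_lower) (use assms False in auto)
  finally have "(k * norm \<Delta>)\<^sup>2 \<le> (scaled_norm (X *v \<Delta>))\<^sup>2"
    using False by (simp add: field_simps)
  then show ?thesis by (rule power2_le_imp_le) (rule scaled_norm_nonneg)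
qed (simp add: scaled_norm_nonneg)

lemma restricted_eigenvalue_infinite:
  assumes "l1_norm (restrict_vec \<Delta> (- S)) \<le> c\<^sub>0 * l1_norm (restrict_vec \<Delta> S)"
    and inf: "restricted_eigenvalue X S c\<^sub>0 = \<infinity>"
  shows "\<Delta> = 0"
proof (rule ccontr)
  assume "\<Delta> \<noteq> 0"
  have "\<infinity> = restricted_eigenvalue_sq X S c\<^sub>0"
    using restricted_eigenvalue_square[of X S c\<^sub>0] inf by (simp add: power2_eq_square)
  also have "\<dots> \<le> ereal ((scaled_norm (X *v \<Delta>))\<^sup>2 / (norm \<Delta>)\<^sup>2)"
    unfolding restricted_eigenvalue_sq_def by (rule INF_lower) (use assms \<open>\<Delta> \<noteq> 0\<close> in auto)
  finally show False by simp
qed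

lemma restricted_eigenvalue_empty: "restricted_eigenvalue X {} c\<^sub>0 \<noteq> 0"
proof
  assume 0: "restricted_eigenvalue X {} c\<^sub>0 = 0"
  have "\<Delta> = 0" if "l1_norm (restrict_vec \<Delta> (- {})) \<le> c\<^sub>0 * l1_norm (restrict_vec \<Delta> {})" for \<Delta> :: "real ^ 'a"
    using that by (simp add: l1_norm_def restrict_vec_def vec_eq_iff sum_nonneg_eq_0_iff order_antisym_conv sum_nonneg)
  then have no_dir: "{\<Delta> :: real ^ 'a. \<Delta> \<noteq> 0 \<and> l1_norm (restrict_vec \<Delta> (- {})) \<le> c\<^sub>0 * l1_norm (restrict_vec \<Delta> {})} = {}"
    by blast
  have "restricted_eigenvalue_sq X {} c\<^sub>0 = \<infinity>"
    unfolding restricted_eigenvalue_sq_def no_dir by (simp add: top_ereal_def)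
  then show False using restricted_eigenvalue_square[of X "{}" c\<^sub>0] 0 by (simp add: power2_eq_square)
qed

text \<open>For \<open>\<kappa> = 0\<close> the set \<open>S\<close> is nonempty and its term of the bound is infinite; for \<open>\<kappa> = \<infinity>\<close> the cone contains
  only \<open>0\<close> and the term vanishes.\<close>

lemma lasso_oracle_bound:
  fixes X :: "real ^ 'p::finite ^ 'n::finite" and f \<xi> z :: "real ^ 'n"
  assumes b: "b \<in> lasso X (f + \<xi>) lam" and lam: "0 < lam"
    and noise: "\<And>j. \<bar>column j X \<bullet> z\<bar> \<le> real CARD('n) * lam / 2"
  shows "ereal (scaled_norm (X *v b - f)) \<le> oracle_bound X f lam + ereal (norm (\<xi> - z) / sqrt (real CARD('n)))"
proof -
  let ?A = "scaled_norm (X *v b - f)" and ?w = "norm (\<xi> - z) / sqrt (real CARD('n))"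
  let ?I = "\<lambda>S. INF d \<in> {d. Supp d = S}. ereal (scaled_norm (X *v d - f))"
  let ?t = "\<lambda>S. ereal (3 * lam * sqrt (real (card S))) / (2 * restricted_eigenvalue X S 3)"
  have "oracle_bound X f lam \<in> range (\<lambda>S. ?I S + ?t S)"
    unfolding oracle_bound_def by (rule Min_in) auto
  then obtain S where S: "oracle_bound X f lam = ?I S + ?t S" by auto
  have I0: "0 \<le> ?I S" by (rule INF_greatest) (simp add: scaled_norm_nonneg)
  have fin: "ereal ?A \<le> ?I S + ereal a + ereal ?w"
    if a: "0 \<le> a" and compat: "\<And>\<Delta>. l1_norm (restrict_vec \<Delta> (- S)) \<le> 3 * l1_norm (restrict_vec \<Delta> S) \<Longrightarrow>
      3 * lam * l1_norm (restrict_vec \<Delta> S) \<le> 2 * a * scaled_norm (X *v \<Delta>)" for a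
  proof -
    have "ereal (?A - a - ?w) \<le> ?I S"
    proof (rule INF_greatest)
      fix d :: "real ^ 'p"
      assume "d \<in> {d. Supp d = S}"
      then have "?A \<le> scaled_norm (X *v d - f) + a + ?w"
        using lasso_oracle_inequality[OF b _ noise a, of d] compat lam by simp
      then show "ereal (?A - a - ?w) \<le> ereal (scaled_norm (X *v d - f))" by simp
    qed
    then show ?thesis by (cases "?I S") auto
  qed
  show ?thesis
  proof (cases "restricted_eigenvalue X S 3")
    case (real k)
    have k0: "0 \<le> k" using restricted_eigenvalue_nonneg[of X S 3] real by simp
    show ?thesis
    proof (cases "k = 0")
      case True
      then have "S \<noteq> {}" using restricted_eigenvalue_empty[of X 3] real by auto
      then have "0 < 3 * lam * sqrt (real (card S))" using lam by (simp add: card_gt_0_iff)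
      then have "?t S = \<infinity>"
        using real True lam \<open>S \<noteq> {}\<close> by (simp add: zero_ereal_def[symmetric] divide_ereal_def)
      then show ?thesis using I0 unfolding S by (cases "?I S") auto
    next
      case False
      then have k: "0 < k" using k0 by simp
      let ?a = "3 * lam * sqrt (real (card S)) / (2 * k)"
      have t: "?t S = ereal ?a" using real k by simp
      have "ereal ?A \<le> ?I S + ereal ?a + ereal ?w"
      proof (rule fin)
        show "0 \<le> ?a" using lam k by simp
        fix \<Delta> :: "real ^ 'p"
        assume cone: "l1_norm (restrict_vec \<Delta> (- S)) \<le> 3 * l1_norm (restrict_vec \<Delta> S)"
        have "k * l1_norm (restrict_vec \<Delta> S) \<le> k * (sqrt (real (card S)) * norm \<Delta>)"
          using k by (intro mult_left_mono l1_norm_restrict_le) simp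
        also have "\<dots> = sqrt (real (card S)) * (k * norm \<Delta>)" by simp
        also have "\<dots> \<le> sqrt (real (card S)) * scaled_norm (X *v \<Delta>)"
          by (intro mult_left_mono restricted_eigenvalue_le[OF cone real]) simp
        finally have "3 * lam * (k * l1_norm (restrict_vec \<Delta> S)) \<le> 3 * lam * (sqrt (real (card S)) * scaled_norm (X *v \<Delta>))"
          using lam by (intro mult_left_mono) auto
        then show "3 * lam * l1_norm (restrict_vec \<Delta> S) \<le> 2 * ?a * scaled_norm (X *v \<Delta>)"
          using k by (simp add: field_simps)
      qed
      then show ?thesis unfolding S t .
    qed
  next
    case PInf
    have "ereal ?A \<le> ?I S + ereal 0 + ereal ?w"
    proof (rule fin)
      fix \<Delta> :: "real ^ 'p"
      assume "l1_norm (restrict_vec \<Delta> (- S)) \<le> 3 * l1_norm (restrict_vec \<Delta> S)"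
      then have "\<Delta> = 0" using PInf by (rule restricted_eigenvalue_infinite)
      then show "3 * lam * l1_norm (restrict_vec \<Delta> S) \<le> 2 * 0 * scaled_norm (X *v \<Delta>)"
        by (simp add: l1_norm_def restrict_vec_def cong: if_cong)
    qed simp
    moreover have "?t S = ereal 0" using PInf by (simp add: zero_ereal_def[symmetric])
    ultimately show ?thesis unfolding S by simp
  next
    case MInf
    then show ?thesis using restricted_eigenvalue_nonneg[of X S 3] by simp
  qed
qed

text \<open>The selection \<open>\<beta>\<close> may be non-measurable, but the fitted vector is a Lipschitz function of the
  observation. That function is needed only on the image of the observation, which may itself fail to be
  a Borel set.\<close>

lemma borel_measurable_lasso_fit:
  fixes X :: "real ^ 'p::finite ^ 'n::finite" and y :: "'a \<Rightarrow> real ^ 'n"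
  assumes y: "y \<in> borel_measurable M" and lam: "0 \<le> lam"
    and fit: "\<And>\<omega>. \<omega> \<in> space M \<Longrightarrow> \<beta> \<omega> \<in> lasso X (y \<omega>) lam"
  shows "(\<lambda>\<omega>. X *v \<beta> \<omega>) \<in> borel_measurable M"
proof -
  define T where "T v = X *v \<beta> (SOME \<omega>. \<omega> \<in> space M \<and> y \<omega> = v)" for v
  have pick: "(SOME \<omega>'. \<omega>' \<in> space M \<and> y \<omega>' = y \<omega>) \<in> space M \<and> y (SOME \<omega>'. \<omega>' \<in> space M \<and> y \<omega>' = y \<omega>) = y \<omega>"
    if "\<omega> \<in> space M" for \<omega>
    by (rule someI[of _ \<omega>]) (use that in auto)
  have eq: "T (y \<omega>) = X *v \<beta> \<omega>" if "\<omega> \<in> space M" for \<omega>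
  proof -
    have "norm (T (y \<omega>) - X *v \<beta> \<omega>) \<le> norm (y \<omega> - y \<omega>)"
      unfolding T_def using pick[OF that] fit that
      by (intro lasso_fit_lipschitz[OF _ _ lam]) (metis, metis)
    then show ?thesis by simp
  qed
  have "continuous_on (y ` space M) T"
  proof (rule continuous_onI)
    fix v e :: "_"
    assume "v \<in> y ` space M" and e: "0 < (e::real)"
    then obtain \<omega> where \<omega>: "\<omega> \<in> space M" "v = y \<omega>" by auto
    show "\<exists>d>0. \<forall>v'\<in>y ` space M. dist v' v < d \<longrightarrow> dist (T v') (T v) \<le> e"
    proof (intro exI[of _ e] conjI ballI impI e)
      fix v'
      assume "v' \<in> y ` space M" and d: "dist v' v < e"
      then obtain \<omega>' where \<omega>': "\<omega>' \<in> space M" "v' = y \<omega>'" by auto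
      have "dist (T v') (T v) \<le> dist v' v"
        unfolding \<omega>(2) \<omega>'(2) eq[OF \<omega>(1)] eq[OF \<omega>'(1)] dist_norm
        by (rule lasso_fit_lipschitz[OF fit[OF \<omega>'(1)] fit[OF \<omega>(1)] lam])
      with d show "dist (T v') (T v) \<le> e" by simp
    qed
  qed
  then have "T \<in> borel_measurable (restrict_space borel (y ` space M))"
    by (rule borel_measurable_continuous_on_restrict)
  moreover have "y \<in> measurable M (restrict_space borel (y ` space M))"
    by (rule measurable_restrict_space2[OF _ y]) auto
  ultimately have "(\<lambda>\<omega>. T (y \<omega>)) \<in> borel_measurable M"
    by (rule measurable_compose[rotated])
  then show ?thesis
    by (rule measurable_cong[THEN iffD1, rotated]) (rule eq)
qed

lemma distr_standardised:
  fixes \<xi> :: "'a \<Rightarrow> real ^ 'n::finite"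
  assumes \<xi>: "distributed M lborel \<xi> (\<lambda>x. ennreal (isotropic_normal_density \<sigma> x))" and \<sigma>: "0 < \<sigma>"
  shows "distr M borel (\<lambda>\<omega>. (1 / \<sigma>) *\<^sub>R \<xi> \<omega>) = std_gauss"
proof -
  have meas: "\<xi> \<in> borel_measurable M" using distributed_measurable[OF \<xi>] by simp
  have "distr M borel \<xi> = distr M lborel \<xi>" by (rule distr_cong) simp_all
  also have "\<dots> = distr std_gauss borel (\<lambda>x. \<sigma> *\<^sub>R x)"
    using distributed_distr_eq_density[OF \<xi>] std_gauss_scaled[of \<sigma>, where 'a="real ^ 'n"] \<sigma>
    by (simp add: isotropic_normal_density_def)
  finally have law: "distr M borel \<xi> = distr std_gauss borel (\<lambda>x. \<sigma> *\<^sub>R x)" .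
  have "distr M borel (\<lambda>\<omega>. (1 / \<sigma>) *\<^sub>R \<xi> \<omega>) = distr (distr M borel \<xi>) borel (\<lambda>x. (1 / \<sigma>) *\<^sub>R x)"
    using meas by (subst distr_distr) (auto simp: comp_def)
  also have "\<dots> = distr std_gauss borel (\<lambda>x. x)"
    unfolding law using \<sigma> by (subst distr_distr) (auto simp: comp_def)
  also have "\<dots> = std_gauss" by (rule distr_id2) simp
  finally show ?thesis .
qed

lemma norm_column_sq: "((1 / c) *\<^sub>R (transpose X ** X)) $ j $ j = (norm (column j X))\<^sup>2 / c"
  by (simp add: matrix_matrix_mult_def transpose_def column_def power2_norm_eq_inner inner_vec_def)

theorem theorem2:
  fixes M :: "'a measure"
    and f :: "real ^ 'n::finite"
    and \<xi> y :: "'a \<Rightarrow> real ^ 'n"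
    and X :: "real ^ 'p::finite ^ 'n"
    and \<sigma> lam :: real
    and \<beta>hat :: "'a \<Rightarrow> real ^ 'p"
  assumes "prob_space M"
    and "\<sigma> > 0"
    and "distributed M lborel \<xi> (\<lambda>x. ennreal (isotropic_normal_density \<sigma> x))"
    and "\<And>\<omega>. \<omega> \<in> space M \<Longrightarrow> y \<omega> = f + \<xi> \<omega>"
    and "CARD('p) \<ge> 2"
    and "lam \<ge> 2 * \<sigma> * sqrt (2 * ln (real CARD('p)) / real CARD('n))"
    and "\<And>j. ((1 / real CARD('n)) *\<^sub>R (transpose X ** X)) $ j $ j \<le> 1"
    and "\<And>\<omega>. \<omega> \<in> space M \<Longrightarrow> \<beta>hat \<omega> \<in> lasso X (y \<omega>) lam"
  shows "(\<forall>\<delta>. 0 < \<delta> \<and> \<delta> < 1 \<longrightarrow>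
            \<P>(\<omega> in M. ereal (scaled_norm (X *v \<beta>hat \<omega> - f))
                 \<le> oracle_bound X f lam
                   + ereal (\<sigma> * max 0 (inv Phi (1 - \<delta>)) / sqrt (real CARD('n)))) \<ge> 1 - \<delta>
            \<and> inv Phi (1 - \<delta>) \<le> sqrt (2 * ln (1 / \<delta>)))
       \<and> integrable M (\<lambda>\<omega>. scaled_norm (X *v \<beta>hat \<omega> - f))
       \<and> ereal (\<integral>\<omega>. scaled_norm (X *v \<beta>hat \<omega> - f) \<partial>M)
           \<le> oracle_bound X f lam + ereal (\<sigma> / sqrt (2 * pi * real CARD('n)))"
proof -
  interpret prob_space M by (rule assms(1))
  note \<sigma> = assms(2) and lasso = assms(8)
  let ?n = "real CARD('n)" and ?p = "real CARD('p)"
  define A where "A \<omega> = scaled_norm (X *v \<beta>hat \<omega> - f)" for \<omega>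
  define Z where "Z \<omega> = (1 / \<sigma>) *\<^sub>R \<xi> \<omega>" for \<omega>
  \<comment> \<open>Everything is rescaled by \<open>\<sigma>\<close> so that the noise is standard Gaussian.\<close>
  define \<tau> where "\<tau> = ?n * lam / (2 * \<sigma>)"
  define C where "C = {x. \<forall>j. \<bar>column j X \<bullet> x\<bar> \<le> \<tau>}"
  define w where "w \<omega> = infdist (Z \<omega>) C" for \<omega>
  have n: "0 < ?n" by simp
  have lam: "0 < lam"
  proof -
    have "0 < 2 * \<sigma> * sqrt (2 * ln ?p / ?n)" using \<sigma> assms(5) by simp
    with assms(6) show ?thesis by linarith
  qed
  have \<tau>0: "0 \<le> \<tau>" using lam \<sigma> by (simp add: \<tau>_def)
  have Z_meas [measurable]: "Z \<in> borel_measurable M"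
    using distributed_measurable[OF assms(3)] unfolding Z_def[abs_def]
    by (intro borel_measurable_scaleR borel_measurable_const) simp
  have Z_law: "distr M borel Z = std_gauss"
    using distr_standardised[OF assms(3) \<sigma>] by (simp add: Z_def[abs_def])
  have w_meas [measurable]: "w \<in> borel_measurable M"
    unfolding w_def[abs_def]
    by (rule measurable_compose[OF Z_meas]) (intro borel_measurable_continuous_onI continuous_intros)
  have "closed C"
    unfolding C_def by (intro closed_Collect_all closed_Collect_le continuous_intros)
  moreover have "convex C"
  proof -
    have "C = (\<Inter>j. {x. column j X \<bullet> x \<le> \<tau>} \<inter> {x. - \<tau> \<le> column j X \<bullet> x})"
      by (auto simp: C_def abs_le_iff minus_le_iff)
    then show ?thesis by (auto intro!: convex_INT convex_Int convex_halfspace_le convex_halfspace_ge)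
  qed
  moreover have "0 \<in> C" using \<tau>0 by (simp add: C_def)
  ultimately interpret C: closed_convex C by unfold_locales auto
  have C_half: "1/2 \<le> measure std_gauss C"
    unfolding C_def
  proof (rule std_gauss_slabs[OF assms(5)])
    fix j
    have "(norm (column j X))\<^sup>2 \<le> ?n"
      using assms(7)[of j] n unfolding norm_column_sq by (simp add: divide_le_eq)
    then have "norm (column j X) \<le> sqrt ?n" by (rule real_le_rsqrt)
    then have "sqrt (2 * ln ?p) * norm (column j X) \<le> sqrt (2 * ln ?p) * sqrt ?n"
      using assms(5) by (intro mult_left_mono) auto
    also have "\<dots> = ?n * (2 * \<sigma> * sqrt (2 * ln ?p / ?n)) / (2 * \<sigma>)"
      using \<sigma> real_div_sqrt[of ?n] by (simp add: real_sqrt_divide field_simps)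
    also have "\<dots> \<le> \<tau>"
      unfolding \<tau>_def using assms(6) \<sigma> by (intro divide_right_mono mult_left_mono) auto
    finally show "sqrt (2 * ln ?p) * norm (column j X) \<le> \<tau>" .
  qed
  have tail: "Phi t \<le> prob {\<omega>\<in>space M. w \<omega> \<le> t}" if "0 \<le> t" for t
  proof -
    have "Phi t = Phi (inv Phi (1/2) + t)" by (simp flip: Phi_zero)
    also have "\<dots> \<le> measure std_gauss {x. infdist x C \<le> t}"
      using C_half that by (intro C.gaussian_isoperimetry) auto
    also have "\<dots> = prob {\<omega>\<in>space M. w \<omega> \<le> t}"
      unfolding Z_law[symmetric]
      by (subst measure_distr)
         (auto simp: w_def vimage_def Int_def conj_commute
           intro!: borel_closed closed_Collect_le continuous_intros arg_cong[where f=prob])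
    finally show ?thesis .
  qed
  \<comment> \<open>The projection of the noise on the set of noise vectors of small correlation.\<close>
  define z where "z \<omega> = \<sigma> *\<^sub>R closest_point C (Z \<omega>)" for \<omega>
  have noise: "\<bar>column j X \<bullet> z \<omega>\<bar> \<le> ?n * lam / 2" for j \<omega>
  proof -
    have "closest_point C (Z \<omega>) \<in> C" by (rule closest_point_in_set[OF C.closed_C C.C_nonempty])
    then have "\<sigma> * \<bar>column j X \<bullet> closest_point C (Z \<omega>)\<bar> \<le> \<sigma> * \<tau>"
      using \<sigma> by (intro mult_left_mono) (auto simp: C_def)
    also have "\<sigma> * \<tau> = ?n * lam / 2" using \<sigma> by (simp add: \<tau>_def)
    finally show ?thesis using \<sigma> by (simp add: z_def abs_mult)
  qed
  have dist: "norm (\<xi> \<omega> - z \<omega>) = \<sigma> * w \<omega>" for \<omega>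
  proof -
    have "\<xi> \<omega> - z \<omega> = \<sigma> *\<^sub>R C.resid (Z \<omega>)"
      using \<sigma> by (simp add: z_def Z_def C.resid_def scaleR_diff_right)
    then show ?thesis using \<sigma> by (simp add: C.norm_resid w_def)
  qed
  have lasso': "\<beta>hat \<omega> \<in> lasso X (f + \<xi> \<omega>) lam" if "\<omega> \<in> space M" for \<omega>
    using lasso[OF that] assms(4)[OF that] by simp
  have fit_le: "ereal (A \<omega>) \<le> oracle_bound X f lam + ereal (\<sigma> * w \<omega> / sqrt ?n)" if "\<omega> \<in> space M" for \<omega>
    using lasso_oracle_bound[OF lasso'[OF that] lam noise[of _ \<omega>]] by (simp add: A_def dist)
  have y_meas: "y \<in> borel_measurable M"
  proof -
    have "\<xi> \<in> borel_measurable M" using distributed_measurable[OF assms(3)] by simp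
    then have "(\<lambda>\<omega>. f + \<xi> \<omega>) \<in> borel_measurable M" by measurable
    then show ?thesis by (rule measurable_cong[THEN iffD2, rotated]) (rule assms(4))
  qed
  have A_meas [measurable]: "A \<in> borel_measurable M"
    using borel_measurable_lasso_fit[OF y_meas less_imp_le[OF lam] lasso]
    unfolding A_def[abs_def] scaled_norm_eq by measurable
  have w_exp: "integrable M w" "expectation w \<le> 1 / sqrt (2 * pi)"
  proof -
    have "0 \<le> w \<omega>" for \<omega> by (simp add: w_def infdist_nonneg)
    then show "integrable M w" "expectation w \<le> 1 / sqrt (2 * pi)"
      using expectation_le_of_Phi_tail[OF w_meas _ tail] by auto
  qed
  \<comment> \<open>The competitor \<open>0\<close> gives an integrable majorant.\<close>
  have A_int: "integrable M A"
  proof (rule Bochner_Integration.integrable_bound[OF _ A_meas])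
    show "integrable M (\<lambda>\<omega>. scaled_norm (X *v 0 - f) + 0 + \<sigma> * w \<omega> / sqrt ?n)"
      using w_exp(1) by simp
    show "AE \<omega> in M. norm (A \<omega>) \<le> norm (scaled_norm (X *v 0 - f) + 0 + \<sigma> * w \<omega> / sqrt ?n)"
    proof (rule AE_I2)
      fix \<omega>
      assume "\<omega> \<in> space M"
      then have "A \<omega> \<le> scaled_norm (X *v 0 - f) + 0 + \<sigma> * w \<omega> / sqrt ?n"
        unfolding A_def dist[symmetric]
        by (intro lasso_oracle_inequality[OF lasso' _ noise])
           (use lam in \<open>auto simp: Supp_def l1_norm_def restrict_vec_def\<close>)
      then show "norm (A \<omega>) \<le> norm (scaled_norm (X *v 0 - f) + 0 + \<sigma> * w \<omega> / sqrt ?n)"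
        by (simp add: A_def scaled_norm_nonneg)
    qed
  qed
  have prob_part: "1 - \<delta> \<le> prob {\<omega>\<in>space M. ereal (A \<omega>) \<le> oracle_bound X f lam
      + ereal (\<sigma> * max 0 (inv Phi (1 - \<delta>)) / sqrt ?n)}" if \<delta>: "0 < \<delta>" "\<delta> < 1" for \<delta>
  proof -
    let ?t = "max 0 (inv Phi (1 - \<delta>))"
    have "1 - \<delta> = Phi (inv Phi (1 - \<delta>))" using \<delta> by (simp add: Phi_inv_Phi)
    also have "\<dots> \<le> Phi ?t" by simp
    also have "\<dots> \<le> prob {\<omega>\<in>space M. w \<omega> \<le> ?t}" by (rule tail) simp
    also have "\<dots> \<le> prob {\<omega>\<in>space M. ereal (A \<omega>) \<le> oracle_bound X f lam + ereal (\<sigma> * ?t / sqrt ?n)}"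
    proof (rule finite_measure_mono)
      show "{\<omega>\<in>space M. w \<omega> \<le> ?t} \<subseteq> {\<omega>\<in>space M. ereal (A \<omega>) \<le> oracle_bound X f lam + ereal (\<sigma> * ?t / sqrt ?n)}"
      proof safe
        fix \<omega>
        assume \<omega>: "\<omega> \<in> space M" and "w \<omega> \<le> ?t"
        then have "ereal (\<sigma> * w \<omega> / sqrt ?n) \<le> ereal (\<sigma> * ?t / sqrt ?n)"
          using \<sigma> by (simp add: divide_right_mono mult_left_mono)
        with fit_le[OF \<omega>] show "ereal (A \<omega>) \<le> oracle_bound X f lam + ereal (\<sigma> * ?t / sqrt ?n)"
          by (meson add_left_mono order_trans)
      qed
    qed measurable
    finally show ?thesis .
  qed
  have exp_part: "ereal (expectation A) \<le> oracle_bound X f lam + ereal (\<sigma> / sqrt (2 * pi * ?n))"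
  proof (cases "oracle_bound X f lam")
    case (real r)
    have "expectation A \<le> expectation (\<lambda>\<omega>. r + \<sigma> * w \<omega> / sqrt ?n)"
    proof (rule integral_mono[OF A_int])
      show "integrable M (\<lambda>\<omega>. r + \<sigma> * w \<omega> / sqrt ?n)" using w_exp(1) by simp
      show "A \<omega> \<le> r + \<sigma> * w \<omega> / sqrt ?n" if "\<omega> \<in> space M" for \<omega>
        using fit_le[OF that] real by simp
    qed
    also have "\<dots> = r + \<sigma> * expectation w / sqrt ?n"
      using w_exp(1) by (simp add: prob_space)
    also have "\<dots> \<le> r + \<sigma> * (1 / sqrt (2 * pi)) / sqrt ?n"
      using w_exp(2) \<sigma> by (intro add_left_mono divide_right_mono mult_left_mono) auto
    also have "\<dots> = r + \<sigma> / sqrt (2 * pi * ?n)" by (simp add: real_sqrt_mult)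
    finally show ?thesis using real by simp
  next
    case MInf
    obtain \<omega> where "\<omega> \<in> space M" using not_empty by blast
    from fit_le[OF this] MInf show ?thesis by simp
  qed simp
  show ?thesis
    using prob_part exp_part A_int inv_Phi_upper_tail unfolding A_def[abs_def] by blast
qed

end
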